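(* Let $D$ and $B$ be operators in $L_2(\mathbf R^n;\mathbf C^N)$ as in the context. There is a constant $C<\infty$ such that the following holds. Let $\eta\in C_0^\infty(\mathbf R^{1+n})$ and let $v$ be a function solving $\partial_tv+BDv=0$ on a neighbourhood of $\mathrm{supp}\,\eta$. Then $$\iint|Dv(t,x)|^2|\eta(t,x)|^2\,dt\,dx\le C\iint|v(t,x)|^2|\nabla\eta(t,x)|^2\,dt\,dx.$$
   Context: Let $n,N\ge1$, and let $L_2(\mathbf R^n;\mathbf C^N)$ have norm $\|\cdot\|_2$ and inner product $(\cdot,\cdot)$. $D$ is a constant coefficient homogeneous first order differential operator (a sum $\sum_{j=1}^nM_j\partial_j$ with constant matrices $M_j\in\mathcal L(\mathbf C^N)$), self-adjoint in $L_2(\mathbf R^n;\mathbf C^N)$, with $\|Df\|_2\ge c\|\nabla f\|_2$ for all $f\in\mathrm{ran}(D)\cap\mathrm{dom}(D)$, for some $c>0$. $B$ is multiplication by a matrix function $B\in L_\infty(\mathbf R^n;\mathcal L(\mathbf C^N))$ (independent of $t$), with $\mathrm{Re}(Bf,f)\ge c\|f\|_2^2$ for all $f\in\mathrm{ran}(D)$, for some $c>0$. Points of $\mathbf R^{1+n}$ are written $(t,x)$, $t\in\mathbf R$, $x\in\mathbf R^n$; $D$ and $B$ act in the $x$ variable, and $\nabla\eta=\nabla_{t,x}\eta$ is the full gradient. A function $v$ solves $\partial_tv+BDv=0$ on an open set if $v$ and $Dv$ (distributional) belong to $L_2^{\mathrm{loc}}$ there, with values in $\mathbf C^N$, and the equation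 holds in the distributional sense. *)

theory Defs
  imports "HOL-Analysis.Analysis"
begin

section \<open>Test functions\<close>

primrec Ck :: "nat \<Rightarrow> ('a::euclidean_space \<Rightarrow> 'b::real_normed_vector) \<Rightarrow> bool" where
  "Ck 0 f \<longleftrightarrow> continuous_on UNIV f"
| "Ck (Suc k) f \<longleftrightarrow> f differentiable_on UNIV
     \<and> (\<forall>e\<in>Basis. Ck k (\<lambda>z. frechet_derivative f (at z) e))"

definition smooth :: "('a::euclidean_space \<Rightarrow> 'b::real_normed_vector) \<Rightarrow> bool" where
  "smooth f \<longleftrightarrow> (\<forall>k. Ck k f)"

definition supp :: "('a::topological_space \<Rightarrow> 'b::zero) \<Rightarrow> 'a set" where
  "supp f = closure {z. f z \<noteq> 0}"

definition test_function :: "'a::euclidean_space set \<Rightarrow> ('a \<Rightarrow> 'b::real_normed_vector) \<Rightarrow> bool" where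
  "test_function \<Omega> \<phi> \<longleftrightarrow> smooth \<phi> \<and> compact (supp \<phi>) \<and> supp \<phi> \<subseteq> \<Omega>"

definition grad_norm :: "('a::euclidean_space \<Rightarrow> 'b::real_normed_vector) \<Rightarrow> 'a \<Rightarrow> real" where
  "grad_norm f z = sqrt (\<Sum>e\<in>Basis. (norm (frechet_derivative f (at z) e))\<^sup>2)"


section \<open>Lebesgue spaces\<close>

text \<open>Elements of \<open>L\<^sub>2\<close>, \<open>L\<^sub>2\<^sup>loc\<close> and \<open>L\<^sub>\<infinity>\<close> are represented by functions; nothing below
  distinguishes functions that agree almost everywhere.\<close>

definition L2 :: "('a::euclidean_space \<Rightarrow> 'b::euclidean_space) set" where
  "L2 = {f. f \<in> borel_measurable lebesgue \<and> integrable lebesgue (\<lambda>x. (norm (f x))\<^sup>2)}"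

definition L2_loc :: "'a::euclidean_space set \<Rightarrow> ('a \<Rightarrow> 'b::euclidean_space) set" where
  "L2_loc \<Omega> = {f. f \<in> borel_measurable (lebesgue_on \<Omega>)
     \<and> (\<forall>K. compact K \<and> K \<subseteq> \<Omega> \<longrightarrow> set_integrable lebesgue K (\<lambda>x. (norm (f x))\<^sup>2))}"

definition Linfty :: "('a::euclidean_space \<Rightarrow> 'b::euclidean_space) set" where
  "Linfty = {f. f \<in> borel_measurable lebesgue \<and> (\<exists>K. AE x in lebesgue. norm (f x) \<le> K)}"

definition L2_norm :: "('a::euclidean_space \<Rightarrow> 'b::euclidean_space) \<Rightarrow> real" where
  "L2_norm f = sqrt (LINT x|lebesgue. (norm (f x))\<^sup>2)"

text \<open>The class operation \<open>\<bullet>\<close> on \<open>complex ^ 'N\<close> is only the real part of the Hermitian product.\<close>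

definition L2_inner :: "('a::euclidean_space \<Rightarrow> complex ^ 'N) \<Rightarrow> ('a \<Rightarrow> complex ^ 'N) \<Rightarrow> complex" where
  "L2_inner f g = (LINT x|lebesgue. (\<Sum>i\<in>UNIV. f x $ i * cnj (g x $ i)))"


section \<open>Distributional derivatives\<close>

text \<open>\<open>\<partial>\<^sub>e u = g\<close> in the sense of distributions on \<open>\<Omega>\<close>.\<close>

definition weak_deriv ::
    "'a::euclidean_space set \<Rightarrow> 'a \<Rightarrow> ('a \<Rightarrow> 'b::euclidean_space) \<Rightarrow> ('a \<Rightarrow> 'b) \<Rightarrow> bool" where
  "weak_deriv \<Omega> e u g \<longleftrightarrow> (\<forall>\<phi> :: 'a \<Rightarrow> real. test_function \<Omega> \<phi> \<longrightarrow>
     (LINT z|lebesgue. \<phi> z *\<^sub>R g z)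
       = - (LINT z|lebesgue. frechet_derivative \<phi> (at z) e *\<^sub>R u z))"

text \<open>\<open>\<Sum>\<^sub>j M\<^sub>j \<partial>\<^bsub>e j\<^esub> u = g\<close> in the sense of distributions on \<open>\<Omega>\<close>; the individual
  distributions \<open>\<partial>\<^bsub>e j\<^esub> u\<close> need not be functions.\<close>

definition weak_diffop ::
    "'a::euclidean_space set \<Rightarrow> ('n::finite \<Rightarrow> 'a) \<Rightarrow> ('n \<Rightarrow> complex ^ 'N ^ 'N)
      \<Rightarrow> ('a \<Rightarrow> complex ^ 'N) \<Rightarrow> ('a \<Rightarrow> complex ^ 'N) \<Rightarrow> bool" where
  "weak_diffop \<Omega> e M u g \<longleftrightarrow> (\<forall>\<phi> :: 'a \<Rightarrow> real. test_function \<Omega> \<phi> \<longrightarrow>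
     (LINT z|lebesgue. \<phi> z *\<^sub>R g z)
       = - (LINT z|lebesgue. (\<Sum>j\<in>UNIV. frechet_derivative \<phi> (at z) (e j) *\<^sub>R (M j *v u z))))"

definition weak_gradient ::
    "(real ^ 'n \<Rightarrow> complex ^ 'N) \<Rightarrow> (real ^ 'n \<Rightarrow> complex ^ 'N ^ 'n) \<Rightarrow> bool" where
  "weak_gradient f G \<longleftrightarrow> (\<forall>j. weak_deriv UNIV (axis j 1) f (\<lambda>x. G x $ j))"


section \<open>Unbounded operators in \<open>L\<^sub>2\<close>\<close>

text \<open>An operator \<open>A\<close> is given by its graph: \<open>A f g\<close> means \<open>f \<in> dom A\<close> and \<open>A f = g\<close>.\<close>

definition op_ran :: "('f \<Rightarrow> 'g \<Rightarrow> bool) \<Rightarrow> 'g set" where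
  "op_ran A = {g. \<exists>f. A f g}"

definition selfadjoint_L2 ::
    "((real ^ 'n \<Rightarrow> complex ^ 'N) \<Rightarrow> (real ^ 'n \<Rightarrow> complex ^ 'N) \<Rightarrow> bool) \<Rightarrow> bool" where
  "selfadjoint_L2 A \<longleftrightarrow>
     (\<forall>f\<in>L2. \<forall>\<epsilon>>0. \<exists>u w. A u w \<and> L2_norm (\<lambda>x. f x - u x) < \<epsilon>) \<and>
     (\<forall>f\<in>L2. \<forall>h\<in>L2. A f h \<longleftrightarrow> (\<forall>u w. A u w \<longrightarrow> L2_inner w f = L2_inner u h))"

text \<open>The operator \<open>D = \<Sum>\<^sub>j M\<^sub>j \<partial>\<^sub>j\<close> in \<open>L\<^sub>2\<close> with its maximal domain
  \<open>{f \<in> L\<^sub>2. D f \<in> L\<^sub>2}\<close>.\<close>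

definition diffop ::
    "('n::finite \<Rightarrow> complex ^ 'N ^ 'N)
      \<Rightarrow> (real ^ 'n \<Rightarrow> complex ^ 'N) \<Rightarrow> (real ^ 'n \<Rightarrow> complex ^ 'N) \<Rightarrow> bool" where
  "diffop M f g \<longleftrightarrow> f \<in> L2 \<and> g \<in> L2 \<and> weak_diffop UNIV (\<lambda>j. axis j 1) M f g"


section \<open>The equation \<open>\<partial>\<^sub>t v + B D v = 0\<close>\<close>

text \<open>\<open>v\<close> solves the equation on \<open>\<Omega>\<close>, and \<open>w\<close> is (a representative of) \<open>D v\<close> there.
  The values of \<open>v\<close> and \<open>w\<close> outside \<open>\<Omega>\<close> are irrelevant.\<close>

definition solves ::
    "('n::finite \<Rightarrow> complex ^ 'N ^ 'N) \<Rightarrow> (real ^ 'n \<Rightarrow> complex ^ 'N ^ 'N) \<Rightarrow> (real \<times> (real ^ 'n)) set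
      \<Rightarrow> (real \<times> (real ^ 'n) \<Rightarrow> complex ^ 'N) \<Rightarrow> (real \<times> (real ^ 'n) \<Rightarrow> complex ^ 'N) \<Rightarrow> bool" where
  "solves M B \<Omega> v w \<longleftrightarrow> v \<in> L2_loc \<Omega> \<and> w \<in> L2_loc \<Omega>
     \<and> weak_diffop \<Omega> (\<lambda>j. (0, axis j 1)) M v w
     \<and> weak_deriv \<Omega> (1, 0) v (\<lambda>(t, x). - (B x *v w (t, x)))"

end

theory Submission
  imports Defs
begin

text \<open>
  Take a real cutoff \<open>\<alpha>\<close> first and put \<open>u = \<alpha> v\<close>. By the product rule \<open>W = D u\<close> and \<open>U = \<partial>\<^sub>t u\<close> are
  \<open>W = \<alpha> D v + h\<close> with \<open>h = \<Sum>\<^sub>j \<partial>\<^sub>j\<alpha> M\<^sub>j v\<close>, and \<open>U = - \<alpha> B D v + \<partial>\<^sub>t\<alpha> v\<close>, so that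
  \<open>B W = g - U\<close> with \<open>g = \<partial>\<^sub>t\<alpha> v + B h\<close>. Both \<open>g\<close> and \<open>h\<close> are bounded pointwise by a constant
  times \<open>\<bar>v\<bar> \<bar>\<nabla>\<alpha>\<bar>\<close>. The slices \<open>W(t, \<cdot>)\<close> belong to the range of \<open>D\<close>, hence
  \<open>c \<parallel>W\<parallel>\<^sup>2 \<le> Re (B W, W) = Re (g, W) - Re (U, W)\<close>. The last term vanishes: \<open>D\<close> is symmetric, so
  \<open>2 Re (\<partial>\<^sub>t u, D u)\<close> is the \<open>t\<close>-derivative of \<open>(u, D u)\<close>, and \<open>u\<close> has bounded support.
  Cauchy-Schwarz gives \<open>\<parallel>W\<parallel> \<le> \<parallel>g\<parallel> / c\<close>, and \<open>\<alpha> D v = W - h\<close>. This is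
  \<open>Caccioppoli_real_cutoff\<close>. A complex \<open>\<eta>\<close> is split into real and imaginary part, because
  \<open>\<bar>\<eta>\<bar>\<^sup>2\<close> and \<open>\<bar>\<nabla>\<eta>\<bar>\<^sup>2\<close> both are sums of the corresponding terms.

  The two relations \<open>Re (U, W) = 0\<close> and \<open>c \<parallel>W\<parallel>\<^sup>2 \<le> Re (B W, W)\<close> (\<open>energy_relations\<close>) need
  justification, since \<open>u\<close> is only a weak solution and the hypotheses on \<open>D\<close> and \<open>B\<close> concern
  functions of \<open>x\<close> alone. Convolution in \<open>(t, x)\<close> with a smooth kernel \<open>\<kappa>\<close> of bounded support
  settles both points: every slice of \<open>\<kappa> \<star> u\<close> lies in the domain of \<open>D\<close> and is mapped to the
  slice of \<open>\<kappa> \<star> W\<close> (\<open>diffop_convolve_slice\<close>), so accretivity can be applied for each \<open>t\<close>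
  and integrated (\<open>mollified_accretive\<close>), while \<open>Re (\<kappa> \<star> U, \<kappa> \<star> W) = 0\<close> follows from
  symmetric difference quotients in \<open>t\<close> (\<open>mollified_time_derivative_orthogonal\<close>). The kernels
  then shrink to a point, with convergence in \<open>L\<^sub>2\<close> (\<open>mollification_tendsto\<close>), which rests on
  continuity of translations. A kernel is obtained from the cutoff itself, as a normalisation of
  \<open>\<alpha>(s \<cdot>)\<^sup>2\<close> with large \<open>s\<close> (\<open>mollifier_exists\<close>).

  The operation \<open>\<bullet>\<close> on \<open>complex ^ 'N\<close> is the real part of the Hermitian product, so real parts
  disappear from the formulas below. All analysis is done with Borel functions and the measure
  \<open>lborel\<close>, where Fubini's theorem for the product \<open>real \<times> real ^ 'n\<close> holds directly; the given
  Lebesgue measurable data are replaced by Borel representatives at the end.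
\<close>

section \<open>Smooth functions and test functions\<close>

lemma Ck_Suc_imp_Ck: "Ck (Suc k) f \<Longrightarrow> Ck k f"
  by (induction k arbitrary: f) (auto intro: differentiable_imp_continuous_on)

lemma smooth_has_derivative:
  assumes "smooth f"
  shows "(f has_derivative frechet_derivative f (at z)) (at z)"
proof -
  have "Ck (Suc 0) f" using assms unfolding smooth_def by blast
  then have "f differentiable (at z)" by (auto simp: differentiable_on_def)
  then show ?thesis by (simp add: frechet_derivative_works)
qed

lemma smooth_continuous_on: "smooth f \<Longrightarrow> continuous_on S f"
  using smooth_has_derivative has_derivative_continuous
  by (metis continuous_at_imp_continuous_on)

lemma smooth_partial:
  assumes "smooth f" "e \<in> Basis"
  shows "smooth (\<lambda>z. frechet_derivative f (at z) e)"
  using assms unfolding smooth_def by (metis Ck.simps(2))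

lemma Ck_differentiable: "Ck (Suc k) f \<Longrightarrow> (f has_derivative frechet_derivative f (at z)) (at z)"
  by (auto simp: differentiable_on_def frechet_derivative_works)

lemma Ck_SucI:
  assumes "\<And>z. (f has_derivative f' z) (at z)"
    and "\<And>e. e \<in> Basis \<Longrightarrow> Ck k (\<lambda>z. f' z e)"
  shows "Ck (Suc k) f"
proof -
  have "frechet_derivative f (at z) = f' z" for z
    using assms(1) frechet_derivative_at by metis
  then show ?thesis
    using assms by (auto simp: differentiable_on_def differentiable_def)
qed

lemma Ck_add: "Ck k f \<Longrightarrow> Ck k g \<Longrightarrow> Ck k (\<lambda>z. f z + g z)"
proof (induction k arbitrary: f g)
  case (Suc k)
  show ?case
    by (rule Ck_SucI, rule has_derivative_add[OF Suc.prems[THEN Ck_differentiable]])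
       (use Suc in auto)
qed (auto intro: continuous_intros)

lemma Ck_mult:
  fixes f g :: "'a::euclidean_space \<Rightarrow> real"
  shows "Ck k f \<Longrightarrow> Ck k g \<Longrightarrow> Ck k (\<lambda>z. f z * g z)"
proof (induction k arbitrary: f g)
  case (Suc k)
  note le = Suc.prems[THEN Ck_Suc_imp_Ck]
  show ?case
    by (rule Ck_SucI, rule has_derivative_mult[OF Suc.prems[THEN Ck_differentiable]])
       (use Suc.prems in \<open>auto intro!: Ck_add Suc.IH le\<close>)
qed (auto intro: continuous_intros)

lemma Ck_bounded_linear_compose:
  "bounded_linear L \<Longrightarrow> Ck k f \<Longrightarrow> Ck k (\<lambda>z. L (f z))"
proof (induction k arbitrary: f)
  case (Suc k)
  show ?case
    by (rule Ck_SucI, rule bounded_linear.has_derivative[OF Suc.prems(1) Ck_differentiable[OF Suc.prems(2)]])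
       (use Suc in auto)
qed (simp add: linear_continuous_on continuous_on_compose2[of UNIV])

lemma Ck_affine_compose:
  fixes f :: "'a::euclidean_space \<Rightarrow> 'b::real_normed_vector"
  shows "Ck k f \<Longrightarrow> Ck k (\<lambda>z. f (a + c *\<^sub>R z))"
proof (induction k arbitrary: f)
  case 0
  then show ?case
    by (auto intro!: continuous_on_compose2[of UNIV f] continuous_intros)
next
  case (Suc k)
  have lin: "linear (frechet_derivative f (at z))" for z
    using Ck_differentiable[OF Suc.prems] has_derivative_linear by blast
  have d: "((\<lambda>z. a + c *\<^sub>R z) has_derivative (\<lambda>h. c *\<^sub>R h)) (at z)" for z :: 'a
    by (auto intro!: derivative_eq_intros)
  have "((\<lambda>z. f (a + c *\<^sub>R z)) has_derivative
      (\<lambda>h. c *\<^sub>R frechet_derivative f (at (a + c *\<^sub>R z)) h)) (at z)" for z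
    using has_derivative_compose[OF d Ck_differentiable[OF Suc.prems]]
    by (simp add: linear_scale[OF lin] o_def)
  moreover have "Ck k (\<lambda>z. c *\<^sub>R frechet_derivative f (at (a + c *\<^sub>R z)) e)" if "e \<in> Basis" for e
    using Suc that by (auto intro!: Ck_bounded_linear_compose[OF bounded_linear_scaleR_right])
  ultimately show ?case by (rule Ck_SucI)
qed

lemma smooth_bounded_linear_compose: "bounded_linear L \<Longrightarrow> smooth f \<Longrightarrow> smooth (\<lambda>z. L (f z))"
  and smooth_affine_compose: "smooth f \<Longrightarrow> smooth (\<lambda>z. f (a + c *\<^sub>R z))"
  by (simp_all add: smooth_def Ck_bounded_linear_compose Ck_affine_compose)

lemma smooth_mult:
  fixes f g :: "'a::euclidean_space \<Rightarrow> real"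
  shows "smooth f \<Longrightarrow> smooth g \<Longrightarrow> smooth (\<lambda>z. f z * g z)"
  by (simp add: smooth_def Ck_mult)

lemma supp_subset_closed: "closed S \<Longrightarrow> (\<And>z. f z \<noteq> 0 \<Longrightarrow> z \<in> S) \<Longrightarrow> supp f \<subseteq> S"
  unfolding supp_def by (rule closure_minimal) auto

lemma not_supp_zero: "z \<notin> supp f \<Longrightarrow> f z = 0"
  using closure_subset[of "{z. f z \<noteq> 0}"] unfolding supp_def by blast

lemma test_functionI:
  assumes "smooth f" "compact S" "S \<subseteq> \<Omega>" "\<And>z. f z \<noteq> 0 \<Longrightarrow> z \<in> S"
  shows "test_function \<Omega> f"
proof -
  have "supp f \<subseteq> S" using assms supp_subset_closed compact_imp_closed by metis
  moreover have "closed (supp f)" by (simp add: supp_def)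
  ultimately show ?thesis
    using assms unfolding test_function_def
    by (metis closed_Int_compact inf.absorb_iff1 order_trans)
qed

lemma test_function_smooth: "test_function \<Omega> f \<Longrightarrow> smooth f"
  by (simp add: test_function_def)

lemma test_function_mult:
  fixes \<phi> \<alpha> :: "'a::euclidean_space \<Rightarrow> real"
  assumes \<phi>: "test_function UNIV \<phi>" and \<alpha>: "test_function S \<alpha>"
  shows "test_function S (\<lambda>z. \<phi> z * \<alpha> z)"
    and "frechet_derivative (\<lambda>z. \<phi> z * \<alpha> z) (at z) e
      = \<phi> z * frechet_derivative \<alpha> (at z) e + frechet_derivative \<phi> (at z) e * \<alpha> z"
proof -
  have sm: "smooth \<phi>" "smooth \<alpha>" using assms by (auto dest: test_function_smooth)
  show "test_function S (\<lambda>z. \<phi> z * \<alpha> z)"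
    by (rule test_functionI[OF smooth_mult[OF sm], of "supp \<alpha>"])
       (use \<alpha> not_supp_zero in \<open>auto simp: test_function_def\<close>)
  show "frechet_derivative (\<lambda>z. \<phi> z * \<alpha> z) (at z) e
      = \<phi> z * frechet_derivative \<alpha> (at z) e + frechet_derivative \<phi> (at z) e * \<alpha> z"
    using fun_cong[OF frechet_derivative_at[OF has_derivative_mult[OF
      smooth_has_derivative[OF sm(1)] smooth_has_derivative[OF sm(2)], of z]], of e] by simp
qed

lemma frechet_derivative_outside_supp:
  assumes "z \<notin> supp f"
  shows "frechet_derivative f (at z) = (\<lambda>h. 0)"
proof -
  have op: "open (- supp f)" by (simp add: supp_def open_Compl)
  have "((\<lambda>_. 0) has_derivative (\<lambda>h. 0)) (at z)" by simp
  then have "(f has_derivative (\<lambda>h. 0)) (at z)"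
    by (rule has_derivative_transform_within_open[OF _ op]) (use assms not_supp_zero in fastforce)+
  then show ?thesis by (metis frechet_derivative_at)
qed

lemma test_function_reflect:
  fixes \<kappa> :: "'a::euclidean_space \<Rightarrow> real"
  assumes \<kappa>: "test_function UNIV \<kappa>"
  shows "test_function UNIV (\<lambda>z. \<kappa> (y - z))"
    and "frechet_derivative (\<lambda>z. \<kappa> (y - z)) (at z) e = - frechet_derivative \<kappa> (at (y - z)) e"
proof -
  have sm: "smooth \<kappa>" and c: "compact (supp \<kappa>)" using \<kappa> by (auto simp: test_function_def)
  have "smooth (\<lambda>z. \<kappa> (y + (-1) *\<^sub>R z))" by (rule smooth_affine_compose[OF sm])
  moreover have "compact ((\<lambda>z. y - z) ` supp \<kappa>)"
    by (rule compact_continuous_image[OF _ c]) (intro continuous_intros)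
  moreover have "z \<in> (\<lambda>z. y - z) ` supp \<kappa>" if "\<kappa> (y - z) \<noteq> 0" for z
    using that not_supp_zero[of "y - z" \<kappa>] by (intro image_eqI[of _ _ "y - z"]) auto
  ultimately show "test_function UNIV (\<lambda>z. \<kappa> (y - z))"
    by (intro test_functionI) auto
  have "linear (frechet_derivative \<kappa> (at (y - z)))"
    using smooth_has_derivative[OF sm] has_derivative_linear by blast
  moreover have "((\<lambda>z. \<kappa> (y - z)) has_derivative (\<lambda>h. frechet_derivative \<kappa> (at (y - z)) (- h))) (at z)"
    by (rule has_derivative_compose[OF _ smooth_has_derivative[OF sm], of "\<lambda>z. y - z"])
       (auto intro!: derivative_eq_intros)
  ultimately show "frechet_derivative (\<lambda>z. \<kappa> (y - z)) (at z) e = - frechet_derivative \<kappa> (at (y - z)) e"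
    by (metis frechet_derivative_at linear_neg)
qed

lemma test_function_zero_outside:
  assumes "test_function S \<phi>" "z \<notin> S"
  shows "\<phi> z = 0" and "frechet_derivative \<phi> (at z) e = 0"
proof -
  have "z \<notin> supp \<phi>" using assms by (auto simp: test_function_def)
  then show "\<phi> z = 0" "frechet_derivative \<phi> (at z) e = 0"
    by (simp_all add: not_supp_zero frechet_derivative_outside_supp)
qed

section \<open>Bounded functions of bounded support\<close>

text \<open>The class of mollified functions: it contains the test functions and their partial derivatives,
  is stable under products and under restriction to slices, and consists of integrable functions.
  Here the bounds are required everywhere, not just almost everywhere, so that slices inherit them.\<close>

definition bounded_bsupp :: "('a::euclidean_space \<Rightarrow> 'b::euclidean_space) \<Rightarrow> bool" where
  "bounded_bsupp f \<longleftrightarrow> f \<in> borel_measurable borel \<and>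
     (\<exists>K. \<forall>z. norm (f z) \<le> K) \<and> (\<exists>R. \<forall>z. norm z > R \<longrightarrow> f z = 0)"

lemma bounded_bsupp_measurable [measurable_dest]: "bounded_bsupp f \<Longrightarrow> f \<in> borel_measurable borel"
  by (simp add: bounded_bsupp_def)

lemma bounded_bsupp_bounds:
  assumes "bounded_bsupp f"
  shows "\<exists>K R. K > 0 \<and> R > 0 \<and> (\<forall>z. norm (f z) \<le> K) \<and> (\<forall>z. norm z > R \<longrightarrow> f z = 0)"
proof -
  obtain K R where K: "\<forall>z. norm (f z) \<le> K" "\<forall>z. norm z > R \<longrightarrow> f z = 0"
    using assms unfolding bounded_bsupp_def by (elim exE conjE) (rule that)
  have "norm (f z) \<le> max K 1" for z using K(1) by (simp add: le_max_iff_disj)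
  moreover have "f z = 0" if "norm z > max R 1" for z using K(2) that by simp
  ultimately have "max K 1 > 0 \<and> max R 1 > 0 \<and> (\<forall>z. norm (f z) \<le> max K 1)
      \<and> (\<forall>z. norm z > max R 1 \<longrightarrow> f z = 0)" by (simp add: less_max_iff_disj)
  then show ?thesis by blast
qed

lemma bounded_bsupp_bound:
  assumes "bounded_bsupp g" "f \<in> borel_measurable borel" "\<And>z. norm (f z) \<le> K * norm (g z)"
  shows "bounded_bsupp f"
proof -
  obtain L R where L: "L > 0" "R > 0" "\<forall>z. norm (g z) \<le> L" "\<forall>z. norm z > R \<longrightarrow> g z = 0"
    using bounded_bsupp_bounds[OF assms(1)] by (elim exE conjE) (rule that)
  have "norm (f z) \<le> \<bar>K\<bar> * L" for z
  proof -
    have "K * norm (g z) \<le> \<bar>K\<bar> * L"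
      using L(1) L(3) by (intro mult_mono) auto
    with assms(3)[of z] show ?thesis by linarith
  qed
  moreover have "f z = 0" if "norm z > R" for z
    using assms(3)[of z] L(4)[rule_format, OF that] by simp
  ultimately show ?thesis using assms(2) unfolding bounded_bsupp_def by blast
qed

lemma continuous_compact_supp_bounded_bsupp:
  fixes f :: "'a::euclidean_space \<Rightarrow> 'b::euclidean_space"
  assumes c: "continuous_on UNIV f" and S: "compact S" and z: "\<And>z. z \<notin> S \<Longrightarrow> f z = 0"
  shows "bounded_bsupp f"
proof -
  have "compact (f ` S)" using compact_continuous_image[OF continuous_on_subset[OF c] S] by simp
  then obtain K where K: "\<forall>x\<in>f ` S. norm x \<le> K"
    using compact_imp_bounded bounded_iff by blast
  have K': "\<forall>z. norm (f z) \<le> max K 0"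
  proof
    show "norm (f z) \<le> max K 0" for z using K z[of z] by (cases "z \<in> S") (auto simp: le_max_iff_disj)
  qed
  obtain R where "\<forall>z\<in>S. norm z \<le> R"
    using compact_imp_bounded[OF S] bounded_iff by blast
  then have "\<forall>z. norm z > R \<longrightarrow> f z = 0" using z by (meson not_le)
  with K' show ?thesis
    unfolding bounded_bsupp_def using borel_measurable_continuous_onI[OF c] by blast
qed

lemma test_function_bounded_bsupp:
  fixes f :: "'a::euclidean_space \<Rightarrow> 'b::euclidean_space"
  assumes "test_function \<Omega> f"
  shows "bounded_bsupp f"
  using assms unfolding test_function_def
  by (intro continuous_compact_supp_bounded_bsupp[of f "supp f"]) (auto intro: smooth_continuous_on not_supp_zero)

lemma test_function_partial_bounded_bsupp:
  fixes f :: "'a::euclidean_space \<Rightarrow> 'b::euclidean_space"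
  assumes "test_function \<Omega> f" "e \<in> Basis"
  shows "bounded_bsupp (\<lambda>z. frechet_derivative f (at z) e)"
  using assms unfolding test_function_def
  by (intro continuous_compact_supp_bounded_bsupp[of _ "supp f"])
     (auto intro: smooth_continuous_on smooth_partial simp: frechet_derivative_outside_supp)

lemma bounded_bsupp_integrable:
  assumes "bounded_bsupp f" shows "integrable lborel f"
proof -
  obtain K R where K: "K > 0" "R > 0" "\<forall>z. norm (f z) \<le> K" "\<forall>z. norm z > R \<longrightarrow> f z = 0"
    using bounded_bsupp_bounds[OF assms] by (elim exE conjE) (rule that)
  show ?thesis
  proof (rule Bochner_Integration.integrable_bound)
    show "integrable lborel (\<lambda>z. K * indicator (cball 0 R) z)"
      by (intro integrable_mult_right integrable_real_indicator emeasure_lborel_cball_finite) auto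
    show "AE z in lborel. norm (f z) \<le> norm (K * indicator (cball 0 R) z)"
    proof (rule AE_I2)
      show "norm (f z) \<le> norm (K * indicator (cball 0 R) z)" for z
        using K(1) K(3)[rule_format, of z] K(4)[rule_format, of z] by (cases "norm z \<le> R") auto
    qed
  qed (use assms in measurable)
qed

lemma bounded_bsupp_shift:
  assumes \<kappa>: "bounded_bsupp \<kappa>" shows "bounded_bsupp (\<lambda>z. \<kappa> (z - y))"
proof -
  obtain K R where K: "K > 0" "R > 0" "\<forall>z. norm (\<kappa> z) \<le> K" "\<forall>z. norm z > R \<longrightarrow> \<kappa> z = 0"
    using bounded_bsupp_bounds[OF \<kappa>] by (elim exE conjE) (rule that)
  have [measurable]: "\<kappa> \<in> borel_measurable borel" using \<kappa> by measurable
  have "\<kappa> (z - y) = 0" if "norm z > R + norm y" for z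
    using K(4) that norm_triangle_ineq2[of z y] by simp
  then show ?thesis using K(3) unfolding bounded_bsupp_def by (intro conjI) (measurable, blast+)
qed

lemma bounded_bsupp_scaleR:
  assumes f: "bounded_bsupp f" and g: "bounded_bsupp g"
  shows "bounded_bsupp (\<lambda>x. f x *\<^sub>R g x)"
proof -
  obtain K R where K: "K > 0" "R > 0" "\<forall>z. norm (f z) \<le> K" "\<forall>z. norm z > R \<longrightarrow> f z = 0"
    using bounded_bsupp_bounds[OF f] by (elim exE conjE) (rule that)
  have [measurable]: "f \<in> borel_measurable borel" "g \<in> borel_measurable borel" using f g by measurable
  show ?thesis
    using K(3) by (intro bounded_bsupp_bound[OF g, where K=K]) (auto intro!: mult_right_mono)
qed

lemma bounded_bsupp_mult:
  fixes f g :: "'a::euclidean_space \<Rightarrow> real"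
  shows "bounded_bsupp f \<Longrightarrow> bounded_bsupp g \<Longrightarrow> bounded_bsupp (\<lambda>x. f x * g x)"
  using bounded_bsupp_scaleR[of f g] by simp

lemma bounded_bsupp_add:
  assumes f: "bounded_bsupp f" and g: "bounded_bsupp g"
  shows "bounded_bsupp (\<lambda>x. f x + g x)"
proof -
  obtain K R where K: "K > 0" "R > 0" "\<forall>z. norm (g z) \<le> K" "\<forall>z. norm z > R \<longrightarrow> g z = 0"
    using bounded_bsupp_bounds[OF g] by (elim exE conjE) (rule that)
  obtain L S where L: "L > 0" "S > 0" "\<forall>z. norm (f z) \<le> L" "\<forall>z. norm z > S \<longrightarrow> f z = 0"
    using bounded_bsupp_bounds[OF f] by (elim exE conjE) (rule that)
  have [measurable]: "f \<in> borel_measurable borel" "g \<in> borel_measurable borel" using f g by measurable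
  have "norm (f z + g z) \<le> L + K" for z
    using K(3) L(3) by (meson add_mono norm_triangle_le)
  moreover have "f z + g z = 0" if "norm z > max R S" for z using that K(4) L(4) by simp
  ultimately show ?thesis unfolding bounded_bsupp_def by (intro conjI) (measurable, blast+)
qed

lemma bounded_bsupp_slice:
  fixes f :: "'a::euclidean_space \<times> 'c::euclidean_space \<Rightarrow> 'b::euclidean_space"
  assumes f: "bounded_bsupp f" shows "bounded_bsupp (\<lambda>x. f (t, x))"
proof -
  obtain K R where K: "K > 0" "R > 0" "\<forall>z. norm (f z) \<le> K" "\<forall>z. norm z > R \<longrightarrow> f z = 0"
    using bounded_bsupp_bounds[OF f] by (elim exE conjE) (rule that)
  have [measurable]: "f \<in> borel_measurable borel" using f by measurable
  have "f (t, x) = 0" if "norm x > R" for x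
    using K(4) that norm_snd_le[of x t] by (meson less_le_trans)
  moreover have "(\<lambda>x. f (t, x)) \<in> borel_measurable borel"
    by (rule measurable_compose[OF _ \<open>f \<in> borel_measurable borel\<close>]) (simp add: borel_prod[symmetric])
  ultimately show ?thesis using K(3) unfolding bounded_bsupp_def by blast
qed

lemma bounded_bsupp_sum: "finite I \<Longrightarrow> (\<And>i. i \<in> I \<Longrightarrow> bounded_bsupp (f i)) \<Longrightarrow> bounded_bsupp (\<lambda>z. \<Sum>i\<in>I. f i z)"
proof (induction I rule: finite_induct)
  case empty
  show ?case by (auto simp: bounded_bsupp_def)
next
  case (insert i I)
  then show ?case by (simp add: bounded_bsupp_add)
qed

section \<open>Directional derivatives\<close>

text \<open>Pointwise differentiability in one direction is all that integration by parts in that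
  direction uses. Unlike membership in the space of test functions it is immediately inherited by
  slices of functions on a product space.\<close>

definition dir_deriv :: "('a::euclidean_space \<Rightarrow> real) \<Rightarrow> 'a \<Rightarrow> ('a \<Rightarrow> real) \<Rightarrow> bool" where
  "dir_deriv g e g' \<longleftrightarrow> (\<forall>y. ((\<lambda>s. g (y + s *\<^sub>R e)) has_real_derivative g' y) (at 0))"

lemma smooth_dir_deriv:
  fixes g :: "'a::euclidean_space \<Rightarrow> real"
  assumes "smooth g"
  shows "dir_deriv g e (\<lambda>y. frechet_derivative g (at y) e)"
  unfolding dir_deriv_def
proof
  fix y
  let ?g' = "frechet_derivative g (at y)"
  have "((\<lambda>s. g (y + s *\<^sub>R e)) has_derivative (\<lambda>s. ?g' (s *\<^sub>R e))) (at 0)"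
    by (rule has_derivative_compose[of "\<lambda>s. y + s *\<^sub>R e" _ 0 UNIV g])
       (auto intro!: derivative_eq_intros smooth_has_derivative assms)
  moreover have "linear ?g'"
    using smooth_has_derivative[OF assms] has_derivative_linear by blast
  then have "(\<lambda>s. ?g' (s *\<^sub>R e)) = (*) (?g' e)"
    by (auto simp: linear_scale mult.commute)
  ultimately show "((\<lambda>s. g (y + s *\<^sub>R e)) has_real_derivative ?g' e) (at 0)"
    by (simp add: has_field_derivative_def)
qed

lemma dir_deriv_mult:
  assumes "dir_deriv f e f'" "dir_deriv g e g'"
  shows "dir_deriv (\<lambda>x. f x * g x) e (\<lambda>x. f x * g' x + f' x * g x)"
  using assms unfolding dir_deriv_def
  by (auto intro!: derivative_eq_intros simp: algebra_simps)

lemma dir_deriv_line: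
  assumes "dir_deriv g e g'"
  shows "((\<lambda>s. g (y + s *\<^sub>R e)) has_real_derivative g' (y + s *\<^sub>R e)) (at s)"
proof -
  have "((\<lambda>r. g ((y + s *\<^sub>R e) + r *\<^sub>R e)) has_real_derivative g' (y + s *\<^sub>R e)) (at 0)"
    using assms unfolding dir_deriv_def by blast
  then have "((\<lambda>r. g (y + (r + s) *\<^sub>R e)) has_real_derivative g' (y + s *\<^sub>R e)) (at 0)"
    by (simp add: algebra_simps)
  then show ?thesis using DERIV_shift[of "\<lambda>r. g (y + r *\<^sub>R e)" _ 0 s] by simp
qed

lemma dir_deriv_lipschitz:
  assumes "dir_deriv g e g'" "\<And>y. \<bar>g' y\<bar> \<le> L"
  shows "\<bar>g (y + h *\<^sub>R e) - g y\<bar> \<le> L * \<bar>h\<bar>"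
  using field_differentiable_bound[of UNIV "\<lambda>s. g (y + s *\<^sub>R e)" "\<lambda>s. g' (y + s *\<^sub>R e)" L h 0]
    dir_deriv_line[OF assms(1)] assms(2) by (auto simp: has_field_derivative_at_within)

lemma dir_deriv_tendsto:
  assumes "dir_deriv g e g'" "X \<longlonglongrightarrow> 0" "\<And>k::nat. X k \<noteq> 0"
  shows "(\<lambda>k. (g (y + X k *\<^sub>R e) - g y) / X k) \<longlonglongrightarrow> g' y"
proof -
  have "((\<lambda>h. (g (y + h *\<^sub>R e) - g y) / h) \<longlongrightarrow> g' y) (at 0)"
    using assms(1) unfolding dir_deriv_def DERIV_def by simp
  moreover have "filterlim X (at 0) sequentially"
    using assms(2,3) by (simp add: filterlim_at)
  ultimately show ?thesis by (rule filterlim_compose)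
qed

section \<open>Continuity of translations in the mean\<close>

lemma lborel_distr_minus: "distr lborel borel (\<lambda>z. c - z) = (lborel :: 'a::euclidean_space measure)"
  using lborel_affine[of "-1" c] by (simp add: density_1)

lemma lborel_integral_reflect:
  fixes f :: "'a::euclidean_space \<Rightarrow> 'b::euclidean_space"
  assumes [measurable]: "f \<in> borel_measurable borel"
  shows "(LINT z|lborel. f (c - z)) = (LINT z|lborel. f z)"
proof -
  have "(LINT z|lborel. f (c - z)) = (LINT z|distr lborel borel (\<lambda>z. c - z). f z)"
    by (rule integral_distr[symmetric]) measurable
  then show ?thesis by (simp add: lborel_distr_minus)
qed

lemma lborel_integral_translate:
  fixes f :: "'a::euclidean_space \<Rightarrow> 'b::euclidean_space"
  assumes [measurable]: "f \<in> borel_measurable borel"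
  shows "(LINT z|lborel. f (z + c)) = (LINT z|lborel. f z)"
proof -
  have "(LINT z|lborel. f (z + c)) = (LINT z|distr lborel borel ((+) c). f z)"
    by (subst integral_distr) (auto simp: add.commute)
  then show ?thesis by (simp add: lborel_distr_plus)
qed

lemma lborel_integrable_translate:
  fixes f :: "'a::euclidean_space \<Rightarrow> 'b::euclidean_space"
  assumes "integrable lborel f"
  shows "integrable lborel (\<lambda>z. f (z + c))"
proof -
  have "integrable (distr lborel borel ((+) c)) f" using assms by (simp add: lborel_distr_plus)
  then show ?thesis
    by (subst (asm) integrable_distr_eq) (use assms in \<open>auto simp: add.commute\<close>)
qed

lemma lborel_integrable_reflect:
  fixes f :: "'a::euclidean_space \<Rightarrow> 'b::euclidean_space"
  assumes "integrable lborel f"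
  shows "integrable lborel (\<lambda>z. f (c - z))"
proof -
  have "integrable (distr lborel borel (\<lambda>z. c - z)) f" using assms by (simp add: lborel_distr_minus)
  then show ?thesis
    by (subst (asm) integrable_distr_eq) (use assms in auto)
qed

text \<open>The functions for which translation is continuous in the mean form a closed set, because
  \<open>f\<close> and its translate are equally far from \<open>g\<close> and its translate.\<close>

lemma L1_translation_approx:
  fixes f :: "'a::euclidean_space \<Rightarrow> real"
  assumes f: "integrable lborel f"
    and appr: "\<And>e. e > 0 \<Longrightarrow> \<exists>g. integrable lborel g \<and> (LINT x|lborel. \<bar>f x - g x\<bar>) < e
        \<and> ((\<lambda>h. LINT x|lborel. \<bar>g (x + h) - g x\<bar>) \<longlongrightarrow> 0) (at 0)"
  shows "((\<lambda>h. LINT x|lborel. \<bar>f (x + h) - f x\<bar>) \<longlongrightarrow> 0) (at 0)"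
proof (rule tendstoI)
  fix e :: real assume "e > 0"
  then obtain g where g: "integrable lborel g" "(LINT x|lborel. \<bar>f x - g x\<bar>) < e / 3"
      "((\<lambda>h. LINT x|lborel. \<bar>g (x + h) - g x\<bar>) \<longlongrightarrow> 0) (at 0)"
    using appr[of "e / 3"] by auto
  have "eventually (\<lambda>h. (LINT x|lborel. \<bar>g (x + h) - g x\<bar>) < e / 3) (at 0)"
    using order_tendstoD(2)[OF g(3), of "e / 3"] \<open>e > 0\<close> by simp
  then show "eventually (\<lambda>h. dist (LINT x|lborel. \<bar>f (x + h) - f x\<bar>) 0 < e) (at 0)"
  proof eventually_elim
    case (elim h)
    note tf = lborel_integrable_translate[OF f, of h] and tg = lborel_integrable_translate[OF g(1), of h]
    note m = borel_measurable_integrable[OF f] borel_measurable_integrable[OF g(1)]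
    have "(LINT x|lborel. \<bar>f (x + h) - f x\<bar>)
        \<le> (LINT x|lborel. \<bar>g (x + h) - g x\<bar> + \<bar>f (x + h) - g (x + h)\<bar> + \<bar>f x - g x\<bar>)"
      by (rule integral_mono) (use f g(1) tf tg in \<open>auto intro!: integrable_abs Bochner_Integration.integrable_add Bochner_Integration.integrable_diff\<close>)
    also have "\<dots> = (LINT x|lborel. \<bar>g (x + h) - g x\<bar>) + (LINT x|lborel. \<bar>f (x + h) - g (x + h)\<bar>)
        + (LINT x|lborel. \<bar>f x - g x\<bar>)"
      using f g(1) tf tg by simp
    also have "(LINT x|lborel. \<bar>f (x + h) - g (x + h)\<bar>) = (LINT x|lborel. \<bar>f x - g x\<bar>)"
      using m by (intro lborel_integral_translate[of "\<lambda>x. \<bar>f x - g x\<bar>"]) auto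
    finally have "(LINT x|lborel. \<bar>f (x + h) - f x\<bar>) < e" using elim g(2) by linarith
    then show ?case by (simp add: dist_real_def integral_nonneg_AE)
  qed
qed

text \<open>The indicator \<open>f\<close> of an open set is lower semicontinuous, so the decrease
  \<open>max 0 (f x - f (x + h))\<close> tends to 0 pointwise and is dominated by \<open>f\<close>. Increase and decrease
  have the same integral since translation preserves the integral of \<open>f\<close>.\<close>

lemma L1_translation_open:
  fixes U :: "'a::euclidean_space set"
  assumes U: "open U" "emeasure lborel U < \<infinity>"
  defines "f \<equiv> (indicator U :: 'a \<Rightarrow> real)"
  shows "((\<lambda>h. LINT x|lborel. \<bar>f (x + h) - f x\<bar>) \<longlongrightarrow> 0) (at 0)"
proof -
  have f: "integrable lborel f" unfolding f_def using U by (intro integrable_real_indicator) auto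
  have [measurable]: "f \<in> borel_measurable borel" using f by simp
  have eq: "(LINT x|lborel. \<bar>f (x + h) - f x\<bar>) = 2 * (LINT x|lborel. max 0 (f x - f (x + h)))" for h
  proof -
    note tf = lborel_integrable_translate[OF f, of h]
    have "(LINT x|lborel. \<bar>f (x + h) - f x\<bar>)
        = (LINT x|lborel. (f (x + h) - f x) + 2 * max 0 (f x - f (x + h)))"
      by (rule Bochner_Integration.integral_cong) (auto simp: max_def abs_if)
    also have "\<dots> = (LINT x|lborel. f (x + h)) - (LINT x|lborel. f x) + 2 * (LINT x|lborel. max 0 (f x - f (x + h)))"
      using f tf by simp
    finally show ?thesis using lborel_integral_translate[of f h] by simp
  qed
  have "((\<lambda>h. LINT x|lborel. max 0 (f x - f (x + h))) \<longlongrightarrow> 0) (at 0)"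
    unfolding tendsto_at_iff_sequentially o_def
  proof (intro allI impI)
    fix X :: "nat \<Rightarrow> 'a" assume X: "X \<longlonglongrightarrow> 0"
    have "(\<lambda>n. LINT x|lborel. max 0 (f x - f (x + X n))) \<longlonglongrightarrow> (LINT x|(lborel::'a measure). 0)"
    proof (rule integral_dominated_convergence[where w=f])
      show "AE x in lborel. (\<lambda>n. max 0 (f x - f (x + X n))) \<longlonglongrightarrow> 0"
      proof (rule AE_I2)
        fix x
        show "(\<lambda>n. max 0 (f x - f (x + X n))) \<longlonglongrightarrow> 0"
        proof (cases "x \<in> U")
          case True
          have "(\<lambda>n. x + X n) \<longlonglongrightarrow> x" using tendsto_add[OF tendsto_const X, of x] by simp
          then have "eventually (\<lambda>n. x + X n \<in> U) sequentially"
            by (rule topological_tendstoD[OF _ U(1) True])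
          then have "eventually (\<lambda>n. max 0 (f x - f (x + X n)) = 0) sequentially"
            by eventually_elim (use True in \<open>simp add: f_def\<close>)
          then show ?thesis by (rule tendsto_eventually)
        qed (simp add: f_def)
      qed
      show "AE x in lborel. norm (max 0 (f x - f (x + X n))) \<le> f x" for n
        by (auto simp: f_def indicator_def)
    qed (use f in auto)
    then show "(\<lambda>n. LINT x|lborel. max 0 (f x - f (x + X n))) \<longlonglongrightarrow> 0" by simp
  qed
  then show ?thesis unfolding eq by (rule tendsto_mult_right_zero)
qed

text \<open>Outer regularity passes from open sets to Borel sets of finite measure; linearity and dominated
  convergence do the rest.\<close>

lemma L1_translation_continuous:
  fixes f :: "'a::euclidean_space \<Rightarrow> real"
  assumes "integrable lborel f"
  shows "((\<lambda>h. LINT x|lborel. \<bar>f (x + h) - f x\<bar>) \<longlongrightarrow> 0) (at 0)"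
  using assms
proof (induction rule: integrable_induct)
  case (base A c)
  let ?i = "indicator A :: 'a \<Rightarrow> real"
  have A: "integrable lborel ?i" using base by (intro integrable_real_indicator)
  have "((\<lambda>h. LINT x|lborel. \<bar>?i (x + h) - ?i x\<bar>) \<longlongrightarrow> 0) (at 0)"
  proof (rule L1_translation_approx[OF A])
    fix e :: real assume "e > 0"
    then obtain U where U: "open U" "A \<subseteq> U" "emeasure lborel (U - A) < ennreal e"
      using outer_regular_lborel[of A e] base(1) by auto
    have AB: "A \<in> sets borel" using base(1) by simp
    have "emeasure lborel U \<le> emeasure lborel (U - A) + emeasure lborel A"
      using emeasure_subadditive[of "U - A" lborel A] U AB by (simp add: Un_absorb2 borel_open)
    also have "\<dots> < \<infinity>" using less_trans[OF U(3) ennreal_less_top] base(2) by (simp add: less_top)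
    finally have fin: "emeasure lborel U < \<infinity>" .
    have "(LINT x|lborel. \<bar>?i x - indicator U x\<bar>) = (LINT x|lborel. indicator (U - A) x)"
      by (rule Bochner_Integration.integral_cong) (use U(2) in \<open>auto simp: indicator_def\<close>)
    also have "\<dots> = measure lborel (U - A)" by simp
    also have "\<dots> < e"
      using U(3) \<open>e > 0\<close> less_trans[OF U(3) ennreal_less_top]
      by (simp add: measure_def enn2real_less_iff less_top)
    finally show "\<exists>g. integrable lborel g \<and> (LINT x|lborel. \<bar>?i x - g x\<bar>) < e
        \<and> ((\<lambda>h. LINT x|lborel. \<bar>g (x + h) - g x\<bar>) \<longlongrightarrow> 0) (at 0)"
      using L1_translation_open[OF U(1) fin] U(1) fin
      by (intro exI[of _ "indicator U"] conjI integrable_real_indicator) auto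
  qed
  then have "((\<lambda>h. \<bar>c\<bar> * (LINT x|lborel. \<bar>?i (x + h) - ?i x\<bar>)) \<longlongrightarrow> 0) (at 0)"
    by (rule tendsto_mult_right_zero)
  moreover have "\<bar>indicator A (x + h) *\<^sub>R c - indicator A x *\<^sub>R c\<bar> = \<bar>c\<bar> * \<bar>?i (x + h) - ?i x\<bar>" for x h
    by (simp add: abs_mult[symmetric] algebra_simps)
  ultimately show ?case by simp
next
  case (add f g)
  have "((\<lambda>h. (LINT x|lborel. \<bar>f (x + h) - f x\<bar>) + (LINT x|lborel. \<bar>g (x + h) - g x\<bar>)) \<longlongrightarrow> 0) (at 0)"
    using tendsto_add[OF add.IH] by simp
  then show ?case
  proof (rule tendsto_sandwich[OF _ _ tendsto_const, rotated -1], goal_cases)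
    case 2
    show ?case
    proof (intro always_eventually allI)
      fix h
      note i = add.hyps(1,2) lborel_integrable_translate[OF add.hyps(1), of h] lborel_integrable_translate[OF add.hyps(2), of h]
      have "(LINT x|lborel. \<bar>f (x + h) + g (x + h) - (f x + g x)\<bar>)
          \<le> (LINT x|lborel. \<bar>f (x + h) - f x\<bar> + \<bar>g (x + h) - g x\<bar>)"
        by (rule integral_mono) (use i in auto)
      also have "\<dots> = (LINT x|lborel. \<bar>f (x + h) - f x\<bar>) + (LINT x|lborel. \<bar>g (x + h) - g x\<bar>)"
        using i by simp
      finally show "(LINT x|lborel. \<bar>f (x + h) + g (x + h) - (f x + g x)\<bar>)
          \<le> (LINT x|lborel. \<bar>f (x + h) - f x\<bar>) + (LINT x|lborel. \<bar>g (x + h) - g x\<bar>)" .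
    qed
  qed simp
next
  case (lim f s)
  show ?case
  proof (rule L1_translation_approx[OF lim.hyps(4)])
    fix e :: real assume "e > 0"
    have "(\<lambda>i. LINT x|lborel. \<bar>f x - s i x\<bar>) \<longlonglongrightarrow> (LINT x|(lborel::'a measure). 0)"
    proof (rule integral_dominated_convergence[where w="\<lambda>x. 3 * \<bar>f x\<bar>"])
      show "AE x in lborel. (\<lambda>i. \<bar>f x - s i x\<bar>) \<longlonglongrightarrow> 0"
      proof (rule AE_I2)
        fix x :: 'a
        show "(\<lambda>i. \<bar>f x - s i x\<bar>) \<longlonglongrightarrow> 0"
          using tendsto_rabs[OF tendsto_diff[OF tendsto_const lim.hyps(2)], of x "f x"] by simp
      qed
      show "AE x in lborel. norm \<bar>f x - s i x\<bar> \<le> 3 * \<bar>f x\<bar>" for i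
      proof (rule AE_I2)
        show "norm \<bar>f x - s i x\<bar> \<le> 3 * \<bar>f x\<bar>" for x using lim.hyps(3)[of x i] by simp
      qed
    qed (use lim.hyps(1,4) in auto)
    then have "eventually (\<lambda>i. (LINT x|lborel. \<bar>f x - s i x\<bar>) < e) sequentially"
      using order_tendstoD(2) \<open>e > 0\<close> by fastforce
    then obtain i where "(LINT x|lborel. \<bar>f x - s i x\<bar>) < e"
      using eventually_happens' sequentially_bot by blast
    then show "\<exists>g. integrable lborel g \<and> (LINT x|lborel. \<bar>f x - g x\<bar>) < e
        \<and> ((\<lambda>h. LINT x|lborel. \<bar>g (x + h) - g x\<bar>) \<longlongrightarrow> 0) (at 0)"
      using lim.hyps(1) lim.IH by blast
  qed
qed

section \<open>Square integrable functions of bounded support\<close>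

text \<open>Bounded support makes these functions integrable as well, so that their convolution with a
  bounded kernel is defined everywhere.\<close>

definition L2_bsupp :: "('a::euclidean_space \<Rightarrow> 'b::euclidean_space) \<Rightarrow> bool" where
  "L2_bsupp f \<longleftrightarrow> f \<in> borel_measurable borel \<and> integrable lborel (\<lambda>z. (norm (f z))\<^sup>2)
     \<and> (\<exists>R. \<forall>z. norm z > R \<longrightarrow> f z = 0)"

lemma L2_bsupp_measurable [measurable_dest]: "L2_bsupp f \<Longrightarrow> f \<in> borel_measurable borel"
  by (simp add: L2_bsupp_def)

lemma L2_bsupp_square_integrable: "L2_bsupp f \<Longrightarrow> integrable lborel (\<lambda>z. (norm (f z))\<^sup>2)"
  by (simp add: L2_bsupp_def)

lemma bounded_bsupp_L2_bsupp:
  assumes "bounded_bsupp f" shows "L2_bsupp f"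
proof -
  obtain K R where K: "K > 0" "R > 0" "\<forall>z. norm (f z) \<le> K" "\<forall>z. norm z > R \<longrightarrow> f z = 0"
    using bounded_bsupp_bounds[OF assms] by (elim exE conjE) (rule that)
  have "bounded_bsupp (\<lambda>z. (norm (f z))\<^sup>2)"
    by (rule bounded_bsupp_bound[OF assms, where K=K])
       (use assms K in \<open>auto simp: power2_eq_square intro!: mult_right_mono\<close>)
  from bounded_bsupp_integrable[OF this] show ?thesis using K(4) assms unfolding L2_bsupp_def bounded_bsupp_def by blast
qed

lemma L2_bsupp_bound:
  assumes g: "L2_bsupp g" and [measurable]: "f \<in> borel_measurable borel"
    and le: "\<And>z. norm (f z) \<le> K * norm (g z)"
  shows "L2_bsupp f"
proof -
  have "integrable lborel (\<lambda>z. (norm (f z))\<^sup>2)"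
  proof (rule Bochner_Integration.integrable_bound)
    show "integrable lborel (\<lambda>z. K\<^sup>2 * (norm (g z))\<^sup>2)" using L2_bsupp_square_integrable[OF g] by simp
    show "AE z in lborel. norm ((norm (f z))\<^sup>2) \<le> norm (K\<^sup>2 * (norm (g z))\<^sup>2)"
      using power_mono[OF le, of _ 2] by (auto simp: power_mult_distrib)
  qed measurable
  moreover have "\<And>z. g z = 0 \<Longrightarrow> f z = 0" using le by (metis mult_zero_right norm_le_zero_iff norm_zero)
  ultimately show ?thesis using assms unfolding L2_bsupp_def by blast
qed

lemma L2_bsupp_add:
  assumes f: "L2_bsupp f" and g: "L2_bsupp g"
  shows "L2_bsupp (\<lambda>z. f z + g z)"
proof -
  have [measurable]: "f \<in> borel_measurable borel" "g \<in> borel_measurable borel" using f g by measurable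
  have "integrable lborel (\<lambda>z. (norm (f z + g z))\<^sup>2)"
  proof (rule Bochner_Integration.integrable_bound)
    show "integrable lborel (\<lambda>z. 2 * (norm (f z))\<^sup>2 + 2 * (norm (g z))\<^sup>2)"
      using f g by (simp add: L2_bsupp_square_integrable)
    show "AE z in lborel. norm ((norm (f z + g z))\<^sup>2) \<le> norm (2 * (norm (f z))\<^sup>2 + 2 * (norm (g z))\<^sup>2)"
    proof (rule AE_I2)
      fix z
      have "(norm (f z + g z))\<^sup>2 \<le> (norm (f z) + norm (g z))\<^sup>2"
        by (intro power_mono norm_triangle_ineq) simp
      also have "\<dots> \<le> 2 * (norm (f z))\<^sup>2 + 2 * (norm (g z))\<^sup>2"
        using sum_squares_bound[of "norm (f z)" "norm (g z)"] by (simp add: power2_sum)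
      finally show "norm ((norm (f z + g z))\<^sup>2) \<le> norm (2 * (norm (f z))\<^sup>2 + 2 * (norm (g z))\<^sup>2)"
        by simp
    qed
  qed measurable
  moreover obtain R R' where "\<forall>z. norm z > R \<longrightarrow> f z = 0" "\<forall>z. norm z > R' \<longrightarrow> g z = 0"
    using f g unfolding L2_bsupp_def by blast
  then have "\<exists>R. \<forall>z. norm z > R \<longrightarrow> f z + g z = 0" by (intro exI[of _ "max R R'"]) simp
  ultimately show ?thesis unfolding L2_bsupp_def by simp
qed

lemma L2_bsupp_uminus: "L2_bsupp f \<Longrightarrow> L2_bsupp (\<lambda>z. - f z)"
  by (rule L2_bsupp_bound[where K=1]) auto

lemma L2_bsupp_diff: "L2_bsupp f \<Longrightarrow> L2_bsupp g \<Longrightarrow> L2_bsupp (\<lambda>z. f z - g z)"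
  using L2_bsupp_add[OF _ L2_bsupp_uminus] by fastforce

lemma L2_bsupp_integrable:
  assumes f: "L2_bsupp f" shows "integrable lborel f"
proof -
  obtain R where R: "\<forall>z. norm z > R \<longrightarrow> f z = 0" using f unfolding L2_bsupp_def by blast
  show ?thesis
  proof (rule Bochner_Integration.integrable_bound)
    show "integrable lborel (\<lambda>z. indicator (cball 0 R) z + (norm (f z))\<^sup>2)"
      using L2_bsupp_square_integrable[OF f]
      by (intro Bochner_Integration.integrable_add integrable_real_indicator emeasure_lborel_cball_finite) auto
    show "AE z in lborel. norm (f z) \<le> norm (indicator (cball 0 R) z + (norm (f z))\<^sup>2)"
    proof (rule AE_I2)
      fix z
      have "norm (f z) \<le> 1 + (norm (f z))\<^sup>2"
        using sum_squares_bound[of 1 "norm (f z)", simplified] norm_ge_zero[of "f z"] by linarith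
      then show "norm (f z) \<le> norm (indicator (cball 0 R) z + (norm (f z))\<^sup>2)"
        using R by (cases "norm z \<le> R") auto
    qed
  qed (use f in measurable)
qed

lemma L2_bsupp_scaleR:
  assumes f: "bounded_bsupp f" and g: "L2_bsupp g"
  shows "L2_bsupp (\<lambda>x. f x *\<^sub>R g x)"
proof -
  obtain K R where K: "K > 0" "R > 0" "\<forall>z. norm (f z) \<le> K" "\<forall>z. norm z > R \<longrightarrow> f z = 0"
    using bounded_bsupp_bounds[OF f] by (elim exE conjE) (rule that)
  have [measurable]: "f \<in> borel_measurable borel" "g \<in> borel_measurable borel" using f g by measurable
  have "norm (f z) \<le> K" for z using K(3) by blast
  then show ?thesis
    by (intro L2_bsupp_bound[OF g, where K=K]) (auto intro!: mult_right_mono)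
qed

lemma L2_bsupp_sum: "finite I \<Longrightarrow> (\<And>i. i \<in> I \<Longrightarrow> L2_bsupp (f i)) \<Longrightarrow> L2_bsupp (\<lambda>z. \<Sum>i\<in>I. f i z)"
proof (induction I rule: finite_induct)
  case empty
  show ?case by (simp add: L2_bsupp_def)
next
  case (insert i I)
  then show ?case by (simp add: L2_bsupp_add)
qed

lemma L2_bsupp_translate:
  assumes f: "L2_bsupp f" shows "L2_bsupp (\<lambda>z. f (z + h))"
proof -
  have [measurable]: "f \<in> borel_measurable borel" using f by measurable
  obtain R where R: "\<forall>z. norm z > R \<longrightarrow> f z = 0" using f unfolding L2_bsupp_def by blast
  have "f (z + h) = 0" if "norm z > R + norm h" for z
    using R norm_diff_ineq[of z h] that by simp
  moreover have "integrable lborel (\<lambda>z. (norm (f (z + h)))\<^sup>2)"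
    by (rule lborel_integrable_translate[OF L2_bsupp_square_integrable[OF f]])
  ultimately show ?thesis unfolding L2_bsupp_def by auto
qed

lemma L2_bsupp_inner_integrable:
  assumes f: "L2_bsupp f" and g: "L2_bsupp g"
  shows "integrable lborel (\<lambda>z. f z \<bullet> g z)"
proof (rule Bochner_Integration.integrable_bound)
  show "integrable lborel (\<lambda>z. (norm (f z))\<^sup>2 + (norm (g z))\<^sup>2)"
    using f g by (simp add: L2_bsupp_square_integrable)
  show "AE z in lborel. norm (f z \<bullet> g z) \<le> norm ((norm (f z))\<^sup>2 + (norm (g z))\<^sup>2)"
  proof (rule AE_I2)
    fix z
    have "\<bar>f z \<bullet> g z\<bar> \<le> norm (f z) * norm (g z)" by (rule Cauchy_Schwarz_ineq2)
    also have "\<dots> \<le> (norm (f z))\<^sup>2 + (norm (g z))\<^sup>2"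
      using sum_squares_bound[of "norm (f z)" "norm (g z)"]
        mult_nonneg_nonneg[OF norm_ge_zero[of "f z"] norm_ge_zero[of "g z"]] by linarith
    finally show "norm (f z \<bullet> g z) \<le> norm ((norm (f z))\<^sup>2 + (norm (g z))\<^sup>2)" by simp
  qed
qed (use f g in measurable)

definition L2_norm_sq :: "('a::euclidean_space \<Rightarrow> 'b::euclidean_space) \<Rightarrow> real" where
  "L2_norm_sq f = (LINT z|lborel. (norm (f z))\<^sup>2)"

lemma L2_norm_sq_nonneg [simp]: "L2_norm_sq f \<ge> 0"
  unfolding L2_norm_sq_def by (simp add: integral_nonneg_AE)

lemma nn_integral_L2_norm_sq:
  assumes "L2_bsupp f"
  shows "(\<integral>\<^sup>+z. (ennreal (norm (f z)))\<^sup>2 \<partial>lborel) = ennreal (L2_norm_sq f)"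
  unfolding L2_norm_sq_def using nn_integral_eq_integral[OF L2_bsupp_square_integrable[OF assms]]
  by (simp add: ennreal_power)

lemma L2_norm_sq_mono:
  assumes g: "L2_bsupp g" and le: "\<And>z. norm (f z) \<le> k * norm (g z)"
  shows "L2_norm_sq f \<le> k\<^sup>2 * L2_norm_sq g"
proof -
  have "L2_norm_sq f \<le> (LINT z|lborel. k\<^sup>2 * (norm (g z))\<^sup>2)"
    unfolding L2_norm_sq_def
    by (rule integral_mono')
       (use L2_bsupp_square_integrable[OF g] power_mono[OF le, of _ 2] in \<open>auto simp: power_mult_distrib\<close>)
  then show ?thesis by (simp add: L2_norm_sq_def)
qed

lemma L2_bsupp_Cauchy_Schwarz:
  assumes f: "L2_bsupp f" and g: "L2_bsupp g"
  shows "\<bar>LINT z|lborel. f z \<bullet> g z\<bar> \<le> sqrt (L2_norm_sq f) * sqrt (L2_norm_sq g)"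
proof -
  have [measurable]: "f \<in> borel_measurable borel" "g \<in> borel_measurable borel" using f g by measurable
  have "ennreal \<bar>LINT z|lborel. f z \<bullet> g z\<bar> \<le> (\<integral>\<^sup>+z. norm (f z \<bullet> g z) \<partial>lborel)"
    using integral_norm_bound_ennreal[OF L2_bsupp_inner_integrable[OF f g]] by simp
  also have "\<dots> \<le> (\<integral>\<^sup>+z. ennreal (norm (f z)) * ennreal (norm (g z)) \<partial>lborel)"
    by (intro nn_integral_mono) (simp add: ennreal_mult[symmetric] Cauchy_Schwarz_ineq2)
  finally have "(ennreal \<bar>LINT z|lborel. f z \<bullet> g z\<bar>)\<^sup>2
      \<le> (\<integral>\<^sup>+z. ennreal (norm (f z)) * ennreal (norm (g z)) \<partial>lborel)\<^sup>2"
    by (rule power_mono) simp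
  also have "\<dots> \<le> ennreal (L2_norm_sq f) * ennreal (L2_norm_sq g)"
    unfolding nn_integral_L2_norm_sq[OF f, symmetric] nn_integral_L2_norm_sq[OF g, symmetric] by (rule Cauchy_Schwarz_nn_integral) auto
  finally have "\<bar>LINT z|lborel. f z \<bullet> g z\<bar>\<^sup>2 \<le> L2_norm_sq f * L2_norm_sq g"
    by (simp add: ennreal_power ennreal_mult[symmetric] del: power2_abs)
  then have "\<bar>LINT z|lborel. f z \<bullet> g z\<bar> \<le> sqrt (L2_norm_sq f * L2_norm_sq g)" by (rule real_le_rsqrt)
  then show ?thesis by (simp add: real_sqrt_mult)
qed

text \<open>The hypotheses on \<open>L2_norm_sq\<close> say that \<open>F k \<longlonglongrightarrow> f\<close> and \<open>G k \<longlonglongrightarrow> g\<close> in \<open>L\<^sub>2\<close>; the inner product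
  is jointly continuous.\<close>

lemma L2_bsupp_inner_tendsto:
  assumes f: "L2_bsupp f" "\<And>k. L2_bsupp (F k)" "(\<lambda>k. L2_norm_sq (\<lambda>z. F k z - f z)) \<longlonglongrightarrow> 0"
    and g: "L2_bsupp g" "\<And>k. L2_bsupp (G k)" "(\<lambda>k. L2_norm_sq (\<lambda>z. G k z - g z)) \<longlonglongrightarrow> 0"
  shows "(\<lambda>k::nat. LINT z|lborel. F k z \<bullet> G k z) \<longlonglongrightarrow> (LINT z|lborel. f z \<bullet> g z)"
proof -
  define a where "a k = sqrt (L2_norm_sq (\<lambda>z. F k z - f z))" for k
  define b where "b k = sqrt (L2_norm_sq (\<lambda>z. G k z - g z))" for k
  have a: "a \<longlonglongrightarrow> 0" unfolding a_def[abs_def] using tendsto_real_sqrt[OF f(3)] by simp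
  have b: "b \<longlonglongrightarrow> 0" unfolding b_def[abs_def] using tendsto_real_sqrt[OF g(3)] by simp
  have "(\<lambda>k. a k * b k + a k * sqrt (L2_norm_sq g) + sqrt (L2_norm_sq f) * b k) \<longlonglongrightarrow> 0 * 0 + 0 * sqrt (L2_norm_sq g) + sqrt (L2_norm_sq f) * 0"
    by (intro tendsto_intros a b)
  then have lim: "(\<lambda>k. a k * b k + a k * sqrt (L2_norm_sq g) + sqrt (L2_norm_sq f) * b k) \<longlonglongrightarrow> 0" by simp
  have "norm ((LINT z|lborel. F k z \<bullet> G k z) - (LINT z|lborel. f z \<bullet> g z))
      \<le> a k * b k + a k * sqrt (L2_norm_sq g) + sqrt (L2_norm_sq f) * b k" for k
  proof -
    note df = L2_bsupp_diff[OF f(2)[of k] f(1)] and dg = L2_bsupp_diff[OF g(2)[of k] g(1)]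
    have "(LINT z|lborel. F k z \<bullet> G k z) - (LINT z|lborel. f z \<bullet> g z)
        = (LINT z|lborel. F k z \<bullet> G k z - f z \<bullet> g z)"
      by (simp add: L2_bsupp_inner_integrable f g)
    also have "\<dots> = (LINT z|lborel. (F k z - f z) \<bullet> (G k z - g z) + (F k z - f z) \<bullet> g z + f z \<bullet> (G k z - g z))"
      by (simp add: algebra_simps)
    also have "\<dots> = (LINT z|lborel. (F k z - f z) \<bullet> (G k z - g z)) + (LINT z|lborel. (F k z - f z) \<bullet> g z)
        + (LINT z|lborel. f z \<bullet> (G k z - g z))"
      by (subst Bochner_Integration.integral_add Bochner_Integration.integrable_add;
          (intro Bochner_Integration.integrable_add L2_bsupp_inner_integrable df dg f(1) g(1))?)+ simp
    finally have "norm ((LINT z|lborel. F k z \<bullet> G k z) - (LINT z|lborel. f z \<bullet> g z))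
      \<le> \<bar>LINT z|lborel. (F k z - f z) \<bullet> (G k z - g z)\<bar> + \<bar>LINT z|lborel. (F k z - f z) \<bullet> g z\<bar>
        + \<bar>LINT z|lborel. f z \<bullet> (G k z - g z)\<bar>" by simp
    also have "\<dots> \<le> a k * b k + a k * sqrt (L2_norm_sq g) + sqrt (L2_norm_sq f) * b k"
      unfolding a_def b_def by (intro add_mono L2_bsupp_Cauchy_Schwarz df dg f(1) g(1))
    finally show ?thesis .
  qed
  then have "(\<lambda>k. (LINT z|lborel. F k z \<bullet> G k z) - (LINT z|lborel. f z \<bullet> g z)) \<longlonglongrightarrow> 0"
    by (intro Lim_null_comparison[OF _ lim] always_eventually allI)
  then show ?thesis by (rule LIM_zero_cancel)
qed

text \<open>Reduces \<open>L\<^sub>2\<close> to \<open>L\<^sub>1\<close>: \<open>(p - q)\<^sup>2 \<le> \<bar>p\<^sup>2 - q\<^sup>2\<bar>\<close> holds for nonnegative numbers, and each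
  coordinate is a difference of two nonnegative parts.\<close>

lemma sum_positive_parts_bound:
  fixes a b :: "'a::euclidean_space"
  shows "(norm (a - b))\<^sup>2 \<le> (\<Sum>e\<in>Basis. 2 * \<bar>(max 0 (a \<bullet> e))\<^sup>2 - (max 0 (b \<bullet> e))\<^sup>2\<bar>
      + 2 * \<bar>(max 0 (- (a \<bullet> e)))\<^sup>2 - (max 0 (- (b \<bullet> e)))\<^sup>2\<bar>)"
proof -
  have sq: "(p - q)\<^sup>2 \<le> \<bar>p\<^sup>2 - q\<^sup>2\<bar>" if "p \<ge> 0" "q \<ge> 0" for p q :: real
  proof -
    have "(p - q)\<^sup>2 = \<bar>p - q\<bar> * \<bar>p - q\<bar>" by (simp add: power2_eq_square flip: abs_mult)
    also have "\<dots> \<le> \<bar>p - q\<bar> * (p + q)" using that by (intro mult_left_mono) auto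
    also have "\<dots> = \<bar>p\<^sup>2 - q\<^sup>2\<bar>"
      using that by (simp add: power2_eq_square square_diff_square_factored abs_mult mult.commute)
    finally show ?thesis .
  qed
  have "(s - t)\<^sup>2 \<le> 2 * \<bar>(max 0 s)\<^sup>2 - (max 0 t)\<^sup>2\<bar> + 2 * \<bar>(max 0 (- s))\<^sup>2 - (max 0 (- t))\<^sup>2\<bar>" for s t :: real
  proof -
    have "(s - t)\<^sup>2 = ((max 0 s - max 0 t) - (max 0 (- s) - max 0 (- t)))\<^sup>2"
      by (simp add: max_def)
    also have "\<dots> \<le> 2 * (max 0 s - max 0 t)\<^sup>2 + 2 * (max 0 (- s) - max 0 (- t))\<^sup>2"
      using zero_le_power2[of "(max 0 s - max 0 t) + (max 0 (- s) - max 0 (- t))"]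
      by (simp add: power2_eq_square algebra_simps)
    finally show ?thesis
      using sq[OF max.cobounded1 max.cobounded1, of s t] sq[OF max.cobounded1 max.cobounded1, of "- s" "- t"]
      by linarith
  qed
  note part = this
  have "(norm (a - b))\<^sup>2 = (\<Sum>e\<in>Basis. (a \<bullet> e - b \<bullet> e)\<^sup>2)"
    unfolding power2_norm_eq_inner euclidean_inner[of "a - b" "a - b"]
    by (simp add: inner_diff_left power2_eq_square)
  also have "\<dots> \<le> (\<Sum>e\<in>Basis. 2 * \<bar>(max 0 (a \<bullet> e))\<^sup>2 - (max 0 (b \<bullet> e))\<^sup>2\<bar>
      + 2 * \<bar>(max 0 (- (a \<bullet> e)))\<^sup>2 - (max 0 (- (b \<bullet> e)))\<^sup>2\<bar>)"
    by (intro sum_mono part)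
  finally show ?thesis .
qed

text \<open>The squares of the positive and negative parts of the coordinates of \<open>f\<close> are integrable, so
  their translates converge in the mean; \<open>sum_positive_parts_bound\<close> turns this into convergence
  in \<open>L\<^sub>2\<close> of \<open>f\<close> itself.\<close>

lemma L2_translation_continuous:
  fixes f :: "'a::euclidean_space \<Rightarrow> 'b::euclidean_space"
  assumes f: "L2_bsupp f"
  shows "((\<lambda>h. L2_norm_sq (\<lambda>x. f (x + h) - f x)) \<longlongrightarrow> 0) (at 0)"
proof -
  have [measurable]: "f \<in> borel_measurable borel" using f by measurable
  define p where "p e x = (max 0 (f x \<bullet> e))\<^sup>2" for e x
  define n where "n e x = (max 0 (- (f x \<bullet> e)))\<^sup>2" for e x
  \<comment> \<open>To be used with \<open>s = 1\<close> and \<open>s = - 1\<close>.\<close>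
  have le: "(max 0 (s * (f x \<bullet> e)))\<^sup>2 \<le> (norm (f x))\<^sup>2" if "e \<in> Basis" "\<bar>s\<bar> = 1" for e x s
  proof (rule power_mono)
    have "\<bar>s * (f x \<bullet> e)\<bar> \<le> norm (f x)"
      using Cauchy_Schwarz_ineq2[of "f x" e] that by (simp add: abs_mult)
    then show "max 0 (s * (f x \<bullet> e)) \<le> norm (f x)" by simp
  qed simp
  have ip: "integrable lborel (p e)" and "in": "integrable lborel (n e)" if "e \<in> Basis" for e
    unfolding p_def n_def using le[OF that, of 1] le[OF that, of "-1"]
    by (auto intro!: Bochner_Integration.integrable_bound[OF L2_bsupp_square_integrable[OF f]])
  have lim: "((\<lambda>h. \<Sum>e\<in>Basis. 2 * (LINT x|lborel. \<bar>p e (x + h) - p e x\<bar>)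
       + 2 * (LINT x|lborel. \<bar>n e (x + h) - n e x\<bar>)) \<longlongrightarrow> (\<Sum>e\<in>(Basis::'b set). 2 * 0 + 2 * 0)) (at 0)"
    by (intro tendsto_intros L1_translation_continuous ip "in")
  show ?thesis
  proof (rule tendsto_sandwich[OF _ _ tendsto_const, rotated -1])
    show "((\<lambda>h. \<Sum>e\<in>Basis. 2 * (LINT x|lborel. \<bar>p e (x + h) - p e x\<bar>)
       + 2 * (LINT x|lborel. \<bar>n e (x + h) - n e x\<bar>)) \<longlongrightarrow> 0) (at 0)" using lim by simp
    show "\<forall>\<^sub>F h in at 0. L2_norm_sq (\<lambda>x. f (x + h) - f x) \<le> (\<Sum>e\<in>Basis. 2 * (LINT x|lborel. \<bar>p e (x + h) - p e x\<bar>)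
       + 2 * (LINT x|lborel. \<bar>n e (x + h) - n e x\<bar>))"
    proof (intro always_eventually allI)
      fix h
      have i: "integrable lborel (\<lambda>x. 2 * \<bar>p e (x + h) - p e x\<bar>)" "integrable lborel (\<lambda>x. 2 * \<bar>n e (x + h) - n e x\<bar>)"
        if "e \<in> Basis" for e
        using ip[OF that] "in"[OF that] lborel_integrable_translate[OF ip[OF that], of h]
          lborel_integrable_translate[OF "in"[OF that], of h] by auto
      have "L2_norm_sq (\<lambda>x. f (x + h) - f x)
          \<le> (LINT x|lborel. (\<Sum>e\<in>Basis. 2 * \<bar>p e (x + h) - p e x\<bar> + 2 * \<bar>n e (x + h) - n e x\<bar>))"
        unfolding L2_norm_sq_def
      proof (rule integral_mono')
        show "integrable lborel (\<lambda>x. \<Sum>e\<in>Basis. 2 * \<bar>p e (x + h) - p e x\<bar> + 2 * \<bar>n e (x + h) - n e x\<bar>)"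
          by (intro Bochner_Integration.integrable_sum Bochner_Integration.integrable_add i)
      qed (unfold p_def n_def, rule sum_positive_parts_bound, intro sum_nonneg, simp)
      also have "\<dots> = (\<Sum>e\<in>Basis. 2 * (LINT x|lborel. \<bar>p e (x + h) - p e x\<bar>)
          + 2 * (LINT x|lborel. \<bar>n e (x + h) - n e x\<bar>))"
        using i by (subst Bochner_Integration.integral_sum) (auto intro!: sum.cong)
      finally show "L2_norm_sq (\<lambda>x. f (x + h) - f x) \<le> (\<Sum>e\<in>Basis. 2 * (LINT x|lborel. \<bar>p e (x + h) - p e x\<bar>)
          + 2 * (LINT x|lborel. \<bar>n e (x + h) - n e x\<bar>))" .
    qed
  qed simp
qed

section \<open>Integration by parts and convolution\<close>

text \<open>The difference quotients of \<open>g\<close> integrate to 0 by translation invariance, and they converge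
  dominatedly because \<open>g\<close> is Lipschitz in the direction \<open>e\<close> and has bounded support.\<close>

lemma integral_dir_deriv_zero:
  fixes g :: "'a::euclidean_space \<Rightarrow> real"
  assumes g: "bounded_bsupp g" "bounded_bsupp g'" "dir_deriv g e g'"
  shows "(LINT x|lborel. g' x) = 0"
proof -
  have [measurable]: "g \<in> borel_measurable borel" "g' \<in> borel_measurable borel" using g by measurable
  obtain L R where L: "L > 0" "R > 0" "\<forall>z. norm (g' z) \<le> L" "\<forall>z. norm z > R \<longrightarrow> g' z = 0"
    using bounded_bsupp_bounds[OF g(2)] by (elim exE conjE) (rule that)
  obtain K S where K: "K > 0" "S > 0" "\<forall>z. norm (g z) \<le> K" "\<forall>z. norm z > S \<longrightarrow> g z = 0"
    using bounded_bsupp_bounds[OF g(1)] by (elim exE conjE) (rule that)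
  define X where "X k = inverse (real (Suc k))" for k
  have X: "X \<longlonglongrightarrow> 0" "X k \<noteq> 0" "0 < X k" "X k \<le> 1" for k
    unfolding X_def using LIMSEQ_inverse_real_of_nat by (auto simp: field_simps)
  have "(\<lambda>k. LINT x|lborel. (g (x + X k *\<^sub>R e) - g x) / X k) \<longlonglongrightarrow> (LINT x|lborel. g' x)"
  proof (rule integral_dominated_convergence[where w="\<lambda>x. L * indicator (cball 0 (S + norm e)) x"])
    show "integrable lborel (\<lambda>x::'a. L * indicator (cball 0 (S + norm e)) x)"
      by (intro integrable_mult_right integrable_real_indicator emeasure_lborel_cball_finite) auto
    show "AE x in lborel. (\<lambda>k. (g (x + X k *\<^sub>R e) - g x) / X k) \<longlonglongrightarrow> g' x"
      by (intro AE_I2 dir_deriv_tendsto[OF g(3) X(1,2)])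
    show "AE x in lborel. norm ((g (x + X k *\<^sub>R e) - g x) / X k) \<le> L * indicator (cball 0 (S + norm e)) x" for k
    proof (rule AE_I2)
      fix x
      have "\<bar>g (x + X k *\<^sub>R e) - g x\<bar> \<le> L * \<bar>X k\<bar>"
        using dir_deriv_lipschitz[OF g(3), of L] L(3) by simp
      then have 1: "\<bar>(g (x + X k *\<^sub>R e) - g x) / X k\<bar> \<le> L"
        using X(3)[of k] by (simp add: abs_divide pos_divide_le_eq)
      show "norm ((g (x + X k *\<^sub>R e) - g x) / X k) \<le> L * indicator (cball 0 (S + norm e)) x"
      proof (cases "norm x \<le> S + norm e")
        case False
        have "norm (X k *\<^sub>R e) \<le> norm e" using X(3,4)[of k] by (simp add: mult_left_le_one_le)
        then have "norm (x + X k *\<^sub>R e) > S" "norm x > S"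
          using False norm_diff_ineq[of x "X k *\<^sub>R e"] norm_ge_zero[of e] by linarith+
        then show ?thesis using K(4) False by simp
      qed (use 1 in simp)
    qed
  qed measurable
  moreover have "(LINT x|lborel. (g (x + X k *\<^sub>R e) - g x) / X k) = 0" for k
    using bounded_bsupp_integrable[OF g(1)] lborel_integrable_translate[OF bounded_bsupp_integrable[OF g(1)]]
    by (simp add: lborel_integral_translate)
  ultimately have "(\<lambda>k::nat. 0) \<longlonglongrightarrow> (LINT x|lborel. g' x)" by (simp only:)
  then show ?thesis using LIMSEQ_unique tendsto_const by blast
qed

definition convolve :: "('a::euclidean_space \<Rightarrow> real) \<Rightarrow> ('a \<Rightarrow> 'b::euclidean_space) \<Rightarrow> 'a \<Rightarrow> 'b" where
  "convolve \<kappa> f y = (LINT z|lborel. \<kappa> (y - z) *\<^sub>R f z)"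

lemma convolve_integrable:
  fixes f :: "'a::euclidean_space \<Rightarrow> 'b::euclidean_space"
  assumes "bounded_bsupp \<kappa>" and f: "integrable lborel f"
  shows "integrable lborel (\<lambda>z. \<kappa> (y - z) *\<^sub>R f z)"
proof -
  obtain K R where K: "K > 0" "R > 0" "\<forall>z. norm (\<kappa> z) \<le> K" "\<forall>z. norm z > R \<longrightarrow> \<kappa> z = 0"
    using bounded_bsupp_bounds[OF assms(1)] by (elim exE conjE) (rule that)
  have [measurable]: "\<kappa> \<in> borel_measurable borel" using assms by measurable
  show ?thesis
  proof (rule Bochner_Integration.integrable_bound)
    show "integrable lborel (\<lambda>z. K *\<^sub>R f z)" using f by simp
    show "AE z in lborel. norm (\<kappa> (y - z) *\<^sub>R f z) \<le> norm (K *\<^sub>R f z)"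
      using K(1,3) by (auto intro!: mult_right_mono)
  qed (use f in measurable)
qed

lemma convolve_measurable [measurable]:
  assumes [measurable]: "\<kappa> \<in> borel_measurable borel" "f \<in> borel_measurable borel"
  shows "convolve \<kappa> f \<in> borel_measurable borel"
  unfolding convolve_def[abs_def] by measurable

lemma norm_convolve_le:
  fixes f :: "'a::euclidean_space \<Rightarrow> 'b::euclidean_space"
  assumes "bounded_bsupp \<kappa>" and f: "integrable lborel f" and K: "\<And>z. \<bar>\<kappa> z\<bar> \<le> K"
  shows "norm (convolve \<kappa> f y) \<le> K * (LINT z|lborel. norm (f z))"
proof -
  have "norm (convolve \<kappa> f y) \<le> (LINT z|lborel. K * norm (f z))"
    unfolding convolve_def
  proof (rule Bochner_Integration.integral_norm_bound_integral)
  qed (use assms in \<open>auto intro!: mult_right_mono convolve_integrable\<close>)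
  then show ?thesis by simp
qed

lemma convolve_bounded_bsupp:
  assumes \<kappa>: "bounded_bsupp \<kappa>" and f: "L2_bsupp f"
  shows "bounded_bsupp (convolve \<kappa> f)"
proof -
  obtain K R where K: "K > 0" "R > 0" "\<forall>z. norm (\<kappa> z) \<le> K" "\<forall>z. norm z > R \<longrightarrow> \<kappa> z = 0"
    using bounded_bsupp_bounds[OF assms(1)] by (elim exE conjE) (rule that)
  have [measurable]: "\<kappa> \<in> borel_measurable borel" "f \<in> borel_measurable borel" using assms by measurable
  obtain R' where R': "\<forall>z. norm z > R' \<longrightarrow> f z = 0" using f unfolding L2_bsupp_def by blast
  have "convolve \<kappa> f y = 0" if y: "norm y > R + R'" for y
  proof -
    have "\<kappa> (y - z) *\<^sub>R f z = 0" for z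
    proof (cases "norm z > R'")
      case False
      then have "norm (y - z) > R" using y norm_triangle_ineq2[of y z] by simp
      then show ?thesis using K(4) by simp
    qed (use R' in simp)
    then show ?thesis by (simp only: convolve_def Bochner_Integration.integral_zero)
  qed
  moreover have "norm (convolve \<kappa> f y) \<le> K * (LINT z|lborel. norm (f z))" for y
    using norm_convolve_le[OF \<kappa> L2_bsupp_integrable[OF f], of K] K(3) by simp
  ultimately show ?thesis unfolding bounded_bsupp_def by (intro conjI) (measurable, blast+)
qed

lemma convolve_increment:
  assumes \<kappa>: "bounded_bsupp \<kappa>" and u: "integrable lborel u"
  shows "convolve \<kappa> u (y + h) - convolve \<kappa> u y = (LINT z|lborel. (\<kappa> (y - z + h) - \<kappa> (y - z)) *\<^sub>R u z)"
  unfolding convolve_def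
  using Bochner_Integration.integral_diff[OF convolve_integrable[OF \<kappa> u, of "y + h"] convolve_integrable[OF \<kappa> u, of y]]
  by (simp add: algebra_simps)

lemma convolve_lipschitz:
  assumes \<kappa>: "bounded_bsupp \<kappa>" "dir_deriv \<kappa> e \<kappa>'" "\<And>y. \<bar>\<kappa>' y\<bar> \<le> L" and u: "integrable lborel u"
  shows "norm (convolve \<kappa> u (y + h *\<^sub>R e) - convolve \<kappa> u y) \<le> \<bar>h\<bar> * (L * (LINT z|lborel. norm (u z)))"
proof -
  have "norm (convolve \<kappa> u (y + h *\<^sub>R e) - convolve \<kappa> u y) \<le> (LINT z|lborel. (L * \<bar>h\<bar>) * norm (u z))"
    unfolding convolve_increment[OF \<kappa>(1) u]
  proof (rule Bochner_Integration.integral_norm_bound_integral)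
    show "integrable lborel (\<lambda>z. (\<kappa> (y - z + h *\<^sub>R e) - \<kappa> (y - z)) *\<^sub>R u z)"
      using Bochner_Integration.integrable_diff[OF convolve_integrable[OF \<kappa>(1) u, of "y + h *\<^sub>R e"] convolve_integrable[OF \<kappa>(1) u, of y]]
      by (simp add: algebra_simps)
    show "norm ((\<kappa> (y - z + h *\<^sub>R e) - \<kappa> (y - z)) *\<^sub>R u z) \<le> (L * \<bar>h\<bar>) * norm (u z)" for z
      using dir_deriv_lipschitz[OF \<kappa>(2,3), of "y - z" h] by (auto intro!: mult_right_mono)
  qed (use u in simp)
  then show ?thesis by (simp add: mult_ac)
qed

text \<open>Convolution is differentiable because its kernel is, whatever the regularity of \<open>u\<close>.\<close>

lemma convolve_difference_quotient:
  assumes \<kappa>: "bounded_bsupp \<kappa>" "bounded_bsupp \<kappa>'" "dir_deriv \<kappa> e \<kappa>'" and u: "integrable lborel u"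
    and X: "X \<longlonglongrightarrow> 0" "\<And>k::nat. X k \<noteq> 0"
  shows "(\<lambda>k. (convolve \<kappa> u (y + X k *\<^sub>R e) - convolve \<kappa> u y) /\<^sub>R X k) \<longlonglongrightarrow> convolve \<kappa>' u y"
proof -
  have [measurable]: "\<kappa> \<in> borel_measurable borel" "\<kappa>' \<in> borel_measurable borel" using \<kappa> by measurable
  obtain L R where L: "L > 0" "R > 0" "\<forall>z. norm (\<kappa>' z) \<le> L" "\<forall>z. norm z > R \<longrightarrow> \<kappa>' z = 0"
    using bounded_bsupp_bounds[OF \<kappa>(2)] by (elim exE conjE) (rule that)
  have "(convolve \<kappa> u (y + X k *\<^sub>R e) - convolve \<kappa> u y) /\<^sub>R X k
      = (LINT z|lborel. ((\<kappa> (y - z + X k *\<^sub>R e) - \<kappa> (y - z)) / X k) *\<^sub>R u z)" for k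
    unfolding convolve_increment[OF \<kappa>(1) u]
    by (subst Bochner_Integration.integral_scaleR_right[symmetric]) (simp add: divide_inverse mult.commute)
  moreover have "(\<lambda>k. LINT z|lborel. ((\<kappa> (y - z + X k *\<^sub>R e) - \<kappa> (y - z)) / X k) *\<^sub>R u z)
      \<longlonglongrightarrow> (LINT z|lborel. \<kappa>' (y - z) *\<^sub>R u z)"
  proof (rule integral_dominated_convergence[where w="\<lambda>z. L * norm (u z)"])
    show "AE z in lborel. (\<lambda>k. ((\<kappa> (y - z + X k *\<^sub>R e) - \<kappa> (y - z)) / X k) *\<^sub>R u z) \<longlonglongrightarrow> \<kappa>' (y - z) *\<^sub>R u z"
      by (intro AE_I2 tendsto_intros dir_deriv_tendsto[OF \<kappa>(3) X])
    show "AE z in lborel. norm (((\<kappa> (y - z + X k *\<^sub>R e) - \<kappa> (y - z)) / X k) *\<^sub>R u z) \<le> L * norm (u z)" for k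
    proof (rule AE_I2)
      fix z
      have "\<bar>\<kappa> (y - z + X k *\<^sub>R e) - \<kappa> (y - z)\<bar> \<le> L * \<bar>X k\<bar>"
        using dir_deriv_lipschitz[OF \<kappa>(3), of L] L(3) by simp
      then have "\<bar>(\<kappa> (y - z + X k *\<^sub>R e) - \<kappa> (y - z)) / X k\<bar> \<le> L"
        using X(2)[of k] by (simp add: abs_divide pos_divide_le_eq)
      then show "norm (((\<kappa> (y - z + X k *\<^sub>R e) - \<kappa> (y - z)) / X k) *\<^sub>R u z) \<le> L * norm (u z)"
        unfolding norm_scaleR by (rule mult_right_mono) simp
    qed
  qed (use u in \<open>measurable, simp\<close>)
  ultimately show ?thesis by (simp add: convolve_def)
qed

section \<open>Mollification\<close>

text \<open>By the Cauchy-Schwarz inequality for the probability density \<open>\<kappa>\<close>, the squared error at a point is at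
  most the \<open>\<kappa>\<close>-average of the squared increments of \<open>f\<close> there; integrating over the point first
  leaves translates by vectors of length less than \<open>r\<close>.\<close>

lemma mollification_error:
  assumes \<kappa>: "bounded_bsupp \<kappa>" "\<And>z. \<kappa> z \<ge> 0" "(LINT z|lborel. \<kappa> z) = 1" "\<And>z. \<kappa> z \<noteq> 0 \<Longrightarrow> norm z < r"
    and f: "L2_bsupp f" and e: "e \<ge> 0" "\<And>h. norm h < r \<Longrightarrow> L2_norm_sq (\<lambda>x. f (x + h) - f x) \<le> e"
  shows "L2_norm_sq (\<lambda>y. convolve \<kappa> f y - f y) \<le> e"
proof -
  have [measurable]: "\<kappa> \<in> borel_measurable borel" "f \<in> borel_measurable borel" using \<kappa> f by measurable
  have k1: "(\<integral>\<^sup>+z. ennreal (\<kappa> z) \<partial>lborel) = 1"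
    using nn_integral_eq_integral[OF bounded_bsupp_integrable[OF \<kappa>(1)]] \<kappa>(2,3) by simp
  have pt: "(ennreal (norm (convolve \<kappa> f y - f y)))\<^sup>2
      \<le> (\<integral>\<^sup>+s. ennreal (\<kappa> s) * (ennreal (norm (f (y - s) - f y)))\<^sup>2 \<partial>lborel)" for y
  proof -
    have i1: "integrable lborel (\<lambda>s. \<kappa> s *\<^sub>R f (y - s))"
      using lborel_integrable_reflect[OF convolve_integrable[OF \<kappa>(1) L2_bsupp_integrable[OF f], of y], of y] by simp
    have i2: "integrable lborel (\<lambda>s. \<kappa> s *\<^sub>R f y)"
      using bounded_bsupp_integrable[OF \<kappa>(1)] by simp
    have "convolve \<kappa> f y = (LINT s|lborel. \<kappa> s *\<^sub>R f (y - s))"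
      unfolding convolve_def using lborel_integral_reflect[of "\<lambda>z. \<kappa> (y - z) *\<^sub>R f z" y] by simp
    moreover have "f y = (LINT s|lborel. \<kappa> s *\<^sub>R f y)"
      using \<kappa>(3) bounded_bsupp_integrable[OF \<kappa>(1)] by simp
    ultimately have "convolve \<kappa> f y - f y = (LINT s|lborel. \<kappa> s *\<^sub>R (f (y - s) - f y))"
      using i1 i2 by (simp add: scaleR_diff_right)
    then have "ennreal (norm (convolve \<kappa> f y - f y)) \<le> (\<integral>\<^sup>+s. norm (\<kappa> s *\<^sub>R (f (y - s) - f y)) \<partial>lborel)"
      using integral_norm_bound_ennreal[of lborel "\<lambda>s. \<kappa> s *\<^sub>R (f (y - s) - f y)"] i1 i2
      by (simp add: scaleR_diff_right)
    \<comment> \<open>The density is shared between the two factors of the Cauchy-Schwarz inequality.\<close>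
    also have "\<dots> = (\<integral>\<^sup>+s. ennreal (sqrt (\<kappa> s)) * ennreal (sqrt (\<kappa> s) * norm (f (y - s) - f y)) \<partial>lborel)"
      by (intro nn_integral_cong) (simp add: \<kappa>(2) flip: ennreal_mult mult.assoc)
    finally have "(ennreal (norm (convolve \<kappa> f y - f y)))\<^sup>2
        \<le> (\<integral>\<^sup>+s. ennreal (sqrt (\<kappa> s)) * ennreal (sqrt (\<kappa> s) * norm (f (y - s) - f y)) \<partial>lborel)\<^sup>2"
      by (rule power_mono) simp
    also have "\<dots> \<le> (\<integral>\<^sup>+s. (ennreal (sqrt (\<kappa> s)))\<^sup>2 \<partial>lborel) * (\<integral>\<^sup>+s. (ennreal (sqrt (\<kappa> s) * norm (f (y - s) - f y)))\<^sup>2 \<partial>lborel)"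
      by (rule Cauchy_Schwarz_nn_integral) auto
    also have "(\<integral>\<^sup>+s. (ennreal (sqrt (\<kappa> s)))\<^sup>2 \<partial>lborel) = 1"
      using k1 \<kappa>(2) by (simp add: ennreal_power)
    also have "(\<integral>\<^sup>+s. (ennreal (sqrt (\<kappa> s) * norm (f (y - s) - f y)))\<^sup>2 \<partial>lborel)
        = (\<integral>\<^sup>+s. ennreal (\<kappa> s) * (ennreal (norm (f (y - s) - f y)))\<^sup>2 \<partial>lborel)"
      using \<kappa>(2) by (intro nn_integral_cong) (simp add: ennreal_power ennreal_mult power_mult_distrib)
    finally show ?thesis by simp
  qed
  have "ennreal (L2_norm_sq (\<lambda>y. convolve \<kappa> f y - f y)) = (\<integral>\<^sup>+y. (ennreal (norm (convolve \<kappa> f y - f y)))\<^sup>2 \<partial>lborel)"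
    using nn_integral_L2_norm_sq[OF L2_bsupp_diff[OF bounded_bsupp_L2_bsupp[OF convolve_bounded_bsupp[OF \<kappa>(1) f]] f]] by simp
  also have "\<dots> \<le> (\<integral>\<^sup>+y. (\<integral>\<^sup>+s. ennreal (\<kappa> s) * (ennreal (norm (f (y - s) - f y)))\<^sup>2 \<partial>lborel) \<partial>lborel)"
    by (intro nn_integral_mono pt)
  also have "\<dots> = (\<integral>\<^sup>+s. (\<integral>\<^sup>+y. ennreal (\<kappa> s) * (ennreal (norm (f (y - s) - f y)))\<^sup>2 \<partial>lborel) \<partial>lborel)"
    by (rule lborel_pair.Fubini') measurable
  also have "\<dots> \<le> (\<integral>\<^sup>+s. ennreal (\<kappa> s) * ennreal e \<partial>lborel)"
  proof (intro nn_integral_mono)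
    fix s :: 'a
    have "(\<integral>\<^sup>+y. (ennreal (norm (f (y - s) - f y)))\<^sup>2 \<partial>lborel) = ennreal (L2_norm_sq (\<lambda>x. f (x + (- s)) - f x))"
      using nn_integral_L2_norm_sq[OF L2_bsupp_diff[OF L2_bsupp_translate[OF f, of "- s"] f]] by simp
    then have "(\<integral>\<^sup>+y. ennreal (\<kappa> s) * (ennreal (norm (f (y - s) - f y)))\<^sup>2 \<partial>lborel)
       = ennreal (\<kappa> s) * ennreal (L2_norm_sq (\<lambda>x. f (x + (- s)) - f x))"
      by (simp add: nn_integral_cmult)
    also have "\<dots> \<le> ennreal (\<kappa> s) * ennreal e"
      using e(2)[of "- s"] \<kappa>(4)[of s] by (cases "\<kappa> s = 0") (auto intro!: mult_left_mono ennreal_leI)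
    finally show "(\<integral>\<^sup>+y. ennreal (\<kappa> s) * (ennreal (norm (f (y - s) - f y)))\<^sup>2 \<partial>lborel) \<le> ennreal (\<kappa> s) * ennreal e" .
  qed
  also have "\<dots> = ennreal e" using k1 by (simp add: nn_integral_multc)
  finally show ?thesis using e(1) by simp
qed

definition mollifier :: "real \<Rightarrow> ('a::euclidean_space \<Rightarrow> real) \<Rightarrow> bool" where
  "mollifier r \<kappa> \<longleftrightarrow> test_function UNIV \<kappa> \<and> (\<forall>z. \<kappa> z \<ge> 0) \<and> (LINT z|lborel. \<kappa> z) = 1
     \<and> (\<forall>z. \<kappa> z \<noteq> 0 \<longrightarrow> norm z < r)"

lemma mollification_tendsto:
  assumes \<kappa>: "\<And>k. mollifier (1 / real (Suc k)) (\<kappa> k)" and f: "L2_bsupp f"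
  shows "(\<lambda>k. L2_norm_sq (\<lambda>y. convolve (\<kappa> k) f y - f y)) \<longlonglongrightarrow> 0"
proof (rule LIMSEQ_I)
  fix e :: real assume "e > 0"
  then have "eventually (\<lambda>h. L2_norm_sq (\<lambda>x. f (x + h) - f x) < e / 2) (at 0)"
    using order_tendstoD(2)[OF L2_translation_continuous[OF f], of "e / 2"] by simp
  then obtain d where d: "d > 0" "\<And>h. h \<noteq> 0 \<Longrightarrow> norm h < d \<Longrightarrow> L2_norm_sq (\<lambda>x. f (x + h) - f x) < e / 2"
    unfolding eventually_at dist_norm by auto
  \<comment> \<open>The filter \<open>at 0\<close> says nothing about \<open>h = 0\<close>, where the increment vanishes.\<close>
  have d0: "L2_norm_sq (\<lambda>x. f (x + h) - f x) \<le> e / 2" if "norm h < d" for h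
    using d(2)[of h] that \<open>e > 0\<close> by (cases "h = 0") (auto simp: L2_norm_sq_def)
  obtain m where m: "1 / real (Suc m) < d" using d(1) nat_approx_posE by blast
  have "L2_norm_sq (\<lambda>y. convolve (\<kappa> k) f y - f y) \<le> e / 2" if "k \<ge> m" for k
  proof (rule mollification_error[where r="1 / real (Suc k)"])
    fix h :: 'a assume "norm h < 1 / real (Suc k)"
    also have "\<dots> \<le> 1 / real (Suc m)" using that by (simp add: frac_le)
    finally show "L2_norm_sq (\<lambda>x. f (x + h) - f x) \<le> e / 2" using m d0 by simp
  qed (use \<kappa>[of k] f \<open>e > 0\<close> in \<open>auto simp: mollifier_def intro: test_function_bounded_bsupp\<close>)
  then show "\<exists>m. \<forall>k\<ge>m. norm (L2_norm_sq (\<lambda>y. convolve (\<kappa> k) f y - f y) - 0) < e"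
    using \<open>e > 0\<close> by (intro exI[of _ m]) fastforce
qed

text \<open>Any nonzero test function yields mollifiers: its square is nonnegative, dilation shrinks the
  support to a small ball, and the integral is positive since the square is continuous and not
  identically zero.\<close>

lemma mollifier_exists:
  fixes \<alpha> :: "'a::euclidean_space \<Rightarrow> real"
  assumes \<alpha>: "test_function UNIV \<alpha>" "\<alpha> z0 \<noteq> 0" and r: "r > 0"
  shows "\<exists>\<kappa> :: 'a \<Rightarrow> real. mollifier r \<kappa>"
proof -
  obtain K R where K: "K > 0" "R > 0" "\<forall>z. norm (\<alpha> z) \<le> K" "\<forall>z. norm z > R \<longrightarrow> \<alpha> z = 0"
    using bounded_bsupp_bounds[OF test_function_bounded_bsupp[OF \<alpha>(1)]] by (elim exE conjE) (rule that)
  \<comment> \<open>Dilation by \<open>c\<close> shrinks the ball of radius \<open>R\<close> to radius \<open>R / c < r\<close>.\<close>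
  define c where "c = (R + 1) / r"
  have c: "c > 0" using K r by (simp add: c_def)
  define \<psi> where "\<psi> z = \<alpha> (0 + c *\<^sub>R z) * \<alpha> (0 + c *\<^sub>R z)" for z
  have sm: "smooth \<psi>"
    unfolding \<psi>_def[abs_def] using \<alpha>(1) by (intro smooth_mult smooth_affine_compose) (auto simp: test_function_def)
  have sup: "norm z \<le> R / c" if "\<psi> z \<noteq> 0" for z
  proof -
    have "norm (c *\<^sub>R z) \<le> R" using K(4) that unfolding \<psi>_def by (metis add_0 mult_eq_0_iff not_le)
    then show ?thesis using c by (simp add: pos_le_divide_eq mult.commute)
  qed
  have Rc: "R / c < r" using K r by (simp add: c_def field_simps)
  have tf: "test_function UNIV \<psi>"
    by (rule test_functionI[OF sm compact_cball[of 0 "R / c"]]) (use sup in auto)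
  have int: "integrable lborel \<psi>" by (rule bounded_bsupp_integrable[OF test_function_bounded_bsupp[OF tf]])
  have nn: "\<psi> z \<ge> 0" for z by (simp add: \<psi>_def)
  have "(LINT z|lborel. \<psi> z) \<noteq> 0"
  proof
    assume "(LINT z|lborel. \<psi> z) = 0"
    then have "AE z in lborel. \<psi> z = 0"
      using integral_nonneg_eq_0_iff_AE[OF int] nn by simp
    moreover have op: "open {z. \<psi> z \<noteq> 0}"
      using smooth_continuous_on[OF sm, of UNIV] by (intro open_Collect_neq) auto
    ultimately have "{z. \<psi> z \<noteq> 0} \<in> null_sets lborel"
      using AE_iff_null_sets[of "{z. \<psi> z \<noteq> 0}" lborel] by auto
    then have "negligible {z. \<psi> z \<noteq> 0}"
      unfolding negligible_iff_null_sets by (rule null_sets_completionI)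
    then have "{z. \<psi> z \<noteq> 0} = {}" using open_not_negligible[OF op] by blast
    moreover have "\<psi> (z0 /\<^sub>R c) \<noteq> 0" using c \<alpha>(2) by (simp add: \<psi>_def)
    ultimately show False by blast
  qed
  then have I: "(LINT z|lborel. \<psi> z) > 0" using Bochner_Integration.integral_nonneg[of lborel \<psi>] nn by (simp add: less_le)
  define \<kappa> where "\<kappa> z = inverse (LINT z|lborel. \<psi> z) *\<^sub>R \<psi> z" for z
  have "smooth \<kappa>" unfolding \<kappa>_def[abs_def]
    by (rule smooth_bounded_linear_compose[OF bounded_linear_scaleR_right sm])
  then have "test_function UNIV \<kappa>"
    by (rule test_functionI[OF _ compact_cball[of 0 "R / c"]]) (use sup in \<open>auto simp: \<kappa>_def\<close>)
  moreover have "(LINT z|lborel. \<kappa> z) = 1" using I by (simp add: \<kappa>_def)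
  moreover have "norm z < r" if "\<kappa> z \<noteq> 0" for z
    using sup[of z] that Rc by (auto simp: \<kappa>_def)
  moreover have "\<kappa> z \<ge> 0" for z using I nn[of z] by (simp add: \<kappa>_def)
  ultimately show ?thesis unfolding mollifier_def by blast
qed

section \<open>Slices of mollified functions\<close>

lemma bounded_bilinear_matrix_vector:
  "bounded_bilinear ((*v) :: complex ^ 'n ^ 'm \<Rightarrow> complex ^ 'n \<Rightarrow> complex ^ 'm)"
proof
  show "\<exists>K. \<forall>(A :: complex ^ 'n ^ 'm) x. norm (A *v x) \<le> norm A * norm x * K"
  proof (intro exI allI)
    fix A :: "complex ^ 'n ^ 'm" and x :: "complex ^ 'n"
    have "norm (A *v x) \<le> (\<Sum>i\<in>UNIV. norm ((A *v x) $ i))"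
      unfolding norm_vec_def[of "A *v x"] by (rule L2_set_le_sum) simp
    also have "\<dots> \<le> (\<Sum>i\<in>(UNIV :: 'm set). \<Sum>j\<in>(UNIV :: 'n set). norm A * norm x)"
    proof (rule sum_mono)
      fix i
      have "norm ((A *v x) $ i) \<le> (\<Sum>j\<in>UNIV. norm (A $ i $ j * x $ j))"
        by (simp add: matrix_vector_mult_def norm_sum)
      also have "\<dots> \<le> (\<Sum>j\<in>(UNIV :: 'n set). norm A * norm x)"
        unfolding norm_mult
        by (intro sum_mono mult_mono order_trans[OF Finite_Cartesian_Product.norm_nth_le Finite_Cartesian_Product.norm_nth_le]
            Finite_Cartesian_Product.norm_nth_le) auto
      finally show "norm ((A *v x) $ i) \<le> (\<Sum>j\<in>(UNIV :: 'n set). norm A * norm x)" .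
    qed
    also have "\<dots> = norm A * norm x * (real CARD('m) * real CARD('n))" by simp
    finally show "norm (A *v x) \<le> norm A * norm x * (real CARD('m) * real CARD('n))" .
  qed
qed (auto simp: matrix_vector_mult_def vec_eq_iff algebra_simps sum.distrib scaleR_sum_right)

lemma inner_eq_Re_hermitian:
  fixes a b :: "complex ^ 'n"
  shows "a \<bullet> b = Re (\<Sum>i\<in>UNIV. a $ i * cnj (b $ i))"
  by (simp add: inner_vec_def inner_complex_def)

lemma bounded_bsupp_in_L2:
  assumes f: "bounded_bsupp f" shows "f \<in> L2"
proof -
  have m: "f \<in> borel_measurable lborel" using f by (simp add: bounded_bsupp_def)
  then show ?thesis
    using L2_bsupp_square_integrable[OF bounded_bsupp_L2_bsupp[OF f]] unfolding L2_def
    by (auto intro: measurable_completion simp: integrable_completion)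
qed

lemma integral_pair_split:
  fixes f :: "'a::euclidean_space \<times> 'c::euclidean_space \<Rightarrow> 'b::euclidean_space"
  assumes "integrable lborel f"
  shows "(LINT z|lborel. f z) = (LINT t|lborel. (LINT x|lborel. f (t, x)))"
  using lborel_pair.integral_fst'[of f] assms by (simp add: lborel_prod)

lemma integrable_pair_split:
  fixes f :: "'a::euclidean_space \<times> 'c::euclidean_space \<Rightarrow> 'b::euclidean_space"
  assumes "integrable lborel f"
  shows "integrable lborel (\<lambda>t. LINT x|lborel. f (t, x))"
  using lborel_pair.integrable_fst'[of f] assms by (simp add: lborel_prod)

lemma integrable_tensor:
  fixes f :: "'a::euclidean_space \<Rightarrow> real" and g :: "'c::euclidean_space \<Rightarrow> real"
  assumes "integrable lborel f" "integrable lborel g"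
  shows "integrable (lborel \<Otimes>\<^sub>M lborel) (\<lambda>p. f (fst p) * g (snd p))"
proof (rule lborel_pair.Fubini_integrable)
  have [measurable]: "f \<in> borel_measurable borel" "g \<in> borel_measurable borel" using assms by simp_all
  show "(\<lambda>p. f (fst p) * g (snd p)) \<in> borel_measurable (lborel \<Otimes>\<^sub>M lborel)" by measurable
qed (use assms in \<open>simp_all add: abs_mult\<close>)

text \<open>Testing a slice of a convolution against \<open>\<phi>\<close> amounts to integrating \<open>F\<close> against a kernel in
  which \<open>\<phi>\<close> and \<open>\<kappa>\<close> are combined; after that, integration by parts concerns only the explicit
  functions \<open>\<phi>\<close> and \<open>\<kappa>\<close>.\<close>

lemma integral_convolve_slice:
  fixes F :: "'a::euclidean_space \<times> 'c::euclidean_space \<Rightarrow> 'b::euclidean_space"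
  assumes \<phi>: "bounded_bsupp \<phi>" and \<kappa>: "bounded_bsupp \<kappa>" and F: "integrable lborel F"
  shows "(LINT x|lborel. \<phi> x *\<^sub>R convolve \<kappa> F (t, x))
    = (LINT z|lborel. (LINT x|lborel. \<phi> x * \<kappa> ((t, x) - z)) *\<^sub>R F z)"
proof -
  have [measurable]: "\<kappa> \<in> borel_measurable borel" "\<phi> \<in> borel_measurable borel" "F \<in> borel_measurable borel"
    using \<kappa> \<phi> F by (simp_all add: bounded_bsupp_def)
  obtain K R where K: "K > 0" "R > 0" "\<forall>z. norm (\<kappa> z) \<le> K" "\<forall>z. norm z > R \<longrightarrow> \<kappa> z = 0"
    using bounded_bsupp_bounds[OF \<kappa>] by (elim exE conjE) (rule that)
  have shift: "(\<lambda>p. (t, fst p) - snd p) \<in> borel_measurable (lborel \<Otimes>\<^sub>M lborel)"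
    unfolding lborel_prod measurable_lborel1 measurable_lborel2 by (intro borel_measurable_continuous_onI continuous_intros)
  have int: "integrable (lborel \<Otimes>\<^sub>M lborel) (\<lambda>p. (\<phi> (fst p) * \<kappa> ((t, fst p) - snd p)) *\<^sub>R F (snd p))"
  proof (rule Bochner_Integration.integrable_bound)
    show "integrable (lborel \<Otimes>\<^sub>M lborel) (\<lambda>p. K * (\<bar>\<phi> (fst p)\<bar> * norm (F (snd p))))"
      using bounded_bsupp_integrable[OF \<phi>] F by (intro integrable_mult_right integrable_tensor) auto
    show "(\<lambda>p. (\<phi> (fst p) * \<kappa> ((t, fst p) - snd p)) *\<^sub>R F (snd p)) \<in> borel_measurable (lborel \<Otimes>\<^sub>M lborel)"
      using measurable_compose[OF shift, of \<kappa> borel] by measurable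
    show "AE p in lborel \<Otimes>\<^sub>M lborel. norm ((\<phi> (fst p) * \<kappa> ((t, fst p) - snd p)) *\<^sub>R F (snd p))
        \<le> norm (K * (\<bar>\<phi> (fst p)\<bar> * norm (F (snd p))))"
    proof (rule AE_I2)
      fix p :: "'c \<times> 'a \<times> 'c"
      have "\<bar>\<kappa> ((t, fst p) - snd p)\<bar> * (\<bar>\<phi> (fst p)\<bar> * norm (F (snd p))) \<le> K * (\<bar>\<phi> (fst p)\<bar> * norm (F (snd p)))"
        using K(3)[rule_format, of "(t, fst p) - snd p"] by (intro mult_right_mono) auto
      then show "norm ((\<phi> (fst p) * \<kappa> ((t, fst p) - snd p)) *\<^sub>R F (snd p))
        \<le> norm (K * (\<bar>\<phi> (fst p)\<bar> * norm (F (snd p))))" using K(1) by (simp add: abs_mult mult_ac)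
    qed
  qed
  have "(LINT x|lborel. \<phi> x *\<^sub>R convolve \<kappa> F (t, x))
      = (LINT x|lborel. (LINT z|lborel. (\<phi> x * \<kappa> ((t, x) - z)) *\<^sub>R F z))"
    unfolding convolve_def by (simp flip: scaleR_scaleR)
  also have "\<dots> = (LINT z|lborel. (LINT x|lborel. (\<phi> x * \<kappa> ((t, x) - z)) *\<^sub>R F z))"
    by (rule lborel_pair.Fubini_integral[symmetric]) (use int in \<open>simp add: case_prod_beta'\<close>)
  also have "\<dots> = (LINT z|lborel. (LINT x|lborel. \<phi> x * \<kappa> ((t, x) - z)) *\<^sub>R F z)"
  proof -
    have "integrable lborel (\<lambda>x. \<phi> x * \<kappa> ((t, x) - z))" for z
      by (intro bounded_bsupp_integrable bounded_bsupp_mult \<phi> bounded_bsupp_slice[OF bounded_bsupp_shift[OF \<kappa>]])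
    then show ?thesis by simp
  qed
  finally show ?thesis .
qed

lemma integral_convolve_slice_by_parts:
  fixes F :: "'a::euclidean_space \<times> 'c::euclidean_space \<Rightarrow> 'b::euclidean_space"
  assumes \<phi>: "bounded_bsupp \<phi>" "bounded_bsupp \<phi>'" "dir_deriv \<phi> e \<phi>'"
    and \<kappa>: "bounded_bsupp \<kappa>" "bounded_bsupp \<kappa>'" "dir_deriv \<kappa> (0, e) \<kappa>'" and F: "integrable lborel F"
  shows "(LINT x|lborel. \<phi> x *\<^sub>R convolve \<kappa>' F (t, x)) = - (LINT x|lborel. \<phi>' x *\<^sub>R convolve \<kappa> F (t, x))"
proof -
  have parts: "(LINT x|lborel. \<phi> x * \<kappa>' ((t, x) - z)) = - (LINT x|lborel. \<phi>' x * \<kappa> ((t, x) - z))" for z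
  proof -
    have b: "bounded_bsupp (\<lambda>x. \<kappa> ((t, x) - z))" "bounded_bsupp (\<lambda>x. \<kappa>' ((t, x) - z))"
      using bounded_bsupp_slice[OF bounded_bsupp_shift[OF \<kappa>(1)]] bounded_bsupp_slice[OF bounded_bsupp_shift[OF \<kappa>(2)]] by auto
    have "dir_deriv (\<lambda>x. \<kappa> ((t, x) - z)) e (\<lambda>x. \<kappa>' ((t, x) - z))"
      unfolding dir_deriv_def
    proof
      fix x
      have "((\<lambda>s. \<kappa> (((t, x) - z) + s *\<^sub>R (0, e))) has_real_derivative \<kappa>' ((t, x) - z)) (at 0)"
        using \<kappa>(3) unfolding dir_deriv_def by blast
      moreover have "((t, x) - z) + s *\<^sub>R (0, e) = (t, x + s *\<^sub>R e) - z" for s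
        by (cases z) (simp add: algebra_simps)
      ultimately show "((\<lambda>s. \<kappa> ((t, x + s *\<^sub>R e) - z)) has_real_derivative \<kappa>' ((t, x) - z)) (at 0)"
        by (simp only:)
    qed
    from dir_deriv_mult[OF \<phi>(3) this]
    have "(LINT x|lborel. \<phi> x * \<kappa>' ((t, x) - z) + \<phi>' x * \<kappa> ((t, x) - z)) = 0"
      by (rule integral_dir_deriv_zero[rotated 2]) (intro bounded_bsupp_add bounded_bsupp_mult \<phi> b)+
    then show ?thesis
      using bounded_bsupp_integrable[OF bounded_bsupp_mult[OF \<phi>(1) b(2)]] bounded_bsupp_integrable[OF bounded_bsupp_mult[OF \<phi>(2) b(1)]] by simp
  qed
  show ?thesis
    unfolding integral_convolve_slice[OF \<phi>(1) \<kappa>(2) F] integral_convolve_slice[OF \<phi>(2) \<kappa>(1) F] parts by simp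
qed

lemma matrix_vector_measurable [measurable]:
  fixes f :: "'a \<Rightarrow> complex ^ 'N ^ 'm" and g :: "'a \<Rightarrow> complex ^ 'N"
  assumes [measurable]: "f \<in> borel_measurable S" "g \<in> borel_measurable S"
  shows "(\<lambda>x. f x *v g x) \<in> borel_measurable S"
  by (rule borel_measurable_continuous_Pair[OF assms])
     (intro bounded_bilinear.continuous_on[OF bounded_bilinear_matrix_vector] continuous_intros)

lemma L2_bsupp_matrix_vector:
  fixes A :: "complex ^ 'N ^ 'm"
  assumes "L2_bsupp u" shows "L2_bsupp (\<lambda>z. A *v u z)"
proof -
  have [measurable]: "u \<in> borel_measurable borel" using assms by measurable
  show ?thesis
    by (rule L2_bsupp_bound[OF assms, where K="onorm ((*v) A)"]) (auto intro: onorm)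
qed

lemma coefficient_snd_measurable [measurable]:
  fixes B :: "'c::euclidean_space \<Rightarrow> complex ^ 'N ^ 'm"
  assumes B: "B \<in> borel_measurable borel"
  shows "(\<lambda>z :: 'a::euclidean_space \<times> 'c. B (snd z)) \<in> borel_measurable borel"
  by (rule measurable_compose[OF _ B]) (intro borel_measurable_continuous_onI continuous_intros)

lemma L2_bsupp_coefficient:
  fixes f :: "'a::euclidean_space \<times> 'c::euclidean_space \<Rightarrow> complex ^ 'N"
  assumes B [measurable]: "B \<in> borel_measurable borel" and K: "\<And>x a. norm (B x *v a) \<le> K * norm a"
    and f: "L2_bsupp f"
  shows "L2_bsupp (\<lambda>z. B (snd z) *v f z)"
proof -
  have [measurable]: "f \<in> borel_measurable borel" using f by measurable
  show ?thesis by (rule L2_bsupp_bound[OF f, where K=K]) (use K in auto)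
qed

lemma convolve_matrix_vector:
  fixes A :: "complex ^ 'N ^ 'm"
  assumes "bounded_bsupp \<kappa>" "L2_bsupp u"
  shows "convolve \<kappa> (\<lambda>z. A *v u z) y = A *v convolve \<kappa> u y"
proof -
  have "A *v convolve \<kappa> u y = (LINT z|lborel. A *v (\<kappa> (y - z) *\<^sub>R u z))"
    unfolding convolve_def
    by (rule integral_bounded_linear[symmetric]) (use assms in \<open>auto intro: convolve_integrable L2_bsupp_integrable\<close>)
  then show ?thesis
    by (simp add: convolve_def bounded_bilinear.scaleR_right[OF bounded_bilinear_matrix_vector])
qed

lemma lebesgue_integral_borel:
  fixes f :: "'a::euclidean_space \<Rightarrow> 'b::euclidean_space"
  shows "f \<in> borel_measurable borel \<Longrightarrow> (LINT z|lebesgue. f z) = (LINT z|lborel. f z)"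
  by (rule integral_completion) simp

text \<open>The reflected kernel \<open>z \<mapsto> \<kappa> (y - z)\<close> is a test function for the weak equation; reflection
  reverses the sign of its derivatives and so cancels the sign in the definition.\<close>

lemma convolve_weak_diffop:
  fixes e :: "'n::finite \<Rightarrow> 'a::euclidean_space" and u W :: "'a \<Rightarrow> complex ^ 'N"
  assumes \<kappa>: "test_function UNIV \<kappa>" and e: "\<And>j. e j \<in> Basis" and u: "L2_bsupp u" and W: "L2_bsupp W"
    and weak: "weak_diffop UNIV e M u W"
  shows "convolve \<kappa> W y = (\<Sum>j\<in>UNIV. convolve (\<lambda>z. frechet_derivative \<kappa> (at z) (e j)) (\<lambda>z. M j *v u z) y)"
proof -
  define \<kappa>' where "\<kappa>' j z = frechet_derivative \<kappa> (at z) (e j)" for j z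
  have \<kappa>': "bounded_bsupp (\<kappa>' j)" for j
    unfolding \<kappa>'_def by (rule test_function_partial_bounded_bsupp[OF \<kappa> e])
  have m [measurable]: "u \<in> borel_measurable borel" "W \<in> borel_measurable borel"
    "\<kappa> \<in> borel_measurable borel" "\<And>j. \<kappa>' j \<in> borel_measurable borel"
    using u W test_function_bounded_bsupp[OF \<kappa>] \<kappa>' by (auto simp: L2_bsupp_def bounded_bsupp_def)
  have int: "integrable lborel (\<lambda>z. \<kappa>' j (y - z) *\<^sub>R (M j *v u z))" for j
    by (rule convolve_integrable[OF \<kappa>' L2_bsupp_integrable[OF L2_bsupp_matrix_vector[OF u]]])
  have "convolve \<kappa> W y = (LINT z|lebesgue. \<kappa> (y - z) *\<^sub>R W z)"
    unfolding convolve_def by (rule lebesgue_integral_borel[symmetric]) measurable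
  also have "\<dots> = - (LINT z|lebesgue. (\<Sum>j\<in>UNIV. - \<kappa>' j (y - z) *\<^sub>R (M j *v u z)))"
    using weak[unfolded weak_diffop_def, rule_format, OF test_function_reflect(1)[OF \<kappa>]]
    by (simp add: test_function_reflect(2)[OF \<kappa>] \<kappa>'_def)
  also have "\<dots> = - (LINT z|lborel. (\<Sum>j\<in>UNIV. - \<kappa>' j (y - z) *\<^sub>R (M j *v u z)))"
    by (subst lebesgue_integral_borel) measurable
  also have "\<dots> = (\<Sum>j\<in>UNIV. convolve (\<kappa>' j) (\<lambda>z. M j *v u z) y)"
    using int by (simp add: convolve_def sum_negf)
  finally show ?thesis by (simp add: \<kappa>'_def[abs_def])
qed

lemma convolve_weak_deriv:
  fixes e :: "'a::euclidean_space" and u U :: "'a \<Rightarrow> 'b::euclidean_space"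
  assumes \<kappa>: "test_function UNIV \<kappa>" and e: "e \<in> Basis" and u: "L2_bsupp u" and U: "L2_bsupp U"
    and weak: "weak_deriv UNIV e u U"
  shows "convolve \<kappa> U y = convolve (\<lambda>z. frechet_derivative \<kappa> (at z) e) u y"
proof -
  define \<kappa>' where "\<kappa>' z = frechet_derivative \<kappa> (at z) e" for z
  have m [measurable]: "u \<in> borel_measurable borel" "U \<in> borel_measurable borel"
    "\<kappa> \<in> borel_measurable borel" "\<kappa>' \<in> borel_measurable borel"
    using u U test_function_bounded_bsupp[OF \<kappa>] test_function_partial_bounded_bsupp[OF \<kappa> e]
    by (auto simp: L2_bsupp_def bounded_bsupp_def \<kappa>'_def[abs_def])
  have "convolve \<kappa> U y = (LINT z|lebesgue. \<kappa> (y - z) *\<^sub>R U z)"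
    unfolding convolve_def by (rule lebesgue_integral_borel[symmetric]) measurable
  also have "\<dots> = - (LINT z|lebesgue. - \<kappa>' (y - z) *\<^sub>R u z)"
    using weak[unfolded weak_deriv_def, rule_format, OF test_function_reflect(1)[OF \<kappa>]]
    by (simp add: test_function_reflect(2)[OF \<kappa>] \<kappa>'_def)
  also have "\<dots> = - (LINT z|lborel. - \<kappa>' (y - z) *\<^sub>R u z)"
    by (subst lebesgue_integral_borel) measurable
  finally show ?thesis by (simp add: convolve_def \<kappa>'_def)
qed

text \<open>The weak equation turns \<open>\<kappa> \<star> W\<close> into convolutions of \<open>u\<close> with derivatives of \<open>\<kappa>\<close>, which are
  then moved onto the test function \<open>\<phi>\<close> of \<open>x\<close>. This holds for every \<open>t\<close>, whereas the slices of
  \<open>u\<close> itself could only be handled for almost every \<open>t\<close>.\<close>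

lemma diffop_convolve_slice:
  fixes M :: "'n::finite \<Rightarrow> complex ^ 'N ^ 'N" and u W :: "real \<times> (real ^ 'n) \<Rightarrow> complex ^ 'N"
  assumes \<kappa>: "test_function UNIV \<kappa>" and u: "L2_bsupp u" and W: "L2_bsupp W"
    and weak: "weak_diffop UNIV (\<lambda>j. (0, axis j 1)) M u W"
  shows "diffop M (\<lambda>x. convolve \<kappa> u (t, x)) (\<lambda>x. convolve \<kappa> W (t, x))"
proof -
  have b: "bounded_bsupp \<kappa>" by (rule test_function_bounded_bsupp[OF \<kappa>])
  have p: "bounded_bsupp (\<lambda>x. convolve \<kappa> u (t, x))" and q: "bounded_bsupp (\<lambda>x. convolve \<kappa> W (t, x))"
    using bounded_bsupp_slice[OF convolve_bounded_bsupp[OF b u]] bounded_bsupp_slice[OF convolve_bounded_bsupp[OF b W]] by auto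
  define \<kappa>' where "\<kappa>' j = (\<lambda>z. frechet_derivative \<kappa> (at z) (0, axis j 1))" for j :: 'n
  have e: "(0, axis j 1) \<in> (Basis :: (real \<times> (real ^ 'n)) set)" for j by (auto simp: Basis_prod_def)
  have \<kappa>': "bounded_bsupp (\<kappa>' j)" for j
    unfolding \<kappa>'_def by (rule test_function_partial_bounded_bsupp[OF \<kappa> e])
  have "weak_diffop UNIV (\<lambda>j. axis j 1) M (\<lambda>x. convolve \<kappa> u (t, x)) (\<lambda>x. convolve \<kappa> W (t, x))"
    unfolding weak_diffop_def
  proof (intro allI impI)
    fix \<phi> :: "real ^ 'n \<Rightarrow> real" assume \<phi>: "test_function UNIV \<phi>"
    define \<phi>' where "\<phi>' j x = frechet_derivative \<phi> (at x) (axis j 1)" for j :: 'n and x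
    have b\<phi>: "bounded_bsupp \<phi>" and b\<phi>': "bounded_bsupp (\<phi>' j)" for j
      unfolding \<phi>'_def by (rule test_function_bounded_bsupp[OF \<phi>], rule test_function_partial_bounded_bsupp[OF \<phi>]) simp
    have bc: "bounded_bsupp (\<lambda>x. convolve k (\<lambda>z. M j *v u z) (t, x))" if "bounded_bsupp k" for k j
      by (rule bounded_bsupp_slice[OF convolve_bounded_bsupp[OF that L2_bsupp_matrix_vector[OF u]]])
    have m [measurable]: "(\<lambda>x. convolve \<kappa> u (t, x)) \<in> borel_measurable borel"
      "(\<lambda>x. convolve \<kappa> W (t, x)) \<in> borel_measurable borel" "\<phi> \<in> borel_measurable borel" "\<And>j. \<phi>' j \<in> borel_measurable borel"
      using p q b\<phi> b\<phi>' by (auto simp: bounded_bsupp_def)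
    have "(LINT x|lebesgue. \<phi> x *\<^sub>R convolve \<kappa> W (t, x)) = (LINT x|lborel. \<phi> x *\<^sub>R convolve \<kappa> W (t, x))"
      by (rule lebesgue_integral_borel) measurable
    also have "\<dots> = (LINT x|lborel. (\<Sum>j\<in>UNIV. \<phi> x *\<^sub>R convolve (\<kappa>' j) (\<lambda>z. M j *v u z) (t, x)))"
      using convolve_weak_diffop[OF \<kappa> e u W weak] by (simp add: \<kappa>'_def scaleR_sum_right)
    also have "\<dots> = (\<Sum>j\<in>UNIV. LINT x|lborel. \<phi> x *\<^sub>R convolve (\<kappa>' j) (\<lambda>z. M j *v u z) (t, x))"
      by (intro Bochner_Integration.integral_sum bounded_bsupp_integrable bounded_bsupp_scaleR b\<phi> bc \<kappa>')
    also have "\<dots> = (\<Sum>j\<in>UNIV. - (LINT x|lborel. \<phi>' j x *\<^sub>R convolve \<kappa> (\<lambda>z. M j *v u z) (t, x)))"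
    proof (rule sum.cong[OF refl])
      fix j
      have "dir_deriv \<kappa> (0, axis j 1) (\<kappa>' j)" "dir_deriv \<phi> (axis j 1) (\<phi>' j)"
        unfolding \<kappa>'_def \<phi>'_def by (rule smooth_dir_deriv[OF test_function_smooth[OF \<kappa>]], rule smooth_dir_deriv[OF test_function_smooth[OF \<phi>]])
      then show "(LINT x|lborel. \<phi> x *\<^sub>R convolve (\<kappa>' j) (\<lambda>z. M j *v u z) (t, x))
          = - (LINT x|lborel. \<phi>' j x *\<^sub>R convolve \<kappa> (\<lambda>z. M j *v u z) (t, x))"
        by (intro integral_convolve_slice_by_parts b\<phi> b\<phi>' b \<kappa>' L2_bsupp_integrable L2_bsupp_matrix_vector u)
    qed
    also have "\<dots> = - (\<Sum>j\<in>UNIV. LINT x|lborel. \<phi>' j x *\<^sub>R convolve \<kappa> (\<lambda>z. M j *v u z) (t, x))"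
      by (simp add: sum_negf)
    also have "\<dots> = - (LINT x|lborel. (\<Sum>j\<in>UNIV. \<phi>' j x *\<^sub>R convolve \<kappa> (\<lambda>z. M j *v u z) (t, x)))"
      by (subst Bochner_Integration.integral_sum) (auto intro!: bounded_bsupp_integrable bounded_bsupp_scaleR b\<phi>' bc b)
    also have "\<dots> = - (LINT x|lborel. (\<Sum>j\<in>UNIV. \<phi>' j x *\<^sub>R (M j *v convolve \<kappa> u (t, x))))"
      by (simp add: convolve_matrix_vector[OF b u])
    also have "\<dots> = - (LINT x|lebesgue. (\<Sum>j\<in>UNIV. \<phi>' j x *\<^sub>R (M j *v convolve \<kappa> u (t, x))))"
      by (subst lebesgue_integral_borel) measurable
    finally show "(LINT x|lebesgue. \<phi> x *\<^sub>R convolve \<kappa> W (t, x))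
        = - (LINT x|lebesgue. (\<Sum>j\<in>UNIV. frechet_derivative \<phi> (at x) (axis j 1) *\<^sub>R (M j *v convolve \<kappa> u (t, x))))"
      by (simp add: \<phi>'_def)
  qed
  then show ?thesis unfolding diffop_def using bounded_bsupp_in_L2[OF p] bounded_bsupp_in_L2[OF q] by simp
qed

lemma bounded_bsupp_inner_integrable: "bounded_bsupp f \<Longrightarrow> bounded_bsupp g \<Longrightarrow> integrable lborel (\<lambda>z. f z \<bullet> g z)"
  by (intro L2_bsupp_inner_integrable bounded_bsupp_L2_bsupp)

section \<open>The energy relations\<close>

lemma hermitian_measurable:
  fixes f g :: "'a::euclidean_space \<Rightarrow> complex ^ 'N"
  assumes f: "f \<in> borel_measurable borel" and g: "g \<in> borel_measurable borel"
  shows "(\<lambda>x. f x $ i * cnj (g x $ i)) \<in> borel_measurable borel"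
proof -
  have nth: "(\<lambda>x. k x $ i) \<in> borel_measurable borel" if "k \<in> borel_measurable borel"
    for k :: "'a \<Rightarrow> complex ^ 'N"
    by (rule measurable_compose[OF that borel_measurable_continuous_onI[OF continuous_on_component[OF continuous_on_id]]])
  show ?thesis
    by (intro borel_measurable_times nth f
        measurable_compose[OF nth[OF g] borel_measurable_continuous_onI[OF continuous_on_cnj[OF continuous_on_id]]])
qed

lemma Re_L2_inner:
  assumes f: "bounded_bsupp f" and g: "bounded_bsupp g"
  shows "Re (L2_inner f g) = (LINT x|lborel. f x \<bullet> g x)"
proof -
  have [measurable]: "f \<in> borel_measurable borel" "g \<in> borel_measurable borel" using f g by measurable
  note mc = hermitian_measurable[OF bounded_bsupp_measurable[OF f] bounded_bsupp_measurable[OF g]]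
  obtain K R where K: "K > 0" "R > 0" "\<forall>z. norm (f z) \<le> K" "\<forall>z. norm z > R \<longrightarrow> f z = 0"
    using bounded_bsupp_bounds[OF f] by (elim exE conjE) (rule that)
  have "bounded_bsupp (\<lambda>x. f x $ i * cnj (g x $ i))" for i
  proof (rule bounded_bsupp_bound[OF g mc, where K=K])
    show "norm (f z $ i * cnj (g z $ i)) \<le> K * norm (g z)" for z
      using K(1,3) Finite_Cartesian_Product.norm_nth_le[of "f z" i] Finite_Cartesian_Product.norm_nth_le[of "g z" i]
      unfolding norm_mult complex_mod_cnj by (intro mult_mono) (auto intro: order_trans)
  qed
  then have int: "integrable lborel (\<lambda>x. \<Sum>i\<in>UNIV. f x $ i * cnj (g x $ i))"
    by (intro Bochner_Integration.integrable_sum bounded_bsupp_integrable)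
  have "Re (L2_inner f g) = Re (LINT x|lborel. (\<Sum>i\<in>UNIV. f x $ i * cnj (g x $ i)))"
    unfolding L2_inner_def by (subst lebesgue_integral_borel) (intro borel_measurable_sum mc, simp)
  also have "\<dots> = (LINT x|lborel. f x \<bullet> g x)"
    unfolding inner_eq_Re_hermitian by (rule integral_Re[symmetric, OF int])
  finally show ?thesis .
qed

lemma selfadjoint_symmetric:
  fixes M :: "'n::finite \<Rightarrow> complex ^ 'N ^ 'N"
  assumes sa: "selfadjoint_L2 (diffop M)"
    and bounded_bsupp: "bounded_bsupp p" "bounded_bsupp q" "bounded_bsupp p'" "bounded_bsupp q'" and pq: "diffop M p q" "diffop M p' q'"
  shows "(LINT x|lborel. q x \<bullet> p' x) = (LINT x|lborel. p x \<bullet> q' x)"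
proof -
  have "L2_inner q p' = L2_inner p q'"
    using sa pq unfolding selfadjoint_L2_def diffop_def by blast
  then show ?thesis using Re_L2_inner[OF bounded_bsupp(2,3)] Re_L2_inner[OF bounded_bsupp(1,4)] by simp
qed

text \<open>Let \<open>p = \<kappa> \<star> u\<close> and \<open>q = \<kappa> \<star> W\<close>, so that \<open>q\<close> is \<open>D p\<close> slice by slice. Symmetry of \<open>D\<close>
  and invariance of the integral under translation in \<open>t\<close> show that \<open>p(t + s)\<close> and \<open>p(t - s)\<close> have the same inner
  product with \<open>q\<close>. Hence the symmetric difference quotients of \<open>p\<close> in \<open>t\<close> are orthogonal to
  \<open>q\<close>, and so is their limit, twice the \<open>t\<close>-derivative \<open>\<kappa> \<star> U\<close> of \<open>p\<close>.\<close>

lemma mollified_time_derivative_orthogonal: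
  fixes M :: "'n::finite \<Rightarrow> complex ^ 'N ^ 'N" and u W U :: "real \<times> (real ^ 'n) \<Rightarrow> complex ^ 'N"
  assumes sa: "selfadjoint_L2 (diffop M)"
    and \<kappa>: "test_function UNIV \<kappa>" and u: "L2_bsupp u" and W: "L2_bsupp W" and U: "L2_bsupp U"
    and D: "weak_diffop UNIV (\<lambda>j. (0, axis j 1)) M u W" and T: "weak_deriv UNIV (1, 0) u U"
  shows "(LINT z|lborel. convolve \<kappa> U z \<bullet> convolve \<kappa> W z) = 0"
proof -
  define p where "p = convolve \<kappa> u"
  define q where "q = convolve \<kappa> W"
  let ?e = "(1, 0) :: real \<times> (real ^ 'n)"
  have e: "?e \<in> Basis" by (auto simp: Basis_prod_def)
  define \<kappa>' where "\<kappa>' = (\<lambda>z. frechet_derivative \<kappa> (at z) ?e)"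
  have b: "bounded_bsupp \<kappa>" and b': "bounded_bsupp \<kappa>'" and dd: "dir_deriv \<kappa> ?e \<kappa>'"
    unfolding \<kappa>'_def using test_function_bounded_bsupp[OF \<kappa>] test_function_partial_bounded_bsupp[OF \<kappa> e] smooth_dir_deriv[OF test_function_smooth[OF \<kappa>]]
    by auto
  have bp: "bounded_bsupp p" and bq: "bounded_bsupp q" unfolding p_def q_def by (rule convolve_bounded_bsupp[OF b u], rule convolve_bounded_bsupp[OF b W])
  have [measurable]: "p \<in> borel_measurable borel" "q \<in> borel_measurable borel" using bp bq by measurable
  have btr: "bounded_bsupp (\<lambda>z. f (z + h))" if "bounded_bsupp f" for f :: "real \<times> (real ^ 'n) \<Rightarrow> complex ^ 'N" and h
    using bounded_bsupp_shift[OF that, of "- h"] by simp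
  have sym: "(LINT z|lborel. p (z + s *\<^sub>R ?e) \<bullet> q z) = (LINT z|lborel. p (z - s *\<^sub>R ?e) \<bullet> q z)" for s
  proof -
    have "(LINT z|lborel. p (z + s *\<^sub>R ?e) \<bullet> q z) = (LINT t|lborel. (LINT x|lborel. p (t + s, x) \<bullet> q (t, x)))"
      by (subst integral_pair_split) (auto intro!: bounded_bsupp_inner_integrable btr bp bq)
    also have "\<dots> = (LINT t|lborel. (LINT x|lborel. q (t + s, x) \<bullet> p (t, x)))"
    proof -
      have "(LINT x|lborel. p (t + s, x) \<bullet> q (t, x)) = (LINT x|lborel. q (t + s, x) \<bullet> p (t, x))" for t
        by (rule selfadjoint_symmetric[OF sa, symmetric])
           (auto intro!: bounded_bsupp_slice convolve_bounded_bsupp b u W simp: p_def q_def diffop_convolve_slice[OF \<kappa> u W D])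
      then show ?thesis by simp
    qed
    also have "\<dots> = (LINT z|lborel. q (z + s *\<^sub>R ?e) \<bullet> p z)"
      by (subst integral_pair_split) (auto intro!: bounded_bsupp_inner_integrable btr bp bq)
    also have "\<dots> = (LINT z|lborel. p (z - s *\<^sub>R ?e) \<bullet> q z)"
      using lborel_integral_translate[of "\<lambda>z. p (z - s *\<^sub>R ?e) \<bullet> q z" "s *\<^sub>R ?e"] by (simp add: inner_commute)
    finally show ?thesis .
  qed
  obtain L R where L: "L > 0" "R > 0" "\<forall>z. norm (\<kappa>' z) \<le> L" "\<forall>z. norm z > R \<longrightarrow> \<kappa>' z = 0"
    using bounded_bsupp_bounds[OF b'] by (elim exE conjE) (rule that)
  define C where "C = L * (LINT z|lborel. norm (u z))"
  define X where "X k = inverse (real (Suc k))" for k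
  have X: "X \<longlonglongrightarrow> 0" "X k \<noteq> 0" for k
    unfolding X_def using LIMSEQ_inverse_real_of_nat by auto
  define dq where "dq s z = (p (z + s *\<^sub>R ?e) - p z) /\<^sub>R s" for s z
  have dq: "(\<lambda>k. dq (Y k) z) \<longlonglongrightarrow> convolve \<kappa> U z" if "Y \<longlonglongrightarrow> 0" "\<And>k. Y k \<noteq> 0" for Y z
    unfolding dq_def p_def convolve_weak_deriv[OF \<kappa> e u U T]
    using convolve_difference_quotient[OF b b' dd L2_bsupp_integrable[OF u] that] unfolding \<kappa>'_def .
  have dq_le: "norm (dq s z) \<le> C" if "s \<noteq> 0" for s z
  proof -
    have "\<bar>\<kappa>' y\<bar> \<le> L" for y using L(3) by (simp only: real_norm_def)
    then have "norm (p (z + s *\<^sub>R ?e) - p z) \<le> \<bar>s\<bar> * C"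
      unfolding p_def C_def by (rule convolve_lipschitz[OF b dd _ L2_bsupp_integrable[OF u]])
    then have "inverse \<bar>s\<bar> * norm (p (z + s *\<^sub>R ?e) - p z) \<le> inverse \<bar>s\<bar> * (\<bar>s\<bar> * C)"
      by (rule mult_left_mono) simp
    then show ?thesis using that by (simp only: dq_def norm_scaleR abs_inverse) (simp flip: mult.assoc)
  qed
  \<comment> \<open>Forward and backward quotient add up to a symmetric one, which \<open>sym\<close> makes orthogonal to \<open>q\<close>.\<close>
  have "(\<lambda>k. LINT z|lborel. (dq (X k) z + dq (- X k) z) \<bullet> q z) \<longlonglongrightarrow> (LINT z|lborel. (convolve \<kappa> U z + convolve \<kappa> U z) \<bullet> q z)"
  proof (rule integral_dominated_convergence[where w="\<lambda>z. (C + C) * norm (q z)"])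
    show "AE z in lborel. (\<lambda>k. (dq (X k) z + dq (- X k) z) \<bullet> q z) \<longlonglongrightarrow> (convolve \<kappa> U z + convolve \<kappa> U z) \<bullet> q z"
      using X tendsto_minus[OF X(1)] by (intro AE_I2 tendsto_intros dq) auto
    show "AE z in lborel. norm ((dq (X k) z + dq (- X k) z) \<bullet> q z) \<le> (C + C) * norm (q z)" for k
    proof (rule AE_I2)
      fix z
      have "norm ((dq (X k) z + dq (- X k) z) \<bullet> q z) \<le> norm (dq (X k) z + dq (- X k) z) * norm (q z)"
        using Cauchy_Schwarz_ineq2 by simp
      also have "\<dots> \<le> (C + C) * norm (q z)"
        using dq_le[of "X k" z] dq_le[of "- X k" z] X(2)[of k]
        by (intro mult_right_mono norm_triangle_mono) auto
      finally show "norm ((dq (X k) z + dq (- X k) z) \<bullet> q z) \<le> (C + C) * norm (q z)" .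
    qed
    show "(\<lambda>z. (dq (X k) z + dq (- X k) z) \<bullet> q z) \<in> borel_measurable lborel" for k
      unfolding dq_def by measurable
    show "integrable lborel (\<lambda>z. (C + C) * norm (q z))"
      using bounded_bsupp_integrable[OF bq] by simp
    have "convolve \<kappa> U \<in> borel_measurable borel" using convolve_bounded_bsupp[OF b U] by measurable
    then show "(\<lambda>z. (convolve \<kappa> U z + convolve \<kappa> U z) \<bullet> q z) \<in> borel_measurable lborel" by measurable
  qed
  moreover have "(LINT z|lborel. (dq (X k) z + dq (- X k) z) \<bullet> q z) = 0" for k
  proof -
    have "(LINT z|lborel. (dq (X k) z + dq (- X k) z) \<bullet> q z)
        = (LINT z|lborel. inverse (X k) * (p (z + X k *\<^sub>R ?e) \<bullet> q z - p (z - X k *\<^sub>R ?e) \<bullet> q z))"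
      by (rule Bochner_Integration.integral_cong) (auto simp: dq_def inner_add_left inner_diff_left algebra_simps)
    also have "\<dots> = inverse (X k) * ((LINT z|lborel. p (z + X k *\<^sub>R ?e) \<bullet> q z) - (LINT z|lborel. p (z - X k *\<^sub>R ?e) \<bullet> q z))"
      using bounded_bsupp_inner_integrable[OF btr[OF bp] bq, of "X k *\<^sub>R ?e"]
        bounded_bsupp_inner_integrable[OF bounded_bsupp_shift[OF bp] bq, of "X k *\<^sub>R ?e"]
      by (simp only: integral_mult_right_zero Bochner_Integration.integral_diff)
    finally show ?thesis using sym by simp
  qed
  ultimately have "(\<lambda>k::nat. 0) \<longlonglongrightarrow> (LINT z|lborel. (convolve \<kappa> U z + convolve \<kappa> U z) \<bullet> q z)" by (simp only:)
  then have "(LINT z|lborel. (convolve \<kappa> U z + convolve \<kappa> U z) \<bullet> q z) = 0"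
    using LIMSEQ_unique tendsto_const by blast
  then have "(LINT z|lborel. convolve \<kappa> U z \<bullet> q z) + (LINT z|lborel. convolve \<kappa> U z \<bullet> q z) = 0"
    using bounded_bsupp_inner_integrable[OF convolve_bounded_bsupp[OF b U] bq]
    by (simp only: inner_add_left Bochner_Integration.integral_add)
  then show ?thesis by (simp add: q_def)
qed

text \<open>Accretivity holds on the range of \<open>D\<close> in \<open>L\<^sub>2\<close> of the \<open>x\<close> variable. It is applied to each slice
  of \<open>\<kappa> \<star> W\<close>, and the result is integrated in \<open>t\<close>.\<close>

lemma mollified_accretive:
  fixes M :: "'n::finite \<Rightarrow> complex ^ 'N ^ 'N" and u W :: "real \<times> (real ^ 'n) \<Rightarrow> complex ^ 'N"
  assumes acc: "\<And>f. f \<in> op_ran (diffop M) \<Longrightarrow> bounded_bsupp f \<Longrightarrow> c * L2_norm_sq f \<le> (LINT x|lborel. (B x *v f x) \<bullet> f x)"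
    and B [measurable]: "B \<in> borel_measurable borel" and K: "\<And>x a. norm (B x *v a) \<le> K * norm a"
    and \<kappa>: "test_function UNIV \<kappa>" and u: "L2_bsupp u" and W: "L2_bsupp W"
    and D: "weak_diffop UNIV (\<lambda>j. (0, axis j 1)) M u W"
  shows "c * L2_norm_sq (convolve \<kappa> W) \<le> (LINT z|lborel. (B (snd z) *v convolve \<kappa> W z) \<bullet> convolve \<kappa> W z)"
proof -
  define q where "q = convolve \<kappa> W"
  have q: "bounded_bsupp q" unfolding q_def by (rule convolve_bounded_bsupp[OF test_function_bounded_bsupp[OF \<kappa>] W])
  have [measurable]: "q \<in> borel_measurable borel" using q by measurable
  have "bounded_bsupp (\<lambda>z. B (snd z) *v q z)"
    by (rule bounded_bsupp_bound[OF q, where K=K]) (use K in auto)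
  then have i1: "integrable lborel (\<lambda>z. (B (snd z) *v q z) \<bullet> q z)" using q by (rule bounded_bsupp_inner_integrable)
  have i2: "integrable lborel (\<lambda>z. (norm (q z))\<^sup>2)" by (rule L2_bsupp_square_integrable[OF bounded_bsupp_L2_bsupp[OF q]])
  have "c * L2_norm_sq q = (LINT t|lborel. c * (LINT x|lborel. (norm (q (t, x)))\<^sup>2))"
    unfolding L2_norm_sq_def integral_pair_split[OF i2] by simp
  also have "\<dots> \<le> (LINT t|lborel. (LINT x|lborel. (B (snd (t, x)) *v q (t, x)) \<bullet> q (t, x)))"
  proof (rule integral_mono)
    show "integrable lborel (\<lambda>t. c * (LINT x|lborel. (norm (q (t, x)))\<^sup>2))"
      using integrable_pair_split[OF i2] by simp
    show "integrable lborel (\<lambda>t. LINT x|lborel. (B (snd (t, x)) *v q (t, x)) \<bullet> q (t, x))"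
      by (rule integrable_pair_split[OF i1])
    fix t
    have "(\<lambda>x. q (t, x)) \<in> op_ran (diffop M)"
      using diffop_convolve_slice[OF \<kappa> u W D] unfolding op_ran_def q_def by blast
    from acc[OF this bounded_bsupp_slice[OF q]]
    show "c * (LINT x|lborel. (norm (q (t, x)))\<^sup>2) \<le> (LINT x|lborel. (B (snd (t, x)) *v q (t, x)) \<bullet> q (t, x))"
      by (simp add: L2_norm_sq_def)
  qed
  also have "\<dots> = (LINT z|lborel. (B (snd z) *v q z) \<bullet> q z)"
    by (rule integral_pair_split[OF i1, symmetric])
  finally show ?thesis by (simp add: q_def)
qed

text \<open>Both relations hold for the mollified functions and are continuous in \<open>L\<^sub>2\<close>. A nonzero
  test function is assumed because mollifiers are built from it.\<close>

lemma energy_relations: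
  fixes M :: "'n::finite \<Rightarrow> complex ^ 'N ^ 'N" and u W U :: "real \<times> (real ^ 'n) \<Rightarrow> complex ^ 'N"
    and \<alpha> :: "real \<times> (real ^ 'n) \<Rightarrow> real"
  assumes sa: "selfadjoint_L2 (diffop M)"
    and acc: "\<And>f. f \<in> op_ran (diffop M) \<Longrightarrow> bounded_bsupp f \<Longrightarrow> c * L2_norm_sq f \<le> (LINT x|lborel. (B x *v f x) \<bullet> f x)"
    and B [measurable]: "B \<in> borel_measurable borel" and K: "\<And>x a. norm (B x *v a) \<le> K * norm a"
    and \<alpha>: "test_function UNIV \<alpha>" "\<alpha> z0 \<noteq> 0"
    and u: "L2_bsupp u" and W: "L2_bsupp W" and U: "L2_bsupp U"
    and D: "weak_diffop UNIV (\<lambda>j. (0, axis j 1)) M u W" and T: "weak_deriv UNIV (1, 0) u U"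
  shows "(LINT z|lborel. U z \<bullet> W z) = 0"
    and "c * L2_norm_sq W \<le> (LINT z|lborel. (B (snd z) *v W z) \<bullet> W z)"
proof -
  have "\<forall>k. \<exists>\<kappa> :: real \<times> (real ^ 'n) \<Rightarrow> real. mollifier (1 / real (Suc k)) \<kappa>"
    using mollifier_exists[OF \<alpha>] by simp
  then obtain \<kappa> :: "nat \<Rightarrow> real \<times> (real ^ 'n) \<Rightarrow> real" where \<kappa>: "\<And>k. mollifier (1 / real (Suc k)) (\<kappa> k)"
    by metis
  have tf: "test_function UNIV (\<kappa> k)" for k using \<kappa>[of k] by (simp add: mollifier_def)
  have c: "L2_bsupp (convolve (\<kappa> k) f)" if "L2_bsupp f" for k and f :: "real \<times> (real ^ 'n) \<Rightarrow> complex ^ 'N"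
    by (rule bounded_bsupp_L2_bsupp[OF convolve_bounded_bsupp[OF test_function_bounded_bsupp[OF tf] that]])
  have "(\<lambda>k. LINT z|lborel. convolve (\<kappa> k) U z \<bullet> convolve (\<kappa> k) W z) \<longlonglongrightarrow> (LINT z|lborel. U z \<bullet> W z)"
    by (intro L2_bsupp_inner_tendsto mollification_tendsto \<kappa> c U W)
  then show "(LINT z|lborel. U z \<bullet> W z) = 0"
    unfolding mollified_time_derivative_orthogonal[OF sa tf u W U D T]
    using LIMSEQ_unique tendsto_const by blast

  have BL: "L2_bsupp (\<lambda>z. B (snd z) *v f z)" if "L2_bsupp f" for f :: "real \<times> (real ^ 'n) \<Rightarrow> complex ^ 'N"
    by (rule L2_bsupp_coefficient[OF B K that])
  note Wk = mollification_tendsto[OF \<kappa> W]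
  have BW: "(\<lambda>k. L2_norm_sq (\<lambda>z. B (snd z) *v convolve (\<kappa> k) W z - B (snd z) *v W z)) \<longlonglongrightarrow> 0"
  proof (rule tendsto_sandwich[OF _ _ tendsto_const])
    show "(\<lambda>k. K\<^sup>2 * L2_norm_sq (\<lambda>z. convolve (\<kappa> k) W z - W z)) \<longlonglongrightarrow> 0"
      using tendsto_mult_right_zero[OF Wk] .
    show "\<forall>\<^sub>F k in sequentially. L2_norm_sq (\<lambda>z. B (snd z) *v convolve (\<kappa> k) W z - B (snd z) *v W z)
        \<le> K\<^sup>2 * L2_norm_sq (\<lambda>z. convolve (\<kappa> k) W z - W z)"
      by (intro always_eventually allI L2_norm_sq_mono L2_bsupp_diff c W)
         (simp add: K flip: bounded_bilinear.diff_right[OF bounded_bilinear_matrix_vector])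
  qed simp
  have lim1: "(\<lambda>k. LINT z|lborel. (B (snd z) *v convolve (\<kappa> k) W z) \<bullet> convolve (\<kappa> k) W z)
      \<longlonglongrightarrow> (LINT z|lborel. (B (snd z) *v W z) \<bullet> W z)"
    by (intro L2_bsupp_inner_tendsto BW Wk BL c W)
  have "(\<lambda>k. LINT z|lborel. convolve (\<kappa> k) W z \<bullet> convolve (\<kappa> k) W z) \<longlonglongrightarrow> (LINT z|lborel. W z \<bullet> W z)"
    by (intro L2_bsupp_inner_tendsto Wk c W)
  then have lim2: "(\<lambda>k. c * L2_norm_sq (convolve (\<kappa> k) W)) \<longlonglongrightarrow> c * L2_norm_sq W"
    unfolding L2_norm_sq_def power2_norm_eq_inner by (rule tendsto_mult_left)
  show "c * L2_norm_sq W \<le> (LINT z|lborel. (B (snd z) *v W z) \<bullet> W z)"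
    by (rule LIMSEQ_le[OF lim2 lim1])
       (intro exI[of _ 0] allI impI mollified_accretive[OF acc B K tf u W D])
qed

section \<open>The estimate for a real cutoff\<close>

text \<open>If \<open>\<phi>\<close> is any test function then \<open>\<phi> \<alpha>\<close> is one supported in \<open>S\<close>, and the product rule
  distributes its derivatives. In the application \<open>S\<close> is the compact support of
  the cutoff.\<close>

lemma weak_diffop_localize:
  fixes e :: "'n::finite \<Rightarrow> 'a::euclidean_space" and v w :: "'a \<Rightarrow> complex ^ 'N"
  assumes \<alpha>: "test_function S \<alpha>" and e: "\<And>j. e j \<in> Basis" and v: "L2_bsupp v" and w: "L2_bsupp w"
    and weak: "weak_diffop S e M v w"
  shows "weak_diffop UNIV e M (\<lambda>z. \<alpha> z *\<^sub>R v z)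
    (\<lambda>z. \<alpha> z *\<^sub>R w z + (\<Sum>j\<in>UNIV. frechet_derivative \<alpha> (at z) (e j) *\<^sub>R (M j *v v z)))"
  unfolding weak_diffop_def
proof (intro allI impI)
  fix \<phi> :: "'a \<Rightarrow> real" assume \<phi>: "test_function UNIV \<phi>"
  define \<alpha>' where "\<alpha>' j z = frechet_derivative \<alpha> (at z) (e j)" for j z
  define \<phi>' where "\<phi>' j z = frechet_derivative \<phi> (at z) (e j)" for j z
  have bb: "bounded_bsupp \<alpha>" "bounded_bsupp (\<alpha>' j)" "bounded_bsupp \<phi>" "bounded_bsupp (\<phi>' j)" for j
    unfolding \<alpha>'_def \<phi>'_def
    by (intro test_function_bounded_bsupp[OF \<alpha>] test_function_partial_bounded_bsupp[OF \<alpha> e]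
        test_function_bounded_bsupp[OF \<phi>] test_function_partial_bounded_bsupp[OF \<phi> e])+
  have [measurable]: "v \<in> borel_measurable borel" "w \<in> borel_measurable borel"
    "\<alpha> \<in> borel_measurable borel" "\<phi> \<in> borel_measurable borel"
    "\<And>j. \<alpha>' j \<in> borel_measurable borel" "\<And>j. \<phi>' j \<in> borel_measurable borel"
    using v w bb by (auto simp: L2_bsupp_def bounded_bsupp_def)
  let ?A = "\<lambda>z. \<Sum>j\<in>UNIV. (\<phi> z * \<alpha>' j z) *\<^sub>R (M j *v v z)"
  let ?P = "\<lambda>z. \<Sum>j\<in>UNIV. (\<phi>' j z * \<alpha> z) *\<^sub>R (M j *v v z)"
  have iA: "integrable lborel ?A" and iP: "integrable lborel ?P"
    by (intro L2_bsupp_integrable L2_bsupp_sum L2_bsupp_scaleR bounded_bsupp_mult bb L2_bsupp_matrix_vector v finite)+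
  have iw: "integrable lborel (\<lambda>z. (\<phi> z * \<alpha> z) *\<^sub>R w z)"
    by (intro L2_bsupp_integrable L2_bsupp_scaleR bounded_bsupp_mult bb w)
  have "(LINT z|lebesgue. (\<phi> z * \<alpha> z) *\<^sub>R w z) = - (LINT z|lebesgue. ?A z + ?P z)"
    using weak[unfolded weak_diffop_def, rule_format, OF test_function_mult(1)[OF \<phi> \<alpha>]]
    by (simp add: test_function_mult(2)[OF \<phi> \<alpha>] \<alpha>'_def \<phi>'_def sum.distrib scaleR_add_left)
  moreover have "(LINT z|lebesgue. (\<phi> z * \<alpha> z) *\<^sub>R w z) = (LINT z|lborel. (\<phi> z * \<alpha> z) *\<^sub>R w z)"
    by (rule lebesgue_integral_borel) measurable
  moreover have "(LINT z|lebesgue. ?A z + ?P z) = (LINT z|lborel. ?A z + ?P z)"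
    by (rule lebesgue_integral_borel) measurable
  ultimately have main: "(LINT z|lborel. (\<phi> z * \<alpha> z) *\<^sub>R w z) = - (LINT z|lborel. ?A z) - (LINT z|lborel. ?P z)"
    unfolding Bochner_Integration.integral_add[OF iA iP] by (simp only: minus_add_distrib diff_conv_add_uminus)
  have "(LINT z|lebesgue. \<phi> z *\<^sub>R (\<alpha> z *\<^sub>R w z + (\<Sum>j\<in>UNIV. \<alpha>' j z *\<^sub>R (M j *v v z))))
      = (LINT z|lborel. \<phi> z *\<^sub>R (\<alpha> z *\<^sub>R w z + (\<Sum>j\<in>UNIV. \<alpha>' j z *\<^sub>R (M j *v v z))))"
    by (rule lebesgue_integral_borel) measurable
  also have "\<dots> = (LINT z|lborel. (\<phi> z * \<alpha> z) *\<^sub>R w z + ?A z)"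
    by (simp add: scaleR_add_right scaleR_sum_right)
  also have "\<dots> = - (LINT z|lborel. ?P z)"
    unfolding Bochner_Integration.integral_add[OF iw iA] main by simp
  also have "\<dots> = - (LINT z|lborel. (\<Sum>j\<in>UNIV. \<phi>' j z *\<^sub>R (M j *v (\<alpha> z *\<^sub>R v z))))"
    by (simp add: bounded_bilinear.scaleR_right[OF bounded_bilinear_matrix_vector])
  also have "\<dots> = - (LINT z|lebesgue. (\<Sum>j\<in>UNIV. \<phi>' j z *\<^sub>R (M j *v (\<alpha> z *\<^sub>R v z))))"
    by (subst lebesgue_integral_borel) measurable
  finally show "(LINT z|lebesgue. \<phi> z *\<^sub>R (\<alpha> z *\<^sub>R w z + (\<Sum>j\<in>UNIV. frechet_derivative \<alpha> (at z) (e j) *\<^sub>R (M j *v v z))))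
      = - (LINT z|lebesgue. (\<Sum>j\<in>UNIV. frechet_derivative \<phi> (at z) (e j) *\<^sub>R (M j *v (\<alpha> z *\<^sub>R v z))))"
    by (simp add: \<alpha>'_def \<phi>'_def)
qed

lemma weak_deriv_localize:
  fixes e :: "'a::euclidean_space" and v g :: "'a \<Rightarrow> 'b::euclidean_space"
  assumes \<alpha>: "test_function S \<alpha>" and e: "e \<in> Basis" and v: "L2_bsupp v" and g: "L2_bsupp g"
    and weak: "weak_deriv S e v g"
  shows "weak_deriv UNIV e (\<lambda>z. \<alpha> z *\<^sub>R v z) (\<lambda>z. \<alpha> z *\<^sub>R g z + frechet_derivative \<alpha> (at z) e *\<^sub>R v z)"
  unfolding weak_deriv_def
proof (intro allI impI)
  fix \<phi> :: "'a \<Rightarrow> real" assume \<phi>: "test_function UNIV \<phi>"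
  define \<alpha>' where "\<alpha>' z = frechet_derivative \<alpha> (at z) e" for z
  define \<phi>' where "\<phi>' z = frechet_derivative \<phi> (at z) e" for z
  have bb: "bounded_bsupp \<alpha>" "bounded_bsupp \<alpha>'" "bounded_bsupp \<phi>" "bounded_bsupp \<phi>'"
    unfolding \<alpha>'_def[abs_def] \<phi>'_def[abs_def]
    by (intro test_function_bounded_bsupp[OF \<alpha>] test_function_partial_bounded_bsupp[OF \<alpha> e]
        test_function_bounded_bsupp[OF \<phi>] test_function_partial_bounded_bsupp[OF \<phi> e])+
  have [measurable]: "v \<in> borel_measurable borel" "g \<in> borel_measurable borel"
    "\<alpha> \<in> borel_measurable borel" "\<phi> \<in> borel_measurable borel"
    "\<alpha>' \<in> borel_measurable borel" "\<phi>' \<in> borel_measurable borel"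
    using v g bb by (auto simp: L2_bsupp_def bounded_bsupp_def)
  let ?A = "\<lambda>z. (\<phi> z * \<alpha>' z) *\<^sub>R v z"
  let ?P = "\<lambda>z. (\<phi>' z * \<alpha> z) *\<^sub>R v z"
  have iA: "integrable lborel ?A" and iP: "integrable lborel ?P"
    and iw: "integrable lborel (\<lambda>z. (\<phi> z * \<alpha> z) *\<^sub>R g z)"
    by (intro L2_bsupp_integrable L2_bsupp_scaleR bounded_bsupp_mult bb v g)+
  have "(LINT z|lebesgue. (\<phi> z * \<alpha> z) *\<^sub>R g z) = - (LINT z|lebesgue. ?A z + ?P z)"
    using weak[unfolded weak_deriv_def, rule_format, OF test_function_mult(1)[OF \<phi> \<alpha>]]
    by (simp add: test_function_mult(2)[OF \<phi> \<alpha>] \<alpha>'_def \<phi>'_def scaleR_add_left)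
  moreover have "(LINT z|lebesgue. (\<phi> z * \<alpha> z) *\<^sub>R g z) = (LINT z|lborel. (\<phi> z * \<alpha> z) *\<^sub>R g z)"
    by (rule lebesgue_integral_borel) measurable
  moreover have "(LINT z|lebesgue. ?A z + ?P z) = (LINT z|lborel. ?A z + ?P z)"
    by (rule lebesgue_integral_borel) measurable
  ultimately have main: "(LINT z|lborel. (\<phi> z * \<alpha> z) *\<^sub>R g z) = - (LINT z|lborel. ?A z) - (LINT z|lborel. ?P z)"
    unfolding Bochner_Integration.integral_add[OF iA iP] by (simp only: minus_add_distrib diff_conv_add_uminus)
  have "(LINT z|lebesgue. \<phi> z *\<^sub>R (\<alpha> z *\<^sub>R g z + \<alpha>' z *\<^sub>R v z))
      = (LINT z|lborel. (\<phi> z * \<alpha> z) *\<^sub>R g z + ?A z)"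
    by (subst lebesgue_integral_borel) (measurable, simp add: scaleR_add_right)
  also have "\<dots> = - (LINT z|lborel. ?P z)"
    unfolding Bochner_Integration.integral_add[OF iw iA] main by simp
  also have "(LINT z|lborel. ?P z) = (LINT z|lborel. \<phi>' z *\<^sub>R (\<alpha> z *\<^sub>R v z))" by simp
  also have "\<dots> = (LINT z|lebesgue. \<phi>' z *\<^sub>R (\<alpha> z *\<^sub>R v z))"
    by (rule lebesgue_integral_borel[symmetric]) measurable
  finally show "(LINT z|lebesgue. \<phi> z *\<^sub>R (\<alpha> z *\<^sub>R g z + frechet_derivative \<alpha> (at z) e *\<^sub>R v z))
      = - (LINT z|lebesgue. frechet_derivative \<phi> (at z) e *\<^sub>R (\<alpha> z *\<^sub>R v z))"
    by (simp add: \<alpha>'_def \<phi>'_def)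
qed

lemma partial_le_grad_norm: "e \<in> Basis \<Longrightarrow> norm (frechet_derivative f (at z) e) \<le> grad_norm f z"
  unfolding grad_norm_def by (rule real_le_rsqrt) (rule member_le_sum, auto)

lemma grad_norm_nonneg [simp]: "grad_norm f z \<ge> 0"
  by (simp add: grad_norm_def sum_nonneg)

lemma grad_norm_bounded_bsupp:
  fixes \<alpha> :: "'a::euclidean_space \<Rightarrow> real"
  assumes \<alpha>: "test_function S \<alpha>"
  shows "bounded_bsupp (grad_norm \<alpha>)"
proof -
  have b: "bounded_bsupp (\<lambda>z. \<bar>frechet_derivative \<alpha> (at z) e\<bar>)" if e: "e \<in> Basis" for e
  proof -
    note p = test_function_partial_bounded_bsupp[OF \<alpha> e]
    have [measurable]: "(\<lambda>z. frechet_derivative \<alpha> (at z) e) \<in> borel_measurable borel" using p by measurable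
    show ?thesis by (rule bounded_bsupp_bound[OF p, where K=1]) auto
  qed
  have norm_measurable: "(norm :: real \<Rightarrow> real) \<in> borel_measurable borel" by measurable
  have m: "(\<lambda>z. frechet_derivative \<alpha> (at z) e) \<in> borel_measurable borel" if "e \<in> Basis" for e
    using test_function_partial_bounded_bsupp[OF \<alpha> that] by (simp add: bounded_bsupp_def)
  show ?thesis
  proof (rule bounded_bsupp_bound[where K=1])
    show "bounded_bsupp (\<lambda>z. \<Sum>e\<in>Basis. \<bar>frechet_derivative \<alpha> (at z) e\<bar>)" by (intro bounded_bsupp_sum b) auto
    have [measurable]: "(\<lambda>z. \<Sum>e\<in>Basis. (norm (frechet_derivative \<alpha> (at z) e))\<^sup>2) \<in> borel_measurable borel"
      by (intro borel_measurable_sum borel_measurable_power measurable_compose[OF m norm_measurable])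
    show "grad_norm \<alpha> \<in> borel_measurable borel"
      unfolding grad_norm_def[abs_def] by measurable
    show "norm (grad_norm \<alpha> z) \<le> 1 * norm (\<Sum>e\<in>Basis. \<bar>frechet_derivative \<alpha> (at z) e\<bar>)" for z
      using L2_set_le_sum[of Basis "\<lambda>e. \<bar>frechet_derivative \<alpha> (at z) e\<bar>"]
      by (simp add: grad_norm_def L2_set_def sum_nonneg)
  qed
qed

lemma basis_time: "(1, 0) \<in> (Basis :: (real \<times> (real ^ 'n)) set)"
  and basis_space: "(0, axis j 1) \<in> (Basis :: (real \<times> (real ^ 'n)) set)"
  by (auto simp: Basis_prod_def)

text \<open>The letters are those of the introduction, with \<open>w\<close> in the role of \<open>D v\<close>. Since \<open>B W = g - U\<close> with \<open>U\<close> orthogonal to \<open>W\<close>,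
  accretivity bounds \<open>W\<close> by \<open>g\<close>; the gradient enters through
  \<open>\<bar>h\<bar> \<le> m \<bar>\<nabla>\<alpha>\<bar> \<bar>v\<bar>\<close> and \<open>\<bar>g\<bar> \<le> (1 + K m) \<bar>\<nabla>\<alpha>\<bar> \<bar>v\<bar>\<close>.\<close>

lemma Caccioppoli_real_cutoff:
  fixes M :: "'n::finite \<Rightarrow> complex ^ 'N ^ 'N" and v w :: "real \<times> (real ^ 'n) \<Rightarrow> complex ^ 'N"
    and \<alpha> :: "real \<times> (real ^ 'n) \<Rightarrow> real"
  assumes sa: "selfadjoint_L2 (diffop M)"
    and c: "c > 0" and acc: "\<And>f. f \<in> op_ran (diffop M) \<Longrightarrow> bounded_bsupp f \<Longrightarrow> c * L2_norm_sq f \<le> (LINT x|lborel. (B x *v f x) \<bullet> f x)"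
    and B [measurable]: "B \<in> borel_measurable borel" and K: "K \<ge> 0" "\<And>x a. norm (B x *v a) \<le> K * norm a"
    and \<alpha>: "test_function S \<alpha>" and v: "L2_bsupp v" and w: "L2_bsupp w"
    and D: "weak_diffop S (\<lambda>j. (0, axis j 1)) M v w"
    and T: "weak_deriv S (1, 0) v (\<lambda>z. - (B (snd z) *v w z))"
  defines "m \<equiv> (\<Sum>j\<in>UNIV. onorm ((*v) (M j)))"
  shows "L2_norm_sq (\<lambda>z. \<alpha> z *\<^sub>R w z)
    \<le> (2 * (1 + K * m)\<^sup>2 / c\<^sup>2 + 2 * m\<^sup>2) * L2_norm_sq (\<lambda>z. grad_norm \<alpha> z *\<^sub>R v z)"
proof (cases "\<exists>z0. \<alpha> z0 \<noteq> 0")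
  case False
  \<comment> \<open>The zero cutoff yields no mollifier, but then the estimate is trivial.\<close>
  then have "(\<lambda>z. \<alpha> z *\<^sub>R w z) = (\<lambda>z. 0)" by (metis scaleR_zero_left)
  then have "L2_norm_sq (\<lambda>z. \<alpha> z *\<^sub>R w z) = 0" by (simp add: L2_norm_sq_def)
  also have "0 \<le> (2 * (1 + K * m)\<^sup>2 / c\<^sup>2 + 2 * m\<^sup>2) * L2_norm_sq (\<lambda>z. grad_norm \<alpha> z *\<^sub>R v z)"
    by (intro mult_nonneg_nonneg add_nonneg_nonneg) auto
  finally show ?thesis .
next
  case True
  then obtain z0 where z0: "\<alpha> z0 \<noteq> 0" by blast
  have \<alpha>U: "test_function UNIV \<alpha>" using \<alpha> by (simp add: test_function_def)
  define \<alpha>' where "\<alpha>' j z = frechet_derivative \<alpha> (at z) (0, axis j 1)" for j :: 'n and z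
  define \<alpha>t where "\<alpha>t z = frechet_derivative \<alpha> (at z) (1, 0)" for z
  define G where "G z = grad_norm \<alpha> z *\<^sub>R v z" for z
  define h where "h z = (\<Sum>j\<in>UNIV. \<alpha>' j z *\<^sub>R (M j *v v z))" for z
  define g where "g z = \<alpha>t z *\<^sub>R v z + B (snd z) *v h z" for z
  define u where "u z = \<alpha> z *\<^sub>R v z" for z
  define W where "W z = \<alpha> z *\<^sub>R w z + h z" for z
  define U where "U z = \<alpha> z *\<^sub>R (- (B (snd z) *v w z)) + \<alpha>t z *\<^sub>R v z" for z
  have b: "bounded_bsupp \<alpha>" "bounded_bsupp (\<alpha>' j)" "bounded_bsupp \<alpha>t" "bounded_bsupp (grad_norm \<alpha>)" for j
    unfolding \<alpha>'_def[abs_def] \<alpha>t_def[abs_def]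
    by (intro test_function_bounded_bsupp[OF \<alpha>] test_function_partial_bounded_bsupp[OF \<alpha>] basis_time basis_space grad_norm_bounded_bsupp[OF \<alpha>])+
  have BL: "L2_bsupp (\<lambda>z. B (snd z) *v f z)" if "L2_bsupp f" for f :: "real \<times> (real ^ 'n) \<Rightarrow> complex ^ 'N"
    by (rule L2_bsupp_coefficient[OF B K(2) that])
  have L: "L2_bsupp u" "L2_bsupp h" "L2_bsupp W" "L2_bsupp U" "L2_bsupp g" "L2_bsupp G" "L2_bsupp (\<lambda>z. \<alpha> z *\<^sub>R w z)"
  proof -
    show h: "L2_bsupp h" unfolding h_def[abs_def] by (intro L2_bsupp_sum L2_bsupp_scaleR b L2_bsupp_matrix_vector v finite)
    show "L2_bsupp u" "L2_bsupp W" "L2_bsupp U" "L2_bsupp g" "L2_bsupp G" "L2_bsupp (\<lambda>z. \<alpha> z *\<^sub>R w z)"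
      unfolding u_def[abs_def] W_def[abs_def] U_def[abs_def] g_def[abs_def] G_def[abs_def]
      by (intro L2_bsupp_add L2_bsupp_scaleR L2_bsupp_uminus BL b v w h)+
  qed
  have Du: "weak_diffop UNIV (\<lambda>j. (0, axis j 1)) M u W"
    unfolding u_def[abs_def] W_def[abs_def] h_def \<alpha>'_def
    by (rule weak_diffop_localize[OF \<alpha> basis_space v w D])
  have Tu: "weak_deriv UNIV (1, 0) u U"
    unfolding u_def[abs_def] U_def[abs_def] \<alpha>t_def
    by (rule weak_deriv_localize[OF \<alpha> basis_time v L2_bsupp_uminus[OF BL[OF w]] T])
  note rel = energy_relations[OF sa acc B K(2) \<alpha>U z0 L(1,3,4) Du Tu]
  \<comment> \<open>The equation enters here: the multiples of \<open>B w\<close> in \<open>B W\<close> and in \<open>U\<close> cancel.\<close>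
  have BW: "B (snd z) *v W z = g z - U z" for z
    by (simp add: W_def g_def U_def bounded_bilinear.add_right[OF bounded_bilinear_matrix_vector]
        bounded_bilinear.scaleR_right[OF bounded_bilinear_matrix_vector])
  have "c * L2_norm_sq W \<le> (LINT z|lborel. g z \<bullet> W z)"
    using rel unfolding BW inner_diff_left
      Bochner_Integration.integral_diff[OF L2_bsupp_inner_integrable[OF L(5,3)] L2_bsupp_inner_integrable[OF L(4,3)]]
    by simp
  also have "\<dots> \<le> sqrt (L2_norm_sq g) * sqrt (L2_norm_sq W)"
    using L2_bsupp_Cauchy_Schwarz[OF L(5,3)] by linarith
  finally have cs: "c * L2_norm_sq W \<le> sqrt (L2_norm_sq g) * sqrt (L2_norm_sq W)" .
  have W_le: "L2_norm_sq W \<le> L2_norm_sq g / c\<^sup>2"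
  proof (cases "L2_norm_sq W = 0")
    case False
    then have pos: "sqrt (L2_norm_sq W) > 0" using L2_norm_sq_nonneg[of W] by (simp add: less_le)
    have "(c * sqrt (L2_norm_sq W)) * sqrt (L2_norm_sq W) \<le> sqrt (L2_norm_sq g) * sqrt (L2_norm_sq W)"
      using cs by (simp add: mult.assoc)
    then have "c * sqrt (L2_norm_sq W) \<le> sqrt (L2_norm_sq g)" using pos by simp
    then have "(c * sqrt (L2_norm_sq W))\<^sup>2 \<le> (sqrt (L2_norm_sq g))\<^sup>2" using c pos by (intro power_mono) auto
    then show ?thesis using c by (simp add: power_mult_distrib pos_le_divide_eq mult.commute)
  qed simp
  have m0: "m \<ge> 0" unfolding m_def by (intro sum_nonneg onorm_pos_le) simp
  have h_le: "norm (h z) \<le> m * norm (G z)" for z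
  proof -
    have "norm (h z) \<le> (\<Sum>j\<in>UNIV. norm (\<alpha>' j z *\<^sub>R (M j *v v z)))" unfolding h_def by (rule norm_sum)
    also have "\<dots> \<le> (\<Sum>j\<in>UNIV. onorm ((*v) (M j)) * norm (G z))"
    proof (rule sum_mono)
      fix j
      have "\<bar>\<alpha>' j z\<bar> \<le> grad_norm \<alpha> z"
        unfolding \<alpha>'_def using partial_le_grad_norm[OF basis_space, of \<alpha> z j] by simp
      moreover have "norm (M j *v v z) \<le> onorm ((*v) (M j)) * norm (v z)" by (rule onorm) simp
      ultimately have "\<bar>\<alpha>' j z\<bar> * norm (M j *v v z) \<le> grad_norm \<alpha> z * (onorm ((*v) (M j)) * norm (v z))"
        by (intro mult_mono) auto
      then show "norm (\<alpha>' j z *\<^sub>R (M j *v v z)) \<le> onorm ((*v) (M j)) * norm (G z)"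
        by (simp add: G_def mult_ac)
    qed
    finally show ?thesis by (simp add: m_def sum_distrib_right)
  qed
  have g_le: "norm (g z) \<le> (1 + K * m) * norm (G z)" for z
  proof -
    have "\<bar>\<alpha>t z\<bar> \<le> grad_norm \<alpha> z"
      unfolding \<alpha>t_def using partial_le_grad_norm[OF basis_time, of \<alpha> z] by simp
    then have "norm (\<alpha>t z *\<^sub>R v z) \<le> norm (G z)" by (simp add: G_def mult_right_mono)
    moreover have "norm (B (snd z) *v h z) \<le> K * (m * norm (G z))"
      using order_trans[OF K(2) mult_left_mono[OF h_le K(1)]] .
    ultimately show ?thesis
      unfolding g_def using norm_triangle_ineq[of "\<alpha>t z *\<^sub>R v z" "B (snd z) *v h z"] by (simp add: algebra_simps)
  qed
  \<comment> \<open>Insert the pointwise bounds and use \<open>\<alpha> w = W - h\<close>.\<close>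
  have gG: "L2_norm_sq g \<le> (1 + K * m)\<^sup>2 * L2_norm_sq G" and hG: "L2_norm_sq h \<le> m\<^sup>2 * L2_norm_sq G"
    by (rule L2_norm_sq_mono[OF L(6) g_le], rule L2_norm_sq_mono[OF L(6) h_le])
  have "L2_norm_sq (\<lambda>z. \<alpha> z *\<^sub>R w z) \<le> (LINT z|lborel. 2 * (norm (W z))\<^sup>2 + 2 * (norm (h z))\<^sup>2)"
    unfolding L2_norm_sq_def
  proof (rule integral_mono')
    show "integrable lborel (\<lambda>z. 2 * (norm (W z))\<^sup>2 + 2 * (norm (h z))\<^sup>2)"
      by (intro Bochner_Integration.integrable_add integrable_mult_right L2_bsupp_square_integrable L)
    fix z
    have "(norm (\<alpha> z *\<^sub>R w z))\<^sup>2 \<le> (norm (W z) + norm (h z))\<^sup>2"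
      using norm_triangle_ineq4[of "W z" "h z"] by (intro power_mono) (simp_all add: W_def)
    also have "\<dots> \<le> 2 * (norm (W z))\<^sup>2 + 2 * (norm (h z))\<^sup>2"
      using sum_squares_bound[of "norm (W z)" "norm (h z)"] unfolding power2_sum by linarith
    finally show "(norm (\<alpha> z *\<^sub>R w z))\<^sup>2 \<le> 2 * (norm (W z))\<^sup>2 + 2 * (norm (h z))\<^sup>2" .
  qed simp
  also have "\<dots> = 2 * L2_norm_sq W + 2 * L2_norm_sq h"
    using L2_bsupp_square_integrable[OF L(3)] L2_bsupp_square_integrable[OF L(2)] by (simp add: L2_norm_sq_def)
  also have "\<dots> \<le> 2 * ((1 + K * m)\<^sup>2 * L2_norm_sq G / c\<^sup>2) + 2 * (m\<^sup>2 * L2_norm_sq G)"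
    using order_trans[OF W_le divide_right_mono[OF gG, of "c\<^sup>2"]] hG by simp
  also have "\<dots> = (2 * (1 + K * m)\<^sup>2 / c\<^sup>2 + 2 * m\<^sup>2) * L2_norm_sq G"
    by (simp add: algebra_simps)
  finally show ?thesis unfolding G_def .
qed

section \<open>Borel representatives\<close>

lemma borel_representative:
  fixes f :: "'a::euclidean_space \<Rightarrow> 'b::euclidean_space"
  assumes "f \<in> borel_measurable lebesgue"
  shows "\<exists>f'\<in>borel_measurable borel. AE x in lborel. f x = f' x"
proof -
  have "\<exists>g\<in>borel_measurable lborel. AE x in lborel. f x \<bullet> b = g x" for b
    by (rule completion_ex_borel_measurable_real) (intro borel_measurable_inner assms borel_measurable_const)
  then obtain g where g: "\<And>b. g b \<in> borel_measurable lborel" "\<And>b. AE x in lborel. f x \<bullet> b = g b x"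
    by metis
  have [measurable]: "g b \<in> borel_measurable borel" for b using g(1)[of b] by simp
  have "AE x in lborel. \<forall>b\<in>Basis. f x \<bullet> b = g b x"
    by (rule AE_finite_allI) (use g(2) in auto)
  then have "AE x in lborel. f x = (\<Sum>b\<in>Basis. g b x *\<^sub>R b)"
  proof eventually_elim
    case (elim x)
    have "f x = (\<Sum>b\<in>Basis. (f x \<bullet> b) *\<^sub>R b)" by (simp add: euclidean_representation)
    with elim show ?case by simp
  qed
  moreover have "(\<lambda>x. \<Sum>b\<in>Basis. g b x *\<^sub>R b) \<in> borel_measurable borel" by measurable
  ultimately show ?thesis by (rule bexI)
qed

text \<open>Measurability of \<open>f\<close> comes for free from completeness of the Lebesgue measure. This matters for
  integrands containing \<open>B (snd z)\<close>, as a Lebesgue measurable function composed with \<open>snd\<close> is not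
  obviously Lebesgue measurable.\<close>

lemma lebesgue_integral_AE:
  fixes f g :: "'a::euclidean_space \<Rightarrow> 'b::euclidean_space"
  assumes g: "g \<in> borel_measurable borel" and ae: "AE z in lborel. f z = g z"
  shows "(LINT z|lebesgue. f z) = (LINT z|lborel. g z)"
proof -
  have ae': "AE z in lebesgue. f z = g z" by (rule AE_completion[OF ae])
  have gl: "g \<in> borel_measurable lebesgue" using g by (intro measurable_completion) simp
  have "f \<in> borel_measurable lebesgue"
  proof (rule measurableI)
    fix A :: "'b set" assume "A \<in> sets borel"
    then have "g -` A \<inter> space lebesgue \<in> sets lebesgue" by (rule measurable_sets[OF gl])
    then show "f -` A \<inter> space lebesgue \<in> sets lebesgue"
      by (rule completion.in_sets_AE[rotated]) (use ae' in \<open>auto elim: eventually_mono\<close>)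
  qed simp
  then have "(LINT z|lebesgue. f z) = (LINT z|lebesgue. g z)"
    using gl ae' by (rule integral_cong_AE)
  then show ?thesis using lebesgue_integral_borel[OF g] by simp
qed

lemma AE_snd:
  assumes "AE x in lborel. P x"
  shows "AE z in lborel. P (snd (z :: 'a::euclidean_space \<times> 'b::euclidean_space))"
proof -
  obtain N where N: "N \<in> null_sets lborel" "{x. \<not> P x} \<subseteq> N"
    using assms unfolding eventually_ae_filter by auto
  have "UNIV \<times> N \<in> null_sets (lborel \<Otimes>\<^sub>M (lborel :: 'b measure) :: ('a \<times> 'b) measure)"
  proof (rule null_setsI)
    have Ns: "N \<in> sets lborel" using N(1) by auto
    then show "UNIV \<times> N \<in> sets (lborel \<Otimes>\<^sub>M (lborel :: 'b measure) :: ('a \<times> 'b) measure)" by (intro pair_measureI) auto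
    have "emeasure (lborel \<Otimes>\<^sub>M lborel) ((UNIV :: 'a set) \<times> N) = emeasure lborel (UNIV :: 'a set) * emeasure lborel N"
      using Ns by (intro lborel.emeasure_pair_measure_Times) auto
    then show "emeasure (lborel \<Otimes>\<^sub>M lborel) ((UNIV :: 'a set) \<times> N) = 0"
      using N(1) by (simp add: null_setsD1)
  qed
  then have null: "UNIV \<times> N \<in> null_sets (lborel :: ('a \<times> 'b) measure)" by (simp only: lborel_prod)
  show ?thesis by (rule AE_I'[OF null]) (use N(2) in auto)
qed

text \<open>Cutting off the values that exceed the essential bound makes the estimate hold at every point,
  hence on every slice.\<close>

lemma bounded_coefficient_representative:
  fixes M :: "'n::finite \<Rightarrow> complex ^ 'N::finite ^ 'N" and B :: "real ^ 'n \<Rightarrow> complex ^ 'N ^ 'N"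
  assumes B: "B \<in> Linfty"
  shows "\<exists>B' K. B' \<in> borel_measurable borel \<and> K \<ge> 0 \<and> (AE x in lborel. B x = B' x)
    \<and> (\<forall>x a. norm (B' x *v a) \<le> K * norm a)"
proof -
  obtain K1 where Bm: "B \<in> borel_measurable lebesgue" and K1: "AE x in lborel. norm (B x) \<le> K1"
    using B unfolding Linfty_def AE_completion_iff by blast
  obtain B0 where B0 [measurable]: "B0 \<in> borel_measurable borel" and ae: "AE x in lborel. B x = B0 x"
    using borel_representative[OF Bm] by (rule bexE)
  obtain K0 where K0: "K0 \<ge> 0" "\<forall>(A :: complex ^ 'N ^ 'N) a. norm (A *v a) \<le> norm A * norm a * K0"
    using bounded_bilinear.nonneg_bounded[OF bounded_bilinear_matrix_vector] by metis
  define B' where "B' x = (if norm (B0 x) \<le> max K1 0 then B0 x else 0)" for x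
  have "B' \<in> borel_measurable borel" unfolding B'_def[abs_def] by measurable
  moreover have "AE x in lborel. B x = B' x"
    using ae K1 by eventually_elim (auto simp: B'_def)
  moreover have "norm (B' x *v a) \<le> (max K1 0 * K0) * norm a" for x a
  proof -
    have "norm (B' x *v a) \<le> norm (B' x) * norm a * K0" using K0(2) by blast
    also have "\<dots> \<le> max K1 0 * norm a * K0"
      using K0(1) by (intro mult_right_mono) (auto simp: B'_def)
    finally show ?thesis by (simp add: mult_ac)
  qed
  moreover have "max K1 0 * K0 \<ge> 0" using K0(1) by simp
  ultimately show ?thesis by (intro exI conjI allI)
qed

lemma accretive_representative:
  fixes f :: "real ^ 'n \<Rightarrow> complex ^ 'N"
  assumes acc: "Re (L2_inner (\<lambda>x. B x *v f x) f) \<ge> c * (L2_norm f)\<^sup>2"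
    and f: "bounded_bsupp f" and B' [measurable]: "B' \<in> borel_measurable borel" and ae: "AE x in lborel. B x = B' x"
    and K: "\<And>x a. norm (B' x *v a) \<le> K * norm a"
  shows "c * L2_norm_sq f \<le> (LINT x|lborel. (B' x *v f x) \<bullet> f x)"
proof -
  have [measurable]: "f \<in> borel_measurable borel" using f by measurable
  have "(L2_norm f)\<^sup>2 = (LINT x|lebesgue. (norm (f x))\<^sup>2)"
    unfolding L2_norm_def by (simp add: Bochner_Integration.integral_nonneg)
  also have "\<dots> = L2_norm_sq f" unfolding L2_norm_sq_def by (rule lebesgue_integral_borel) measurable
  finally have n: "(L2_norm f)\<^sup>2 = L2_norm_sq f" .
  have m: "(\<lambda>x. \<Sum>i\<in>UNIV. (B' x *v f x) $ i * cnj (f x $ i)) \<in> borel_measurable borel"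
    by (intro borel_measurable_sum hermitian_measurable) measurable
  have "L2_inner (\<lambda>x. B x *v f x) f = (LINT x|lborel. (\<Sum>i\<in>UNIV. (B' x *v f x) $ i * cnj (f x $ i)))"
    unfolding L2_inner_def by (rule lebesgue_integral_AE[OF m]) (use ae in eventually_elim, simp)
  also have "\<dots> = L2_inner (\<lambda>x. B' x *v f x) f"
    unfolding L2_inner_def by (rule lebesgue_integral_borel[OF m, symmetric])
  also have "bounded_bsupp (\<lambda>x. B' x *v f x)" by (rule bounded_bsupp_bound[OF f _ K]) measurable
  then have "Re (L2_inner (\<lambda>x. B' x *v f x) f) = (LINT x|lborel. (B' x *v f x) \<bullet> f x)"
    by (rule Re_L2_inner[OF _ f])
  finally show ?thesis using acc n by simp
qed

lemma L2_loc_representative: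
  fixes f :: "'a::euclidean_space \<Rightarrow> 'b::euclidean_space"
  assumes f: "f \<in> L2_loc \<Omega>" and S: "compact S" "S \<subseteq> \<Omega>"
  shows "\<exists>f'. L2_bsupp f' \<and> (AE z in lborel. z \<in> S \<longrightarrow> f z = f' z)"
proof -
  have Sb [measurable]: "S \<in> sets borel" using S(1) by (simp add: compact_imp_closed)
  have "f \<in> borel_measurable (lebesgue_on S)"
    using f S(2) unfolding L2_loc_def by (blast intro: measurable_restrict_mono)
  then have m: "(\<lambda>z. indicator S z *\<^sub>R f z) \<in> borel_measurable lebesgue"
    by (subst (asm) borel_measurable_restrict_space_iff) auto
  obtain f0 where f0 [measurable]: "f0 \<in> borel_measurable borel"
    and ae: "AE z in lborel. indicator S z *\<^sub>R f z = f0 z"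
    using borel_representative[OF m] by (rule bexE)
  \<comment> \<open>Vanishing off \<open>S\<close> provides the bounded support.\<close>
  define f' where "f' z = indicator S z *\<^sub>R f0 z" for z
  have fm [measurable]: "f' \<in> borel_measurable borel" unfolding f'_def[abs_def] by measurable
  have eq: "AE z in lborel. z \<in> S \<longrightarrow> f z = f' z"
    using ae by eventually_elim (auto simp: f'_def)
  have "integrable lebesgue (\<lambda>z. indicator S z *\<^sub>R (norm (f z))\<^sup>2)"
    using f S unfolding L2_loc_def set_integrable_def by blast
  then have "integrable lebesgue (\<lambda>z. (norm (f' z))\<^sup>2)"
  proof (rule integrable_cong_AE_imp)
    have "(\<lambda>z. (norm (f' z))\<^sup>2) \<in> borel_measurable lborel" by measurable
    then show "(\<lambda>z. (norm (f' z))\<^sup>2) \<in> borel_measurable lebesgue" by (rule measurable_completion)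
    show "AE z in lebesgue. indicator S z *\<^sub>R (norm (f z))\<^sup>2 = (norm (f' z))\<^sup>2"
      unfolding AE_completion_iff using eq by eventually_elim (auto simp: f'_def indicator_def)
  qed
  then have "integrable lborel (\<lambda>z. (norm (f' z))\<^sup>2)"
    by (subst (asm) integrable_completion) measurable
  moreover obtain R where "\<forall>z\<in>S. norm z \<le> R"
    using compact_imp_bounded[OF S(1)] bounded_iff by blast
  then have "\<forall>z. norm z > R \<longrightarrow> f' z = 0" by (auto simp: f'_def indicator_def)
  ultimately have "L2_bsupp f'" using fm unfolding L2_bsupp_def by blast
  with eq show ?thesis by blast
qed

text \<open>Test functions supported in \<open>S\<close>, and their derivatives, vanish off \<open>S\<close>; therefore representatives
  on \<open>S\<close> suffice, although \<open>v'\<close> and \<open>w'\<close> need not satisfy the equation on \<open>\<Omega>\<close>.\<close>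

lemma weak_diffop_representative:
  fixes e :: "'n::finite \<Rightarrow> 'a::euclidean_space" and v w v' w' :: "'a \<Rightarrow> complex ^ 'N"
  assumes weak: "weak_diffop \<Omega> e M v w" and S: "S \<subseteq> \<Omega>" and e: "\<And>j. e j \<in> Basis"
    and L: "L2_bsupp v'" "L2_bsupp w'"
    and ae: "AE z in lborel. z \<in> S \<longrightarrow> v z = v' z" "AE z in lborel. z \<in> S \<longrightarrow> w z = w' z"
  shows "weak_diffop S e M v' w'"
  unfolding weak_diffop_def
proof (intro allI impI)
  fix \<phi> :: "'a \<Rightarrow> real" assume \<phi>: "test_function S \<phi>"
  then have "test_function \<Omega> \<phi>" using S by (auto simp: test_function_def)
  note eq = weak[unfolded weak_diffop_def, rule_format, OF this]
  have [measurable]: "v' \<in> borel_measurable borel" "w' \<in> borel_measurable borel" "\<phi> \<in> borel_measurable borel"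
    "\<And>j. (\<lambda>z. frechet_derivative \<phi> (at z) (e j)) \<in> borel_measurable borel"
    using L test_function_bounded_bsupp[OF \<phi>] test_function_partial_bounded_bsupp[OF \<phi> e] by (simp_all add: L2_bsupp_def bounded_bsupp_def)
  let ?l = "\<lambda>z. \<phi> z *\<^sub>R w' z"
  let ?r = "\<lambda>z. \<Sum>j\<in>UNIV. frechet_derivative \<phi> (at z) (e j) *\<^sub>R (M j *v v' z)"
  have m: "?l \<in> borel_measurable borel" "?r \<in> borel_measurable borel" by measurable
  have "(LINT z|lebesgue. \<phi> z *\<^sub>R w z) = (LINT z|lborel. ?l z)"
  proof (rule lebesgue_integral_AE[OF m(1)])
    show "AE z in lborel. \<phi> z *\<^sub>R w z = ?l z"
      using ae(2) by eventually_elim (use test_function_zero_outside(1)[OF \<phi>] in fastforce)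
  qed
  moreover have "(LINT z|lebesgue. (\<Sum>j\<in>UNIV. frechet_derivative \<phi> (at z) (e j) *\<^sub>R (M j *v v z))) = (LINT z|lborel. ?r z)"
  proof (rule lebesgue_integral_AE[OF m(2)])
    show "AE z in lborel. (\<Sum>j\<in>UNIV. frechet_derivative \<phi> (at z) (e j) *\<^sub>R (M j *v v z)) = ?r z"
      using ae(1)
    proof eventually_elim
      case (elim z)
      then show ?case by (cases "z \<in> S") (simp_all add: test_function_zero_outside(2)[OF \<phi>])
    qed
  qed
  ultimately show "(LINT z|lebesgue. ?l z) = - (LINT z|lebesgue. ?r z)"
    using eq unfolding lebesgue_integral_borel[OF m(1)] lebesgue_integral_borel[OF m(2)] by simp
qed

lemma weak_deriv_representative:
  fixes e :: "'a::euclidean_space" and v g v' g' :: "'a \<Rightarrow> 'b::euclidean_space"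
  assumes weak: "weak_deriv \<Omega> e v g" and S: "S \<subseteq> \<Omega>" and e: "e \<in> Basis"
    and L: "L2_bsupp v'" "L2_bsupp g'"
    and ae: "AE z in lborel. z \<in> S \<longrightarrow> v z = v' z" "AE z in lborel. z \<in> S \<longrightarrow> g z = g' z"
  shows "weak_deriv S e v' g'"
  unfolding weak_deriv_def
proof (intro allI impI)
  fix \<phi> :: "'a \<Rightarrow> real" assume \<phi>: "test_function S \<phi>"
  then have "test_function \<Omega> \<phi>" using S by (auto simp: test_function_def)
  note eq = weak[unfolded weak_deriv_def, rule_format, OF this]
  have [measurable]: "v' \<in> borel_measurable borel" "g' \<in> borel_measurable borel" "\<phi> \<in> borel_measurable borel"
    "(\<lambda>z. frechet_derivative \<phi> (at z) e) \<in> borel_measurable borel"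
    using L test_function_bounded_bsupp[OF \<phi>] test_function_partial_bounded_bsupp[OF \<phi> e] by (simp_all add: L2_bsupp_def bounded_bsupp_def)
  let ?l = "\<lambda>z. \<phi> z *\<^sub>R g' z"
  let ?r = "\<lambda>z. frechet_derivative \<phi> (at z) e *\<^sub>R v' z"
  have m: "?l \<in> borel_measurable borel" "?r \<in> borel_measurable borel" by measurable
  have "(LINT z|lebesgue. \<phi> z *\<^sub>R g z) = (LINT z|lborel. ?l z)"
  proof (rule lebesgue_integral_AE[OF m(1)])
    show "AE z in lborel. \<phi> z *\<^sub>R g z = ?l z"
      using ae(2) by eventually_elim (use test_function_zero_outside(1)[OF \<phi>] in fastforce)
  qed
  moreover have "(LINT z|lebesgue. frechet_derivative \<phi> (at z) e *\<^sub>R v z) = (LINT z|lborel. ?r z)"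
  proof (rule lebesgue_integral_AE[OF m(2)])
    show "AE z in lborel. frechet_derivative \<phi> (at z) e *\<^sub>R v z = ?r z"
      using ae(1) by eventually_elim (use test_function_zero_outside(2)[OF \<phi>] in fastforce)
  qed
  ultimately show "(LINT z|lebesgue. ?l z) = - (LINT z|lebesgue. ?r z)"
    using eq unfolding lebesgue_integral_borel[OF m(1)] lebesgue_integral_borel[OF m(2)] by simp
qed

section \<open>Complex cutoffs\<close>

lemma test_function_Re_Im:
  fixes \<eta> :: "'a::euclidean_space \<Rightarrow> complex"
  assumes \<eta>: "test_function UNIV \<eta>"
  shows "test_function (supp \<eta>) (\<lambda>z. Re (\<eta> z))" and "test_function (supp \<eta>) (\<lambda>z. Im (\<eta> z))"
    and "(grad_norm \<eta> z)\<^sup>2 = (grad_norm (\<lambda>z. Re (\<eta> z)) z)\<^sup>2 + (grad_norm (\<lambda>z. Im (\<eta> z)) z)\<^sup>2"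
proof -
  have sm: "smooth \<eta>" and c: "compact (supp \<eta>)" using \<eta> by (auto simp: test_function_def)
  show "test_function (supp \<eta>) (\<lambda>z. Re (\<eta> z))"
    by (rule test_functionI[OF smooth_bounded_linear_compose[OF bounded_linear_Re sm] c])
       (use not_supp_zero in fastforce)+
  show "test_function (supp \<eta>) (\<lambda>z. Im (\<eta> z))"
    by (rule test_functionI[OF smooth_bounded_linear_compose[OF bounded_linear_Im sm] c])
       (use not_supp_zero in fastforce)+
  have "frechet_derivative (\<lambda>z. Re (\<eta> z)) (at z) e = Re (frechet_derivative \<eta> (at z) e)"
    and "frechet_derivative (\<lambda>z. Im (\<eta> z)) (at z) e = Im (frechet_derivative \<eta> (at z) e)" for e
    using fun_cong[OF frechet_derivative_at[OF bounded_linear.has_derivative[OF bounded_linear_Re smooth_has_derivative[OF sm]]], of z e]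
      fun_cong[OF frechet_derivative_at[OF bounded_linear.has_derivative[OF bounded_linear_Im smooth_has_derivative[OF sm]]], of z e]
    by simp_all
  then show "(grad_norm \<eta> z)\<^sup>2 = (grad_norm (\<lambda>z. Re (\<eta> z)) z)\<^sup>2 + (grad_norm (\<lambda>z. Im (\<eta> z)) z)\<^sup>2"
    by (simp add: grad_norm_def sum_nonneg cmod_power2 flip: sum.distrib)
qed

text \<open>Serves both sides of the estimate: \<open>r\<close> is \<open>\<bar>\<eta>\<bar>\<close> or \<open>\<bar>\<nabla>\<eta>\<bar>\<close>, and \<open>a\<close>, \<open>b\<close> are the
  corresponding functions for the real and imaginary parts of \<open>\<eta>\<close>.\<close>

lemma nn_integral_two_cutoffs:
  fixes f f' :: "'a::euclidean_space \<Rightarrow> 'b::euclidean_space"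
  assumes ae: "AE z in lborel. z \<in> S \<longrightarrow> f z = f' z" and r: "\<And>z. z \<notin> S \<Longrightarrow> r z = 0"
    and sq: "\<And>z. (r z)\<^sup>2 = (a z)\<^sup>2 + (b z)\<^sup>2"
    and L: "L2_bsupp (\<lambda>z. a z *\<^sub>R f' z)" "L2_bsupp (\<lambda>z. b z *\<^sub>R f' z)"
  shows "(\<integral>\<^sup>+ z. ennreal ((norm (f z))\<^sup>2 * (r z)\<^sup>2) \<partial>lebesgue)
    = ennreal (L2_norm_sq (\<lambda>z. a z *\<^sub>R f' z) + L2_norm_sq (\<lambda>z. b z *\<^sub>R f' z))"
proof -
  let ?h = "\<lambda>z. (norm (a z *\<^sub>R f' z))\<^sup>2 + (norm (b z *\<^sub>R f' z))\<^sup>2"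
  have int: "integrable lborel ?h"
    by (intro Bochner_Integration.integrable_add L2_bsupp_square_integrable L)
  have "(\<integral>\<^sup>+ z. ennreal ((norm (f z))\<^sup>2 * (r z)\<^sup>2) \<partial>lebesgue) = (\<integral>\<^sup>+ z. ennreal (?h z) \<partial>lebesgue)"
  proof (rule nn_integral_cong_AE)
    have "AE z in lborel. ennreal ((norm (f z))\<^sup>2 * (r z)\<^sup>2) = ennreal (?h z)"
      using ae
    proof eventually_elim
      case (elim z)
      have "?h z = (norm (f' z))\<^sup>2 * (r z)\<^sup>2"
        by (simp add: sq power_mult_distrib algebra_simps)
      then show ?case using elim r[of z] by (cases "z \<in> S") simp_all
    qed
    then show "AE z in lebesgue. ennreal ((norm (f z))\<^sup>2 * (r z)\<^sup>2) = ennreal (?h z)"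
      by (rule AE_completion)
  qed
  also have "\<dots> = (\<integral>\<^sup>+ z. ennreal (?h z) \<partial>lborel)" by (rule nn_integral_completion)
  also have "\<dots> = ennreal (LINT z|lborel. ?h z)"
    by (rule nn_integral_eq_integral[OF int]) simp
  also have "(LINT z|lborel. ?h z) = L2_norm_sq (\<lambda>z. a z *\<^sub>R f' z) + L2_norm_sq (\<lambda>z. b z *\<^sub>R f' z)"
    unfolding L2_norm_sq_def by (rule Bochner_Integration.integral_add[OF L2_bsupp_square_integrable[OF L(1)] L2_bsupp_square_integrable[OF L(2)]])
  finally show ?thesis .
qed

theorem lemma5p2:
  fixes M :: "'n::finite \<Rightarrow> complex ^ 'N::finite ^ 'N"
    and B :: "real ^ 'n \<Rightarrow> complex ^ 'N ^ 'N"
  assumes D_selfadjoint: "selfadjoint_L2 (diffop M)"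
    and D_coercive: "\<exists>c>0. \<forall>f g. f \<in> op_ran (diffop M) \<and> diffop M f g \<longrightarrow>
          (\<exists>G\<in>L2. weak_gradient f G \<and> L2_norm g \<ge> c * L2_norm G)"
    and B_bounded: "B \<in> Linfty"
    and B_accretive: "\<exists>c>0. \<forall>f\<in>op_ran (diffop M).
          Re (L2_inner (\<lambda>x. B x *v f x) f) \<ge> c * (L2_norm f)\<^sup>2"
  shows "\<exists>C::real. \<forall>(\<eta> :: real \<times> (real ^ 'n) \<Rightarrow> complex) \<Omega> v w.
          test_function UNIV \<eta> \<and> open \<Omega> \<and> supp \<eta> \<subseteq> \<Omega> \<and> solves M B \<Omega> v w \<longrightarrow>
          (\<integral>\<^sup>+ z. ennreal ((norm (w z))\<^sup>2 * (norm (\<eta> z))\<^sup>2) \<partial>lebesgue)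
            \<le> ennreal C * (\<integral>\<^sup>+ z. ennreal ((norm (v z))\<^sup>2 * (grad_norm \<eta> z)\<^sup>2) \<partial>lebesgue)"
proof -
  obtain c where c: "c > 0"
    and acc0: "\<forall>f\<in>op_ran (diffop M). Re (L2_inner (\<lambda>x. B x *v f x) f) \<ge> c * (L2_norm f)\<^sup>2"
    using B_accretive by blast
  obtain B' K where B' [measurable]: "B' \<in> borel_measurable borel" and K0: "K \<ge> 0"
    and aeB: "AE x in lborel. B x = B' x" and K: "\<forall>x a. norm (B' x *v a) \<le> K * norm a"
    using bounded_coefficient_representative[OF B_bounded] by (elim exE conjE) (rule that)
  have acc: "c * L2_norm_sq f \<le> (LINT x|lborel. (B' x *v f x) \<bullet> f x)" if "f \<in> op_ran (diffop M)" "bounded_bsupp f" for f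
    by (rule accretive_representative[OF bspec[OF acc0 that(1)] that(2) B' aeB K[rule_format]])
  define m where "m = (\<Sum>j\<in>UNIV. onorm ((*v) (M j)))"
  define C where "C = 2 * (1 + K * m)\<^sup>2 / c\<^sup>2 + 2 * m\<^sup>2"
  have C0: "C \<ge> 0" by (simp add: C_def)
  show ?thesis
  proof (intro exI[of _ C] allI impI, elim conjE)
    fix \<eta> :: "real \<times> (real ^ 'n) \<Rightarrow> complex" and \<Omega> v w
    assume \<eta>: "test_function UNIV \<eta>" and \<Omega>: "supp \<eta> \<subseteq> \<Omega>" and sol: "solves M B \<Omega> v w"
    define S where "S = supp \<eta>"
    define \<alpha> where "\<alpha> = (\<lambda>z. Re (\<eta> z))"
    define \<beta> where "\<beta> = (\<lambda>z. Im (\<eta> z))"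
    have S: "compact S" "S \<subseteq> \<Omega>" using \<eta> \<Omega> by (auto simp: S_def test_function_def)
    have t\<alpha>: "test_function S \<alpha>" and t\<beta>: "test_function S \<beta>"
      unfolding S_def \<alpha>_def \<beta>_def by (rule test_function_Re_Im[OF \<eta>])+
    obtain v' where v': "L2_bsupp v'" "AE z in lborel. z \<in> S \<longrightarrow> v z = v' z"
      using L2_loc_representative[OF _ S, of v] sol by (auto simp: solves_def)
    obtain w' where w': "L2_bsupp w'" "AE z in lborel. z \<in> S \<longrightarrow> w z = w' z"
      using L2_loc_representative[OF _ S, of w] sol by (auto simp: solves_def)
    have [measurable]: "w' \<in> borel_measurable borel" using w'(1) by measurable
    have D: "weak_diffop S (\<lambda>j. (0, axis j 1)) M v' w'"
      using sol by (intro weak_diffop_representative[OF _ S(2) basis_space v'(1) w'(1) v'(2) w'(2)]) (simp add: solves_def)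
    have LB: "L2_bsupp (\<lambda>z. - (B' (snd z) *v w' z))"
      by (intro L2_bsupp_uminus L2_bsupp_coefficient[OF B' K[rule_format]] w'(1))
    have aeg: "AE z in lborel. z \<in> S \<longrightarrow> (case z of (t, x) \<Rightarrow> - (B x *v w (t, x))) = - (B' (snd z) *v w' z)"
      using AE_snd[OF aeB] w'(2) by eventually_elim (auto simp: split_beta)
    have T: "weak_deriv S (1, 0) v' (\<lambda>z. - (B' (snd z) *v w' z))"
      using sol by (intro weak_deriv_representative[OF _ S(2) basis_time v'(1) LB v'(2) aeg]) (simp add: solves_def)
    have main: "L2_norm_sq (\<lambda>z. \<gamma> z *\<^sub>R w' z) \<le> C * L2_norm_sq (\<lambda>z. grad_norm \<gamma> z *\<^sub>R v' z)"
      if "test_function S \<gamma>" for \<gamma> :: "real \<times> (real ^ 'n) \<Rightarrow> real"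
      unfolding C_def m_def
      by (rule Caccioppoli_real_cutoff[OF D_selfadjoint c acc B' K0 K[rule_format] that v'(1) w'(1) D T])
    have lhs: "(\<integral>\<^sup>+ z. ennreal ((norm (w z))\<^sup>2 * (norm (\<eta> z))\<^sup>2) \<partial>lebesgue)
        = ennreal (L2_norm_sq (\<lambda>z. \<alpha> z *\<^sub>R w' z) + L2_norm_sq (\<lambda>z. \<beta> z *\<^sub>R w' z))"
    proof (rule nn_integral_two_cutoffs[OF w'(2)])
      show "norm (\<eta> z) = 0" if "z \<notin> S" for z
        using that by (simp add: S_def not_supp_zero)
      show "(norm (\<eta> z))\<^sup>2 = (\<alpha> z)\<^sup>2 + (\<beta> z)\<^sup>2" for z
        by (simp add: \<alpha>_def \<beta>_def cmod_power2)
      show "L2_bsupp (\<lambda>z. \<alpha> z *\<^sub>R w' z)" "L2_bsupp (\<lambda>z. \<beta> z *\<^sub>R w' z)"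
        by (intro L2_bsupp_scaleR test_function_bounded_bsupp[OF t\<alpha>] test_function_bounded_bsupp[OF t\<beta>] w'(1))+
    qed
    have rhs: "(\<integral>\<^sup>+ z. ennreal ((norm (v z))\<^sup>2 * (grad_norm \<eta> z)\<^sup>2) \<partial>lebesgue)
        = ennreal (L2_norm_sq (\<lambda>z. grad_norm \<alpha> z *\<^sub>R v' z) + L2_norm_sq (\<lambda>z. grad_norm \<beta> z *\<^sub>R v' z))"
    proof (rule nn_integral_two_cutoffs[OF v'(2)])
      show "grad_norm \<eta> z = 0" if "z \<notin> S" for z
        using that by (simp add: S_def grad_norm_def frechet_derivative_outside_supp)
      show "(grad_norm \<eta> z)\<^sup>2 = (grad_norm \<alpha> z)\<^sup>2 + (grad_norm \<beta> z)\<^sup>2" for z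
        unfolding \<alpha>_def \<beta>_def by (rule test_function_Re_Im(3)[OF \<eta>])
      show "L2_bsupp (\<lambda>z. grad_norm \<alpha> z *\<^sub>R v' z)" "L2_bsupp (\<lambda>z. grad_norm \<beta> z *\<^sub>R v' z)"
        by (intro L2_bsupp_scaleR grad_norm_bounded_bsupp[OF t\<alpha>] grad_norm_bounded_bsupp[OF t\<beta>] v'(1))+
    qed
    show "(\<integral>\<^sup>+ z. ennreal ((norm (w z))\<^sup>2 * (norm (\<eta> z))\<^sup>2) \<partial>lebesgue)
        \<le> ennreal C * (\<integral>\<^sup>+ z. ennreal ((norm (v z))\<^sup>2 * (grad_norm \<eta> z)\<^sup>2) \<partial>lebesgue)"
      unfolding lhs rhs ennreal_mult[OF C0 add_nonneg_nonneg[OF L2_norm_sq_nonneg L2_norm_sq_nonneg], symmetric]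
      using main[OF t\<alpha>] main[OF t\<beta>] by (intro ennreal_leI) (simp add: algebra_simps)
  qed
qed

end
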